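(* Let $d\geq 1$, let $X$ be a $d$-dimensional cell complex that is acyclic in positive codimension (APC), and let $\hat L=\hat L^{\rm ud}_{X,d-1}$ be its weighted up-down Laplacian. (1) $$\hat\pi_d(X) = \frac{\hat\tau_d(X)\,\tau_{d-1}(X)}{|\tilde H_{d-2}(X;\mathbb{Z})|^2}.$$ (2) Let $U$ be the set of $(d-1)$-cells of a cellular spanning $(d-1)$-tree of $X$, let $X_U=U\cup X_{(d-2)}$, and let $\hat L_U$ be the reduced Laplacian obtained by deleting the rows and columns of $\hat L$ corresponding to $U$. Then $$\hat\tau_d(X) = \frac{|\tilde H_{d-2}(X;\mathbb{Z})|^2}{|\tilde H_{d-2}(X_U;\mathbb{Z})|^2}\,\det\hat L_U.$$
   Context: A cell complex is a finite CW complex. $X_i$ denotes the set of $i$-dimensional cells of $X$ and $X_{(i)}=X_0\cup\cdots\cup X_i$ its $i$-skeleton ($X_{(-1)}=\emptyset$). $C_i(X)$ is the free $\mathbb{Z}$-module with basis $X_i$; $\partial_{X,i}\colon C_i(X)\to C_{i-1}(X)$ is the cellular boundary map, viewed as an integer matrix with rows indexed by $X_{i-1}$ and columns indexed by $X_i$. $\tilde H_i$ denotes reduced cellular homology (so $\tilde H_{-1}$ of a nonempty complex is $0$), and $\tilde\beta_i(X)$ is the rank of $\tilde H_i(X;\mathbb{Z})$. $X$ is acyclic in positive codimension (APC) if $\tilde\beta_j(X)=0$ for all $j<\dim X$. A cellular spanning $k$-tree ($k$-CST) of $X$, for $0\le k\leq \dim X$, is a $k$-dimensional subcomplex $Y\subseteq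 X$ (a subcomplex of $X_{(k)}$; the degenerate case in which $Y$ has no $k$-cells is allowed) with $Y_{(k-1)}=X_{(k-1)}$ such that $\tilde H_k(Y;\mathbb{Z})=0$, $|\tilde H_{k-1}(Y;\mathbb{Z})|<\infty$, and $|Y_k|=|X_k|-\tilde\beta_k(X_{(k)})+\tilde\beta_{k-1}(X_{(k)})$. The set of all $k$-CSTs of $X$ is $\mathcal{T}_k(X)$, and $\tau_k(X)=\sum_{Y\in\mathcal{T}_k(X)}|\tilde H_{k-1}(Y;\mathbb{Z})|^2$. Weights: introduce an indeterminate $x_f$ for each $f\in X_d$. The weighted boundary matrix $\hat\partial_{X,d}$ is obtained from $\partial_{X,d}$ by multiplying the column of each $d$-cell $f$ by $x_f$; the weighted coboundary $\hat\partial^*_{X,d}$ is its transpose; and $\hat L^{\rm ud}_{X,d-1}=\hat\partial_{X,d}\hat\partial^*_{X,d}$, with rows and columns indexed by $X_{d-1}$. $\hat\pi_d(X)$ is the product, with multiplicity, of the nonzero eigenvalues of $\hat L^{\rm ud}_{X,d-1}$ (in an algebraic closure of the field of rational functions in the $x_f$), and $$\hat\tau_d(X)=\sum_{Y\in\mathcal{T}_d(X)}|\tilde H_{d-1}(Y;\mathbb{Z})|^2\prod_{f\in Y_d}x_f^2.$$ Empty products and determinants of empty matrices are $1$. *)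

theory Defs
  imports
    "HOL-Homology.Homology"
    "HOL-Algebra.Algebraic_Closure_Type"
    "HOL-Algebra.Free_Abelian_Groups"
    "HOL-Computational_Algebra.Fraction_Field"
    "Jordan_Normal_Form.Char_Poly"
begin

subsection \<open>Finite CW complexes\<close>

text \<open>The unit disc, open disc and bounding sphere in \<open>\<real>\<^sup>n\<close> (embedded in \<^typ>\<open>nat \<Rightarrow> real\<close>
  as in \<^const>\<open>Euclidean_space\<close>). For \<open>n = 0\<close> the disc and open disc are a point and the
  sphere is empty; \<open>disc_sphere (Suc n)\<close> is \<open>topspace (nsphere n)\<close>.\<close>

definition sq_norm :: "nat \<Rightarrow> (nat \<Rightarrow> real) \<Rightarrow> real" where
  "sq_norm n x = (\<Sum>i<n. x i ^ 2)"

definition closed_disc :: "nat \<Rightarrow> (nat \<Rightarrow> real) set" where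
  "closed_disc n = {x \<in> topspace (Euclidean_space n). sq_norm n x \<le> 1}"

definition open_disc :: "nat \<Rightarrow> (nat \<Rightarrow> real) set" where
  "open_disc n = {x \<in> topspace (Euclidean_space n). sq_norm n x < 1}"

definition disc_sphere :: "nat \<Rightarrow> (nat \<Rightarrow> real) set" where
  "disc_sphere n = {x \<in> topspace (Euclidean_space n). sq_norm n x = 1}"

record ('a, 'c) cell_structure =
  carrier_space :: "'a topology"
  cells :: "'c set"
  cell_dim :: "'c \<Rightarrow> nat"
  char_map :: "'c \<Rightarrow> (nat \<Rightarrow> real) \<Rightarrow> 'a"

definition open_cell :: "('a, 'c) cell_structure \<Rightarrow> 'c \<Rightarrow> 'a set" where
  "open_cell K c = char_map K c ` open_disc (cell_dim K c)"

text \<open>Closure-finiteness and the weak topology are automatic, since there are finitely many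
  cells and the closed cells are compact.\<close>

definition finite_CW :: "('a, 'c) cell_structure \<Rightarrow> bool" where
  "finite_CW K \<longleftrightarrow>
     Hausdorff_space (carrier_space K) \<and>
     finite (cells K) \<and>
     disjoint_family_on (open_cell K) (cells K) \<and>
     (\<Union>c\<in>cells K. open_cell K c) = topspace (carrier_space K) \<and>
     (\<forall>c\<in>cells K.
        continuous_map (subtopology (Euclidean_space (cell_dim K c)) (closed_disc (cell_dim K c)))
          (carrier_space K) (char_map K c) \<and>
        homeomorphic_map (subtopology (Euclidean_space (cell_dim K c)) (open_disc (cell_dim K c)))
          (subtopology (carrier_space K) (open_cell K c)) (char_map K c) \<and>
        char_map K c ` disc_sphere (cell_dim K c)
          \<subseteq> (\<Union>b\<in>{b \<in> cells K. cell_dim K b < cell_dim K c}. open_cell K b))"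

definition CW_dim :: "('a, 'c) cell_structure \<Rightarrow> nat" where
  "CW_dim K = Max (cell_dim K ` cells K)"

text \<open>Dimensions are integers here so that \<open>-1\<close> is available.\<close>

definition k_cells :: "('a, 'c) cell_structure \<Rightarrow> int \<Rightarrow> 'c set" where
  "k_cells K k = {c \<in> cells K. int (cell_dim K c) = k}"

definition skeleton_cells :: "('a, 'c) cell_structure \<Rightarrow> int \<Rightarrow> 'c set" where
  "skeleton_cells K k = {c \<in> cells K. int (cell_dim K c) \<le> k}"

definition subcomplex :: "('a, 'c) cell_structure \<Rightarrow> 'c set \<Rightarrow> bool" where
  "subcomplex K Y \<longleftrightarrow> Y \<subseteq> cells K \<and>
     (\<forall>c\<in>Y. char_map K c ` closed_disc (cell_dim K c) \<subseteq> (\<Union>b\<in>Y. open_cell K b))"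

text \<open>A subcomplex, given by its set of cells, as a complex in its own right.\<close>

definition on_cells :: "('a, 'c) cell_structure \<Rightarrow> 'c set \<Rightarrow> ('a, 'c) cell_structure" where
  "on_cells K Y = K\<lparr>carrier_space := subtopology (carrier_space K) (\<Union>c\<in>Y. open_cell K c),
                    cells := Y\<rparr>"

subsection \<open>Reduced cellular homology\<close>

text \<open>The map \<open>D\<^sup>n \<rightarrow> S\<^sup>n\<close>, \<open>y \<mapsto> (2 \<surd>(1 - |y|\<^sup>2) y, 2 |y|\<^sup>2 - 1)\<close>, which collapses the boundary of the
  disc to the pole \<open>(0, \<dots>, 0, 1)\<close> and induces a homeomorphism \<open>D\<^sup>n / S\<^sup>n\<^sup>-\<^sup>1 \<cong> S\<^sup>n\<close>.\<close>

definition wrap_disc :: "nat \<Rightarrow> (nat \<Rightarrow> real) \<Rightarrow> (nat \<Rightarrow> real)" where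
  "wrap_disc n y = (\<lambda>i. if i < n then 2 * sqrt (1 - sq_norm n y) * y i
                        else if i = n then 2 * sq_norm n y - 1 else 0)"

definition sphere_pole :: "nat \<Rightarrow> (nat \<Rightarrow> real)" where
  "sphere_pole n = (\<lambda>i. if i = n then 1 else 0)"

text \<open>For an \<open>n\<close>-cell \<open>s\<close> and the \<open>n\<close>-skeleton \<open>K\<^sub>(\<^sub>n\<^sub>)\<close>, this is the quotient map
  \<open>K\<^sub>(\<^sub>n\<^sub>) \<rightarrow> K\<^sub>(\<^sub>n\<^sub>) / (K\<^sub>(\<^sub>n\<^sub>) - s) \<cong> S\<^sup>n\<close>.\<close>

definition collapse_onto :: "('a, 'c) cell_structure \<Rightarrow> 'c \<Rightarrow> 'a \<Rightarrow> (nat \<Rightarrow> real)" where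
  "collapse_onto K s x =
     (if x \<in> open_cell K s
      then wrap_disc (cell_dim K s) (inv_into (open_disc (cell_dim K s)) (char_map K s) x)
      else sphere_pole (cell_dim K s))"

text \<open>The incidence number of an \<open>(n+1)\<close>-cell \<open>f\<close> and an \<open>n\<close>-cell \<open>s\<close> is the degree of
  \<open>S\<^sup>n \<rightarrow> K\<^sub>(\<^sub>n\<^sub>) \<rightarrow> S\<^sup>n\<close>, the attaching map of \<open>f\<close> followed by the collapse onto \<open>s\<close>. The cells
  are oriented by their characteristic maps. The identification \<open>D\<^sup>n / S\<^sup>n\<^sup>-\<^sup>1 \<cong> S\<^sup>n\<close> is fixed, so
  any other convention changes the boundary map in each dimension at most by a global sign.\<close>

definition incidence :: "('a, 'c) cell_structure \<Rightarrow> 'c \<Rightarrow> 'c \<Rightarrow> int" where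
  "incidence K s f = Brouwer_degree2 (cell_dim K s) (collapse_onto K s \<circ> char_map K f)"

text \<open>The augmented cellular chain complex: \<^const>\<open>None\<close> is the generator in degree \<open>-1\<close>.\<close>

definition chain_basis :: "('a, 'c) cell_structure \<Rightarrow> int \<Rightarrow> 'c option set" where
  "chain_basis K j = (if j = -1 then {None} else Some ` k_cells K j)"

definition chain_group :: "('a, 'c) cell_structure \<Rightarrow> int \<Rightarrow> ('c option \<Rightarrow>\<^sub>0 int) monoid" where
  "chain_group K j = free_Abelian_group (chain_basis K j)"

fun basis_boundary :: "('a, 'c) cell_structure \<Rightarrow> 'c option \<Rightarrow> ('c option \<Rightarrow>\<^sub>0 int)" where
  "basis_boundary K None = 0"
| "basis_boundary K (Some f) =
     (if cell_dim K f = 0 then frag_of None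
      else (\<Sum>s\<in>k_cells K (int (cell_dim K f) - 1). frag_cmul (incidence K s f) (frag_of (Some s))))"

definition cell_boundary ::
    "('a, 'c) cell_structure \<Rightarrow> ('c option \<Rightarrow>\<^sub>0 int) \<Rightarrow> ('c option \<Rightarrow>\<^sub>0 int)" where
  "cell_boundary K = frag_extend (basis_boundary K)"

definition cycles :: "('a, 'c) cell_structure \<Rightarrow> int \<Rightarrow> ('c option \<Rightarrow>\<^sub>0 int) set" where
  "cycles K j = {z \<in> carrier (chain_group K j). cell_boundary K z = 0}"

definition boundaries :: "('a, 'c) cell_structure \<Rightarrow> int \<Rightarrow> ('c option \<Rightarrow>\<^sub>0 int) set" where
  "boundaries K j = cell_boundary K ` carrier (chain_group K (j + 1))"

definition red_homology ::
    "('a, 'c) cell_structure \<Rightarrow> int \<Rightarrow> ('c option \<Rightarrow>\<^sub>0 int) set monoid" where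
  "red_homology K j = subgroup_generated (chain_group K j) (cycles K j) Mod boundaries K j"

text \<open>The order of the reduced homology group (\<open>0\<close> if the group is infinite).\<close>

abbreviation hom_order :: "('a, 'c) cell_structure \<Rightarrow> int \<Rightarrow> nat" where
  "hom_order K j \<equiv> Coset.order (red_homology K j)"

definition int_independent :: "('g, 'b) monoid_scheme \<Rightarrow> 'g set \<Rightarrow> bool" where
  "int_independent G S \<longleftrightarrow> finite S \<and> S \<subseteq> carrier G \<and>
     (\<forall>a :: 'g \<Rightarrow> int. finprod G (\<lambda>s. s [^]\<^bsub>G\<^esub> a s) S = \<one>\<^bsub>G\<^esub> \<longrightarrow> (\<forall>s\<in>S. a s = 0))"

definition abelian_rank :: "('g, 'b) monoid_scheme \<Rightarrow> nat" where
  "abelian_rank G = Max {card S | S. int_independent G S}"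

definition red_betti :: "('a, 'c) cell_structure \<Rightarrow> int \<Rightarrow> nat" where
  "red_betti K j = abelian_rank (red_homology K j)"

definition APC :: "('a, 'c) cell_structure \<Rightarrow> bool" where
  "APC K \<longleftrightarrow> (\<forall>j < int (CW_dim K). red_betti K j = 0)"

subsection \<open>Cellular spanning trees\<close>

definition spanning_trees :: "('a, 'c) cell_structure \<Rightarrow> nat \<Rightarrow> 'c set set" where
  "spanning_trees K k = {Y.
     subcomplex K Y \<and> Y \<subseteq> skeleton_cells K k \<and>
     skeleton_cells (on_cells K Y) (int k - 1) = skeleton_cells K (int k - 1) \<and>
     trivial_group (red_homology (on_cells K Y) k) \<and>
     finite (carrier (red_homology (on_cells K Y) (int k - 1))) \<and>
     int (card (k_cells (on_cells K Y) k)) =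
       int (card (k_cells K k)) - int (red_betti (on_cells K (skeleton_cells K k)) k)
         + int (red_betti (on_cells K (skeleton_cells K k)) (int k - 1))}"

definition tau :: "('a, 'c) cell_structure \<Rightarrow> nat \<Rightarrow> nat" where
  "tau K k = (\<Sum>Y\<in>spanning_trees K k. (hom_order (on_cells K Y) (int k - 1))\<^sup>2)"

subsection \<open>Weighted Laplacians\<close>

text \<open>The field \<open>\<rat>(x\<^sub>c)\<close> of rational functions, as the fraction field of the polynomial ring over
  \<open>\<int>\<close> in the indeterminates \<open>x\<^sub>c\<close>; monomials are finitely supported exponent functions. The linear
  order on cell labels makes the polynomial ring an instance of \<^class>\<open>idom\<close> and fixes the
  enumeration of rows and columns of matrices; nothing below depends on which order it is.\<close>

type_synonym 'c ratfun = "(('c \<Rightarrow>\<^sub>0 nat) \<Rightarrow>\<^sub>0 int) fract"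

definition indet :: "'c::linorder \<Rightarrow> 'c ratfun" where
  "indet c = Fract (Poly_Mapping.single (Poly_Mapping.single c 1) 1) 1"

definition weighted_boundary ::
    "('a, 'c::linorder) cell_structure \<Rightarrow> 'c \<Rightarrow> 'c \<Rightarrow> 'c ratfun" where
  "weighted_boundary K s f = of_int (incidence K s f) * indet f"

text \<open>The \<open>(s, t)\<close> entry of the product of the weighted boundary matrix, with rows indexed by the
  \<open>(d-1)\<close>-cells and columns by the \<open>d\<close>-cells, and its transpose.\<close>

definition weighted_laplacian ::
    "('a, 'c::linorder) cell_structure \<Rightarrow> nat \<Rightarrow> 'c \<Rightarrow> 'c \<Rightarrow> 'c ratfun" where
  "weighted_laplacian K d s t =
     (\<Sum>f\<in>k_cells K d. weighted_boundary K s f * weighted_boundary K t f)"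

definition square_matrix :: "'c::linorder set \<Rightarrow> ('c \<Rightarrow> 'c \<Rightarrow> 'k) \<Rightarrow> 'k mat" where
  "square_matrix S M =
     mat (card S) (card S) (\<lambda>(i, j). M (sorted_list_of_set S ! i) (sorted_list_of_set S ! j))"

definition prod_nonzero_eigenvalues :: "'k::field mat \<Rightarrow> 'k" where
  "prod_nonzero_eigenvalues A =
     (\<Prod>a\<in>{a. eigenvalue A a \<and> a \<noteq> 0}. a ^ Polynomial.order a (char_poly A))"

definition pi_hat :: "('a, 'c::linorder) cell_structure \<Rightarrow> nat \<Rightarrow> 'c ratfun alg_closure" where
  "pi_hat K d = prod_nonzero_eigenvalues
     (map_mat to_ac (square_matrix (k_cells K (int d - 1)) (weighted_laplacian K d)))"

definition tau_hat :: "('a, 'c::linorder) cell_structure \<Rightarrow> nat \<Rightarrow> 'c ratfun" where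
  "tau_hat K d = (\<Sum>Y\<in>spanning_trees K d.
     of_nat ((hom_order (on_cells K Y) (int d - 1))\<^sup>2) *
     (\<Prod>f\<in>k_cells (on_cells K Y) d. (indet f)\<^sup>2))"

end

theory Submission
  imports Defs
begin

text \<open>
  Write \<open>n\<close> for the number of \<open>(d-1)\<close>-cells, \<open>M\<close> for the top boundary matrix, and
  \<open>r\<close> for its rank. The theorem is a statement about the maximal minors of \<open>M\<close>. Let \<open>F\<close> be a set
  of \<open>r\<close> top cells and \<open>U\<close> a set of \<open>n - r\<close> cells of dimension \<open>d - 1\<close>, with complement \<open>S\<close>. The
  minor \<open>det M\<^sub>S\<^sub>,\<^sub>F\<close> is, up to sign, the index in \<open>\<int>\<^sup>S\<close> of the projection of the boundaries supported on
  \<open>F\<close>. If \<open>F\<close> and \<open>U\<close> come from spanning trees, this projection is injective on the lattice \<open>Z\<close> of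
  \<open>(d-1)\<close>-cycles, and the index factors through \<open>Z\<close>: the factor inside \<open>Z\<close> is the order of
  \<open>H\<^sub>d\<^sub>-\<^sub>1\<close> of the tree given by \<open>F\<close>, and the factor outside is the index of \<open>\<partial> \<int>\<^sup>U\<close> in the group of
  all \<open>(d-2)\<close>-boundaries, which is the quotient of the orders of \<open>H\<^sub>d\<^sub>-\<^sub>2\<close> of the tree given by \<open>U\<close>
  and of the whole complex. In all other cases the minor vanishes. So the square of every maximal
  minor is a product of a factor for \<open>F\<close> and a factor for \<open>U\<close>
  (\<open>incidence_det_bases\<close>, \<open>incidence_det_nonzero_imp_bases\<close>).

  The rest is linear algebra. By the Cauchy--Binet formula, the principal minor of the weighted
  Laplacian obtained by deleting \<open>U\<close> is the sum over \<open>F\<close> of \<open>(det M\<^sub>S\<^sub>,\<^sub>F)\<^sup>2 \<Prod>\<^sub>f\<^sub>\<in>\<^sub>F x\<^sub>f\<^sup>2\<close>, which gives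
  the formula for the reduced Laplacian. Up to sign, the sum of all principal minors of size \<open>r\<close> is the
  coefficient of degree \<open>n - r\<close> of the characteristic polynomial. The lower coefficients vanish
  because there are no nonzero minors of size above \<open>r\<close>, and this one does not, because it is a
  positive combination of distinct monomials. Hence it is, again up to sign, the product of the
  nonzero eigenvalues.

  That spanning trees are exactly the maximal acyclic sets of cells follows from counting ranks:
  acyclicity in positive codimension says that below the top dimension every cycle has a multiple that
  is a boundary, so that a maximal acyclic set in dimension \<open>k\<close> and one in dimension \<open>k - 1\<close> have
  complementary sizes (\<open>card_basis_complement\<close>, \<open>spanning_tree_iff\<close>).

  All of this presupposes that the cellular boundary squares to zero. Since incidence numbers are
  defined as degrees, this is a topological fact. It rests on a single computation in singular
  homology: the pair formed by the \<open>n\<close>-skeleton and the \<open>(n-1)\<close>-skeleton has its \<open>n\<close>-th relative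
  homology generated by the characteristic maps of the \<open>n\<close>-cells
  (\<open>relative_homology_skeleton_generated\<close>, \<open>incidence_sum_zero\<close>).
\<close>

section \<open>Discs and spheres\<close>

lemma top_subset_Euclidean_space:
  assumes "A \<subseteq> topspace (Euclidean_space n)"
  shows "subtopology (Euclidean_space n) A = top_of_set A"
  using assms
  by (simp add: Euclidean_space_def subtopology_subtopology euclidean_product_topology Int_absorb1)

lemma closed_disc_topology:
  "subtopology (Euclidean_space n) (closed_disc n) = top_of_set (closed_disc n)"
  by (rule top_subset_Euclidean_space) (auto simp: closed_disc_def)

lemma open_disc_topology:
  "subtopology (Euclidean_space n) (open_disc n) = top_of_set (open_disc n)"
  by (rule top_subset_Euclidean_space) (auto simp: open_disc_def)

lemma nsphere_eq_disc_sphere: "nsphere n = top_of_set (disc_sphere (Suc n))"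
  unfolding nsphere euclidean_product_topology
  by (rule arg_cong[where f = "subtopology euclidean"])
    (auto simp: Suc_le_eq disc_sphere_def sq_norm_def topspace_Euclidean_space lessThan_Suc_atMost)

lemma disc_simps:
  "x \<in> closed_disc n \<longleftrightarrow> (\<forall>i\<ge>n. x i = 0) \<and> sq_norm n x \<le> 1"
  "x \<in> open_disc n \<longleftrightarrow> (\<forall>i\<ge>n. x i = 0) \<and> sq_norm n x < 1"
  "x \<in> disc_sphere n \<longleftrightarrow> (\<forall>i\<ge>n. x i = 0) \<and> sq_norm n x = 1"
  by (auto simp: closed_disc_def open_disc_def disc_sphere_def topspace_Euclidean_space)

lemma closed_disc_eq: "closed_disc n = open_disc n \<union> disc_sphere n"
  by (auto simp: disc_simps)

lemma sq_norm_nonneg: "sq_norm n x \<ge> 0"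
  by (simp add: sq_norm_def sum_nonneg)

lemma sq_norm_scale: "sq_norm n (\<lambda>i. c * x i) = c\<^sup>2 * sq_norm n x"
  by (simp add: sq_norm_def power_mult_distrib sum_distrib_left)

lemma continuous_on_sq_norm [continuous_intros]: "continuous_on A (sq_norm n)"
  unfolding sq_norm_def by (intro continuous_intros continuous_on_subset[OF continuous_on_product_coordinates]) auto

lemma continuous_on_sq_norm_comp [continuous_intros]:
  assumes "continuous_on A f"
  shows "continuous_on A (\<lambda>x. sq_norm n (f x))"
  by (rule continuous_on_compose2[OF continuous_on_sq_norm assms subset_UNIV])

lemma coordinate_le_sq_norm: "i < n \<Longrightarrow> (x i)\<^sup>2 \<le> sq_norm n x"
  unfolding sq_norm_def by (rule member_le_sum) auto

lemma closed_closed_disc: "closed (closed_disc n)"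
proof -
  have "closed_disc n = (\<Inter>i\<in>{n..}. {x. x i = 0}) \<inter> {x. sq_norm n x \<le> 1}"
    by (auto simp: disc_simps)
  also have "closed \<dots>"
    by (intro closed_Int closed_INT ballI closed_Collect_eq closed_Collect_le continuous_intros
        continuous_on_product_coordinates)
  finally show ?thesis .
qed

lemma compact_closed_disc: "compact (closed_disc n)"
proof -
  have "compactin (powertop_real UNIV) (\<Pi>\<^sub>E i\<in>(UNIV::nat set). {-1..1::real})"
    by (auto simp: compactin_PiE)
  hence "compact (\<Pi>\<^sub>E i\<in>(UNIV::nat set). {-1..1::real})"
    by (metis compactin_euclidean_iff euclidean_product_topology)
  moreover have "x \<in> (\<Pi>\<^sub>E i\<in>UNIV. {-1..1})" if "x \<in> closed_disc n" for x
  proof -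
    have "(x i)\<^sup>2 \<le> 1" for i
    proof (cases "i < n")
      case True
      thus ?thesis using that coordinate_le_sq_norm[of i n x] by (auto simp: disc_simps)
    qed (use that in \<open>auto simp: disc_simps\<close>)
    hence "- 1 \<le> x i \<and> x i \<le> 1" for i
      by (metis abs_le_iff abs_square_le_1 minus_le_iff)
    thus ?thesis by auto
  qed
  ultimately show ?thesis
    using compact_Int_closed[OF _ closed_closed_disc, of "\<Pi>\<^sub>E i\<in>(UNIV::nat set). {-1..1::real}" n]
    by (metis Int_absorb1 subsetI)
qed

lemma contractible_closed_disc: "contractible_space (top_of_set (closed_disc n))"
proof -
  have "continuous_on ({0..1} \<times> closed_disc n) (\<lambda>z i. (1 - fst z) * snd z i)"
    by (rule continuous_on_coordinatewise_then_product)
      (intro continuous_intros continuous_on_product_then_coordinatewise)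
  moreover have "(\<lambda>i. (1 - t) * x i) \<in> closed_disc n" if "t \<in> {0..1}" "x \<in> closed_disc n" for t x
  proof -
    have "(1 - t)\<^sup>2 * sq_norm n x \<le> 1 * 1"
      using that by (intro mult_mono) (auto simp: disc_simps sq_norm_nonneg power_le_one_iff abs_square_le_1)
    thus ?thesis using that by (auto simp: disc_simps sq_norm_scale)
  qed
  ultimately have "homotopic_with_canon (\<lambda>x. True) (closed_disc n) (closed_disc n) id (\<lambda>x i. 0)"
    by (auto simp: homotopic_with intro!: exI[of _ "\<lambda>z i. (1 - fst z) * snd z i"])
  thus ?thesis unfolding contractible_space_def by blast
qed

lemma wrap_disc_in_sphere:
  assumes "x \<in> closed_disc n" shows "wrap_disc n x \<in> disc_sphere (Suc n)"
proof -
  let ?s = "sq_norm n x"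
  have "sq_norm (Suc n) (wrap_disc n x) = (\<Sum>i<n. (2 * sqrt (1 - ?s) * x i)\<^sup>2) + (2 * ?s - 1)\<^sup>2"
    by (simp add: sq_norm_def wrap_disc_def)
  also have "(\<Sum>i<n. (2 * sqrt (1 - ?s) * x i)\<^sup>2) = 4 * (1 - ?s) * ?s"
    using assms sq_norm_scale[of n "2 * sqrt (1 - ?s)" x]
    by (simp add: sq_norm_def[of n "\<lambda>i. _ i * _ i"] sq_norm_def[of n "\<lambda>i. 2 * _ * _ i"] power_mult_distrib disc_simps)
  finally show ?thesis
    by (simp add: disc_simps wrap_disc_def power2_eq_square algebra_simps)
qed

lemma wrap_disc_on_sphere:
  assumes "x \<in> disc_sphere n" shows "wrap_disc n x = sphere_pole n"
  using assms by (auto simp: disc_simps wrap_disc_def sphere_pole_def)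

lemma sphere_pole_in_sphere: "sphere_pole n \<in> disc_sphere (Suc n)"
  by (auto simp: disc_simps sphere_pole_def sq_norm_def)

lemma continuous_on_wrap_disc: "continuous_on (closed_disc n) (wrap_disc n)"
proof (rule continuous_on_coordinatewise_then_product)
  fix i
  consider "i < n" | "i = n" | "i > n" by linarith
  thus "continuous_on (closed_disc n) (\<lambda>x. wrap_disc n x i)"
    by cases (simp_all add: wrap_disc_def continuous_intros
       continuous_on_subset[OF continuous_on_product_coordinates subset_UNIV])
qed

text \<open>The radial stretching of the disc by the factor \<open>1 + t\<close>, cut off at the boundary sphere. At time
  \<open>1\<close> it pushes everything outside the disc of radius one half onto the sphere. Dividing by a maximum
  makes the formula continuous at the center as well as along the cut.\<close>

definition stretch :: "nat \<Rightarrow> real \<Rightarrow> (nat \<Rightarrow> real) \<Rightarrow> (nat \<Rightarrow> real)" where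
  "stretch n t y = (\<lambda>i. (1 / max (1 / (1 + t)) (sqrt (sq_norm n y))) * y i)"

lemma stretch_0: "y \<in> closed_disc n \<Longrightarrow> stretch n 0 y = y"
  by (simp add: stretch_def disc_simps max_absorb1)

lemma stretch_sphere: "y \<in> disc_sphere n \<Longrightarrow> 0 \<le> t \<Longrightarrow> stretch n t y = y"
  by (simp add: stretch_def disc_simps max_def)

lemma stretch_closed_disc:
  assumes "y \<in> closed_disc n" "0 \<le> t" shows "stretch n t y \<in> closed_disc n"
proof -
  let ?m = "max (1 / (1 + t)) (sqrt (sq_norm n y))"
  have pos: "?m > 0" using assms by (subst less_max_iff_disj) auto
  have "sq_norm n y = (sqrt (sq_norm n y))\<^sup>2" by (simp add: sq_norm_nonneg)
  also have "\<dots> \<le> ?m\<^sup>2" by (rule power_mono) (auto simp: sq_norm_nonneg)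
  finally have "(1 / ?m)\<^sup>2 * sq_norm n y \<le> 1" using pos
    by (simp add: power_divide)
  hence "sq_norm n (stretch n t y) \<le> 1"
    unfolding stretch_def sq_norm_scale .
  thus ?thesis using assms by (simp add: disc_simps stretch_def)
qed

lemma stretch_half:
  assumes "y \<in> closed_disc n" "sq_norm n y \<ge> 1/4" shows "stretch n 1 y \<in> disc_sphere n"
proof -
  have "sqrt (sq_norm n y) \<ge> sqrt (1/4)" using assms by (subst real_sqrt_le_iff)
  hence m: "max (1 / (1 + 1)) (sqrt (sq_norm n y)) = sqrt (sq_norm n y)"
    by (simp add: max_def real_sqrt_divide)
  have "sq_norm n y > 0" using assms by linarith
  hence "sq_norm n (stretch n 1 y) = 1"
    unfolding stretch_def m sq_norm_scale by (simp add: power_divide)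
  thus ?thesis using assms by (simp add: disc_simps stretch_def)
qed

lemma continuous_on_stretch:
  "continuous_on ({0..1} \<times> closed_disc n) (\<lambda>z. stretch n (fst z) (snd z))"
  unfolding stretch_def
proof (rule continuous_on_coordinatewise_then_product)
  fix i
  have "max (1 / (1 + t)) (sqrt (sq_norm n y)) \<noteq> 0" if "t \<ge> 0" for t y
  proof -
    have "max (1 / (1 + t)) (sqrt (sq_norm n y)) > 0" using that by (subst less_max_iff_disj) auto
    thus ?thesis by linarith
  qed
  thus "continuous_on ({0..1} \<times> closed_disc n)
     (\<lambda>z. 1 / max (1 / (1 + fst z)) (sqrt (sq_norm n (snd z))) * snd z i)"
    by (intro continuous_intros continuous_on_product_then_coordinatewise ballI) auto
qed

section \<open>Attaching one cell\<close>

text \<open>A continuous map from a compact space into a Hausdorff space is closed, so preimages of closed sets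
  can be pushed forward along \<open>\<Phi>\<close> and checked on the two closed pieces of the cover separately.\<close>

lemma continuous_map_glue:
  assumes "compact_space D" "Hausdorff_space Y" "continuous_map D Y \<Phi>" "closedin Y A"
    and cover: "topspace Y = A \<union> \<Phi> ` topspace D"
    and gA: "continuous_map (subtopology Y A) Z g" and gD: "continuous_map D Z (g \<circ> \<Phi>)"
  shows "continuous_map Y Z g"
  unfolding continuous_map_closedin
proof (intro conjI allI impI)
  have clm: "closed_map D Y \<Phi>"
    using assms by (intro continuous_imp_closed_map)
  have A: "A \<subseteq> topspace Y" using assms closedin_subset by blast
  show "g \<in> topspace Y \<rightarrow> topspace Z"
    using gA gD A by (auto simp: continuous_map_def cover Pi_iff)
  fix C assume C: "closedin Z C"
  have "closedin (subtopology Y A) {x \<in> topspace (subtopology Y A). g x \<in> C}"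
    using gA C unfolding continuous_map_closedin by blast
  hence 1: "closedin Y {x \<in> topspace (subtopology Y A). g x \<in> C}"
    using assms(4) closedin_trans_full by blast
  have "closedin D {y \<in> topspace D. (g \<circ> \<Phi>) y \<in> C}"
    using gD C unfolding continuous_map_closedin by blast
  hence 2: "closedin Y (\<Phi> ` {y \<in> topspace D. (g \<circ> \<Phi>) y \<in> C})"
    using clm unfolding closed_map_def by blast
  have "{x \<in> topspace Y. g x \<in> C}
     = {x \<in> topspace (subtopology Y A). g x \<in> C} \<union> \<Phi> ` {y \<in> topspace D. (g \<circ> \<Phi>) y \<in> C}"
    using A cover by auto
  thus "closedin Y {x \<in> topspace Y. g x \<in> C}" using 1 2 by auto
qed

lemma compact_space_closed_disc: "compact_space (top_of_set (closed_disc n))"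
  by (simp add: compact_space_subtopology compact_closed_disc)

text \<open>The space \<open>Y\<close> arises from the closed subspace \<open>A\<close> by attaching one \<open>n\<close>-cell with
  characteristic map \<open>\<Phi>\<close>.\<close>

locale attached_cell =
  fixes Y :: "'a topology" and A :: "'a set" and n :: nat and \<Phi> :: "(nat \<Rightarrow> real) \<Rightarrow> 'a"
  assumes Hausdorff: "Hausdorff_space Y" and closed_A: "closedin Y A"
    and cont: "continuous_map (top_of_set (closed_disc n)) Y \<Phi>"
    and homeo: "homeomorphic_map (top_of_set (open_disc n)) (subtopology Y (\<Phi> ` open_disc n)) \<Phi>"
    and disjoint: "\<Phi> ` open_disc n \<inter> A = {}"
    and sphere: "\<Phi> ` disc_sphere n \<subseteq> A"
    and cover: "topspace Y = A \<union> \<Phi> ` open_disc n"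
begin

abbreviation (input) D where "D \<equiv> top_of_set (closed_disc n)"

lemma inj: "inj_on \<Phi> (open_disc n)"
  using homeo by (auto simp: homeomorphic_eq_everything_map)

lemma cover': "topspace Y = A \<union> \<Phi> ` closed_disc n"
  using cover sphere by (auto simp: closed_disc_eq)

lemma continuous_glue:
  assumes "continuous_map (subtopology Y A) Z g" "continuous_map D Z (g \<circ> \<Phi>)"
  shows "continuous_map Y Z g"
  by (rule continuous_map_glue[OF _ Hausdorff cont closed_A _ assms])
    (auto simp: cover' compact_space_closed_disc)

text \<open>The stretching of the disc, transported to the attached cell and extended by the identity on \<open>A\<close>.
  The two prescriptions agree on the boundary of the cell because stretching fixes the sphere.\<close>

definition push :: "real \<Rightarrow> 'a \<Rightarrow> 'a" where
  "push t x = (if x \<in> A then x else \<Phi> (stretch n t (inv_into (open_disc n) \<Phi> x)))"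

lemma push_char:
  assumes "y \<in> closed_disc n" "0 \<le> t" shows "push t (\<Phi> y) = \<Phi> (stretch n t y)"
proof (cases "y \<in> disc_sphere n")
  case True
  thus ?thesis using sphere assms by (auto simp: push_def stretch_sphere)
next
  case False
  hence "y \<in> open_disc n" using assms by (auto simp: closed_disc_eq)
  thus ?thesis using disjoint inj by (auto simp: push_def)
qed

lemma push_A: "x \<in> A \<Longrightarrow> push t x = x"
  by (simp add: push_def)

text \<open>Gluing is applied to the product with the interval: the product of the disc with the interval
  is again compact, so that \<open>Y \<times> [0,1]\<close> carries the quotient topology as well.\<close>

lemma push_homotopy:
  "continuous_map (prod_topology (top_of_set {0..1}) Y) Y (\<lambda>z. push (fst z) (snd z))"
proof (rule continuous_map_glue)
  let ?I = "top_of_set {0..1::real}"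
  show "compact_space (prod_topology ?I D)"
    by (simp add: compact_space_subtopology compact_Times compact_closed_disc)
  show "Hausdorff_space (prod_topology ?I Y)"
    by (simp add: Hausdorff_space_prod_topology Hausdorff Hausdorff_space_subtopology)
  show "continuous_map (prod_topology ?I D) (prod_topology ?I Y) (\<lambda>z. (fst z, \<Phi> (snd z)))"
    unfolding continuous_map_pairwise o_def fst_conv snd_conv
    by (intro conjI continuous_map_fst continuous_map_compose[OF continuous_map_snd cont, unfolded o_def])
  show "closedin (prod_topology ?I Y) ({0..1} \<times> A)"
    using closed_A by (auto simp: closedin_prod_Times_iff)
  show "topspace (prod_topology ?I Y) = {0..1} \<times> A \<union> (\<lambda>z. (fst z, \<Phi> (snd z))) ` topspace (prod_topology ?I D)"
    by (auto simp: cover' image_iff)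
  have "continuous_map (subtopology (prod_topology ?I Y) ({0..1} \<times> A)) Y snd"
    by (rule continuous_map_subtopology_snd)
  thus "continuous_map (subtopology (prod_topology ?I Y) ({0..1} \<times> A)) Y (\<lambda>z. push (fst z) (snd z))"
    by (rule continuous_map_eq) (auto simp: push_A)
  have "continuous_map (prod_topology ?I D) D (\<lambda>z. stretch n (fst z) (snd z))"
    using continuous_on_stretch[of n]
    by (auto simp: prod_topology_subtopology_eu stretch_closed_disc)
  hence "continuous_map (prod_topology ?I D) Y (\<Phi> \<circ> (\<lambda>z. stretch n (fst z) (snd z)))"
    using cont by (rule continuous_map_compose)
  thus "continuous_map (prod_topology ?I D) Y ((\<lambda>z. push (fst z) (snd z)) \<circ> (\<lambda>z. (fst z, \<Phi> (snd z))))"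
    by (rule continuous_map_eq) (auto simp: push_char)
qed

lemma push_homotopic_id: "homotopic_with (\<lambda>h. h \<in> A \<rightarrow> A) Y Y id (push 1)"
proof -
  have *: "\<exists>h. continuous_map (prod_topology (top_of_set {0..1::real}) Y) Y h \<and>
         (\<forall>x\<in>topspace Y. h (0, x) = id x) \<and> (\<forall>x\<in>topspace Y. h (1, x) = push 1 x) \<and>
         (\<forall>t\<in>{0..1}. (\<lambda>x. h (t, x)) \<in> A \<rightarrow> A)"
  proof (intro exI conjI ballI)
    show "continuous_map (prod_topology (top_of_set {0..1}) Y) Y (\<lambda>z. push (fst z) (snd z))"
      by (rule push_homotopy)
  qed (auto simp: push_A cover' push_char stretch_0)
  have "A \<subseteq> topspace Y" using closed_A closedin_subset by blast
  hence "(h \<in> A \<rightarrow> A) = (k \<in> A \<rightarrow> A)" if "\<And>x. x \<in> topspace Y \<Longrightarrow> h x = k x" for h k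
    using that by (simp add: Pi_iff subset_iff)
  from homotopic_with[of Y "\<lambda>h. h \<in> A \<rightarrow> A", OF this] * show ?thesis by blast
qed

lemma push_continuous: "continuous_map Y Y (push 1)"
  using homotopic_with_imp_continuous_maps[OF push_homotopic_id] by blast

text \<open>The relative homology of the pair comes from the pair of disc and sphere. Let \<open>B\<close> be the complement
  of the open cell's half-size disc. Excising \<open>A\<close> from the pair \<open>(Y, B)\<close> leaves the open cell, whose
  classes are carried back to the disc by the inverse characteristic map followed by the stretching.
  The stretching, transported to \<open>Y\<close>, maps \<open>B\<close> into \<open>A\<close> and is homotopic to the identity, and so
  the round trip returns the class one started with.\<close>

lemma relative_homology_generated:
  assumes x: "x \<in> carrier (relative_homology_group p Y A)"
  shows "\<exists>z \<in> carrier (relative_homology_group p D (disc_sphere n)).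
           x = hom_induced p D (disc_sphere n) Y A \<Phi> z"
proof -
  define V where "V = \<Phi> ` {y \<in> closed_disc n. sq_norm n y < 1/4}"
  define B where "B = topspace Y - V"
  define e where "e = \<Phi> ` open_disc n"
  define \<psi> where "\<psi> = inv_into (open_disc n) \<Phi>"
  have A_sub: "A \<subseteq> topspace Y" using closed_A closedin_subset by blast
  have Ve: "V \<subseteq> e" by (auto simp: V_def e_def disc_simps)
  have AB: "A \<subseteq> B" using A_sub Ve disjoint by (auto simp: B_def e_def)
  \<comment> \<open>\<open>A\<close> misses the compact half-size disc, so it lies in the interior of \<open>B\<close>\<close>
  have "compact {y \<in> closed_disc n. sq_norm n y \<le> 1/4}"
  proof -
    have "{y \<in> closed_disc n. sq_norm n y \<le> 1/4} = closed_disc n \<inter> {y. sq_norm n y \<le> 1/4}" by auto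
    moreover have "closed {y. sq_norm n y \<le> 1/4}"
      by (intro closed_Collect_le continuous_intros)
    ultimately show ?thesis by (metis compact_Int_closed compact_closed_disc)
  qed
  hence "compactin D {y \<in> closed_disc n. sq_norm n y \<le> 1/4}"
    by (auto simp: compactin_subtopology)
  hence "compactin Y (\<Phi> ` {y \<in> closed_disc n. sq_norm n y \<le> 1/4})"
    using cont image_compactin by blast
  hence "openin Y (topspace Y - \<Phi> ` {y \<in> closed_disc n. sq_norm n y \<le> 1/4})"
    using Hausdorff compactin_imp_closedin by blast
  moreover have "topspace Y - \<Phi> ` {y \<in> closed_disc n. sq_norm n y \<le> 1/4} \<subseteq> B"
    by (auto simp: B_def V_def)
  moreover have "A \<subseteq> topspace Y - \<Phi> ` {y \<in> closed_disc n. sq_norm n y \<le> 1/4}"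
  proof -
    have "{y \<in> closed_disc n. sq_norm n y \<le> 1/4} \<subseteq> open_disc n" by (auto simp: disc_simps)
    thus ?thesis using A_sub disjoint by blast
  qed
  ultimately have "A \<subseteq> Y interior_of B"
    unfolding interior_of_def by blast
  hence "Y closure_of A \<subseteq> Y interior_of B"
    by (metis closed_A closure_of_closedin)
  hence exc: "hom_induced p (subtopology Y (topspace Y - A)) (B - A) (subtopology Y (topspace Y)) B id
    \<in> iso (relative_homology_group p (subtopology Y (topspace Y - A)) (B - A))
          (relative_homology_group p (subtopology Y (topspace Y)) B)"
    by (rule homology_excision_axiom) (auto simp: B_def)
  have e: "topspace Y - A = e" using cover disjoint by (auto simp: e_def)
  have exc: "hom_induced p (subtopology Y e) (B - A) Y B id
      \<in> iso (relative_homology_group p (subtopology Y e) (B - A)) (relative_homology_group p Y B)"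
    using exc by (simp add: e)
  have "hom_induced p Y A Y B id x \<in> carrier (relative_homology_group p Y B)"
    by (rule hom_induced_carrier)
  hence "hom_induced p Y A Y B id x \<in> hom_induced p (subtopology Y e) (B - A) Y B id `
      carrier (relative_homology_group p (subtopology Y e) (B - A))"
    using exc by (simp add: iso_def bij_betw_def)
  then obtain w where w: "w \<in> carrier (relative_homology_group p (subtopology Y e) (B - A))"
      "hom_induced p (subtopology Y e) (B - A) Y B id w = hom_induced p Y A Y B id x"
    by (metis (no_types, lifting) imageE)
  \<comment> \<open>the inverse of the characteristic map, followed by the stretching of the disc\<close>
  have \<psi>: "continuous_map (subtopology Y e) D \<psi>"
  proof -
    obtain g where g: "homeomorphic_maps (top_of_set (open_disc n)) (subtopology Y e) \<Phi> g"
      using homeo by (auto simp: homeomorphic_map_maps e_def)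
    have "continuous_map (subtopology Y e) (top_of_set (open_disc n)) g"
      using g by (simp add: homeomorphic_maps_def)
    hence "continuous_map (subtopology Y e) D g"
      by (auto simp: continuous_map_in_subtopology closed_disc_eq)
    moreover have "g x = \<psi> x" if "x \<in> topspace (subtopology Y e)" for x
      using that g inj by (auto simp: e_def \<psi>_def homeomorphic_maps_def)
    ultimately show ?thesis by (rule continuous_map_eq)
  qed
  have str: "continuous_map D D (stretch n 1)"
  proof -
    have "continuous_on (closed_disc n) (\<lambda>y. (\<lambda>z. stretch n (fst z) (snd z)) (1, y))"
      by (rule continuous_on_compose2[OF continuous_on_stretch]) (auto intro!: continuous_intros)
    thus ?thesis by (auto simp: stretch_closed_disc)
  qed
  define f where "f = stretch n 1 \<circ> \<psi>"
  have f: "continuous_map (subtopology Y e) D f"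
    unfolding f_def using \<psi> str by (rule continuous_map_compose)
  have f_B: "f x \<in> disc_sphere n" if "x \<in> B - A" for x
  proof -
    from that cover obtain y where y: "y \<in> open_disc n" "x = \<Phi> y" by (auto simp: B_def)
    hence "\<psi> x = y" using inj by (simp add: \<psi>_def)
    moreover have "sq_norm n y \<ge> 1/4" "y \<in> closed_disc n"
      using that y by (auto simp: B_def V_def closed_disc_eq not_less)
    ultimately show ?thesis by (simp add: f_def stretch_half)
  qed
  define z where "z = hom_induced p (subtopology Y e) (B - A) D (disc_sphere n) f w"
  have push_B: "push 1 x \<in> A" if "x \<in> B" for x
  proof (cases "x \<in> A")
    case False
    with that cover obtain y where y: "y \<in> open_disc n" "x = \<Phi> y" by (auto simp: B_def)
    hence "sq_norm n y \<ge> 1/4" "y \<in> closed_disc n"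
      using that by (auto simp: B_def V_def closed_disc_eq not_less)
    thus ?thesis using y sphere by (auto simp: push_char stretch_half)
  qed (simp add: push_A)
  have "hom_induced p D (disc_sphere n) Y A \<Phi> z
      = hom_induced p (subtopology Y e) (B - A) Y A (\<Phi> \<circ> f) w"
    unfolding z_def using f f_B cont sphere
    by (subst hom_induced_compose') auto
  also have "hom_induced p (subtopology Y e) (B - A) Y A (\<Phi> \<circ> f)
      = hom_induced p (subtopology Y e) (B - A) Y A (push 1 \<circ> id)"
  proof (rule hom_induced_eq)
    fix x assume "x \<in> topspace (subtopology Y e)"
    then obtain y where y: "y \<in> open_disc n" "x = \<Phi> y" by (auto simp: e_def)
    thus "(\<Phi> \<circ> f) x = (push 1 \<circ> id) x"
      using inj by (simp add: f_def \<psi>_def push_char closed_disc_eq)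
  qed
  also have "\<dots> w = hom_induced p Y B Y A (push 1) (hom_induced p (subtopology Y e) (B - A) Y B id w)"
    using push_continuous push_B by (subst hom_induced_compose') auto
  also have "\<dots> = hom_induced p Y B Y A (push 1) (hom_induced p Y A Y B id x)"
    by (simp add: w)
  also have "\<dots> = hom_induced p Y A Y A (push 1 \<circ> id) x"
    using push_continuous push_B AB by (subst hom_induced_compose') auto
  also have "\<dots> = hom_induced p Y A Y A id x"
    using homology_homotopy_axiom[OF push_homotopic_id, of p] by simp
  also have "\<dots> = x" using x by (rule hom_induced_id)
  finally have "x = hom_induced p D (disc_sphere n) Y A \<Phi> z" ..
  moreover have "z \<in> carrier (relative_homology_group p D (disc_sphere n))"
    unfolding z_def by (rule hom_induced_carrier)
  ultimately show ?thesis by blast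
qed

text \<open>For a smaller subspace \<open>B\<close> that already contains the boundary of the cell, a class of the pair
  \<open>(Y, B)\<close> maps to a class of \<open>(Y, A)\<close>, which the cell generates. After subtracting the contribution
  of the cell, the class comes from \<open>(A, B)\<close> by the exact sequence of the triple.\<close>

lemma relative_homology_decompose:
  assumes BA: "B \<subseteq> A" and sphB: "\<Phi> ` disc_sphere n \<subseteq> B"
    and x: "x \<in> carrier (relative_homology_group p Y B)"
  obtains x' z where "x' \<in> carrier (relative_homology_group p (subtopology Y A) B)"
    "z \<in> carrier (relative_homology_group p D (disc_sphere n))"
    "x = hom_induced p (subtopology Y A) B Y B id x' \<otimes>\<^bsub>relative_homology_group p Y B\<^esub>
         hom_induced p D (disc_sphere n) Y B \<Phi> z"
proof -
  let ?G = "relative_homology_group p Y B"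
  define \<eta> where "\<eta> = hom_induced p D (disc_sphere n) Y B \<Phi>"
  define i where "i = hom_induced p (subtopology Y A) B Y B id"
  define j where "j = hom_induced p Y B Y A id"
  interpret \<eta>: group_hom "relative_homology_group p D (disc_sphere n)" ?G \<eta>
    unfolding group_hom_def group_hom_axioms_def \<eta>_def by (auto simp: hom_induced_hom)
  interpret j: group_hom ?G "relative_homology_group p Y A" j
    unfolding group_hom_def group_hom_axioms_def j_def by (auto simp: hom_induced_hom)
  have "j x \<in> carrier (relative_homology_group p Y A)" using x by simp
  from relative_homology_generated[OF this] obtain z
    where z: "z \<in> carrier (relative_homology_group p D (disc_sphere n))"
      "j x = hom_induced p D (disc_sphere n) Y A \<Phi> z" by blast
  have "j (\<eta> z) = hom_induced p D (disc_sphere n) Y A (id \<circ> \<Phi>) z"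
    unfolding j_def \<eta>_def using cont sphB BA
    by (intro hom_induced_compose') (auto simp: image_subset_iff_funcset)
  hence jz: "j (\<eta> z) = j x" using z by simp
  define y where "y = x \<otimes>\<^bsub>?G\<^esub> inv\<^bsub>?G\<^esub> (\<eta> z)"
  have y: "y \<in> carrier ?G" "j y = \<one>\<^bsub>relative_homology_group p Y A\<^esub>"
    using x z(1) jz by (simp_all add: y_def)
  have "exact_seq ([relative_homology_group p Y A, ?G, relative_homology_group p (subtopology Y A) B], [j, i])"
    using homology_exactness_triple_3[OF BA, of p Y] by (simp only: i_def j_def)
  hence "kernel ?G (relative_homology_group p Y A) j = i ` carrier (relative_homology_group p (subtopology Y A) B)"
    by simp
  moreover have "y \<in> kernel ?G (relative_homology_group p Y A) j"
    using y by (simp add: kernel_def)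
  ultimately obtain x' where x': "x' \<in> carrier (relative_homology_group p (subtopology Y A) B)" "y = i x'"
    by (metis (no_types, lifting) imageE)
  have "x = y \<otimes>\<^bsub>?G\<^esub> \<eta> z"
    unfolding y_def using x z(1)
    by (simp add: monoid.m_assoc[OF group.is_monoid[OF group_relative_homology_group]])
  with x' z(1) show thesis unfolding i_def \<eta>_def by (intro that) auto
qed

end

section \<open>Relative homology of consecutive skeleta\<close>

definition cell_union :: "('a, 'c) cell_structure \<Rightarrow> 'c set \<Rightarrow> 'a set" where
  "cell_union K C = (\<Union>c\<in>C. open_cell K c)"

text \<open>These are the sets of cells used as stages when cells are attached one at a time in order of dimension; the
  union of such a set is a subcomplex.\<close>

definition downward_closed :: "('a, 'c) cell_structure \<Rightarrow> 'c set \<Rightarrow> bool" where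
  "downward_closed K C \<longleftrightarrow> C \<subseteq> cells K \<and>
     (\<forall>c\<in>C. \<forall>b\<in>cells K. cell_dim K b < cell_dim K c \<longrightarrow> b \<in> C)"

locale finite_CW_complex =
  fixes K :: "('a, 'c) cell_structure"
  assumes CW: "finite_CW K"
begin

abbreviation (input) "T \<equiv> carrier_space K"
abbreviation "dm \<equiv> cell_dim K"
abbreviation "\<Phi> \<equiv> char_map K"
abbreviation "cells_below n \<equiv> {c \<in> cells K. dm c < n}"

lemma finite_cells: "finite (cells K)"
  and Hausdorff: "Hausdorff_space T"
  and topspace_eq: "topspace T = cell_union K (cells K)"
  using CW by (auto simp: finite_CW_def cell_union_def)

lemma open_cells_disjoint:
  "b \<in> cells K \<Longrightarrow> c \<in> cells K \<Longrightarrow> b \<noteq> c \<Longrightarrow> open_cell K b \<inter> open_cell K c = {}"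
  using CW by (auto simp: finite_CW_def disjoint_family_on_def)

lemma char_map_continuous:
  "c \<in> cells K \<Longrightarrow> continuous_map (top_of_set (closed_disc (dm c))) T (\<Phi> c)"
  using CW by (auto simp: finite_CW_def closed_disc_topology)

lemma char_map_homeo:
  "c \<in> cells K \<Longrightarrow> homeomorphic_map (top_of_set (open_disc (dm c))) (subtopology T (open_cell K c)) (\<Phi> c)"
  using CW by (auto simp: finite_CW_def open_disc_topology)

lemma char_map_inj: "c \<in> cells K \<Longrightarrow> inj_on (\<Phi> c) (open_disc (dm c))"
  using char_map_homeo[of c] by (auto simp: homeomorphic_eq_everything_map)

lemma char_map_sphere:
  "c \<in> cells K \<Longrightarrow> \<Phi> c ` disc_sphere (dm c) \<subseteq> cell_union K (cells_below (dm c))"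
  using CW by (auto simp: finite_CW_def cell_union_def)

lemma char_map_sphere_downward:
  assumes "c \<in> cells K" "cells_below (dm c) \<subseteq> C"
  shows "\<Phi> c ` disc_sphere (dm c) \<subseteq> cell_union K C"
  using char_map_sphere[OF assms(1)] assms(2) by (auto simp: cell_union_def)

text \<open>The union of the open cells equals the union of the closed cells, because the boundary of each cell
  lies in cells of lower dimension; closed cells are compact.\<close>

lemma closedin_cell_union:
  assumes "downward_closed K C"
  shows "closedin T (cell_union K C)"
proof -
  have C: "C \<subseteq> cells K" using assms by (simp add: downward_closed_def)
  have "cell_union K C = (\<Union>c\<in>C. \<Phi> c ` closed_disc (dm c))"
  proof
    show "cell_union K C \<subseteq> (\<Union>c\<in>C. \<Phi> c ` closed_disc (dm c))"
      by (auto simp: cell_union_def open_cell_def closed_disc_eq)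
    have "\<Phi> c ` closed_disc (dm c) \<subseteq> cell_union K C" if "c \<in> C" for c
    proof -
      have "\<Phi> c ` disc_sphere (dm c) \<subseteq> cell_union K C"
        using that C assms by (intro char_map_sphere_downward) (auto simp: downward_closed_def)
      thus ?thesis using that by (auto simp: closed_disc_eq cell_union_def open_cell_def)
    qed
    thus "(\<Union>c\<in>C. \<Phi> c ` closed_disc (dm c)) \<subseteq> cell_union K C" by blast
  qed
  moreover have "closedin T (\<Phi> c ` closed_disc (dm c))" if "c \<in> C" for c
  proof -
    have "compactin (top_of_set (closed_disc (dm c))) (closed_disc (dm c))"
      by (simp add: compactin_subtopology compact_closed_disc)
    hence "compactin T (\<Phi> c ` closed_disc (dm c))"
      using char_map_continuous[of c] that C image_compactin by blast
    thus ?thesis using Hausdorff compactin_imp_closedin by blast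
  qed
  moreover have "finite C" using C finite_cells finite_subset by blast
  ultimately show ?thesis by (auto intro: closedin_Union)
qed

lemma cell_union_subset: "C \<subseteq> cells K \<Longrightarrow> cell_union K C \<subseteq> topspace T"
  by (auto simp: topspace_eq cell_union_def)

lemma cell_union_disjoint:
  assumes "C \<subseteq> cells K" "s \<in> cells K" "s \<notin> C"
  shows "open_cell K s \<inter> cell_union K C = {}"
proof -
  have "open_cell K s \<inter> open_cell K c = {}" if "c \<in> C" for c
    using open_cells_disjoint[of s c] assms that by auto
  thus ?thesis by (auto simp: cell_union_def)
qed

lemma attached_cell_insert:
  assumes "downward_closed K C" "s \<in> cells K" "s \<notin> C" "cells_below (dm s) \<subseteq> C"
  shows "attached_cell (subtopology T (cell_union K (insert s C))) (cell_union K C) (dm s) (\<Phi> s)"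
proof
  let ?Y = "subtopology T (cell_union K (insert s C))"
  have C: "C \<subseteq> cells K" using assms by (simp add: downward_closed_def)
  have union: "cell_union K (insert s C) = cell_union K C \<union> open_cell K s"
    by (auto simp: cell_union_def)
  have sub: "cell_union K (insert s C) \<subseteq> topspace T"
    using C assms by (intro cell_union_subset) auto
  show "Hausdorff_space ?Y" by (simp add: Hausdorff Hausdorff_space_subtopology)
  show "closedin ?Y (cell_union K C)"
    using closedin_cell_union[OF assms(1)] by (rule closedin_subset_topspace) (auto simp: cell_union_def)
  show sph: "\<Phi> s ` disc_sphere (dm s) \<subseteq> cell_union K C"
    using assms by (intro char_map_sphere_downward)
  show "continuous_map (top_of_set (closed_disc (dm s))) ?Y (\<Phi> s)"
    using char_map_continuous[OF assms(2)] sph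
    by (auto simp: continuous_map_in_subtopology union closed_disc_eq open_cell_def)
  show "homeomorphic_map (top_of_set (open_disc (dm s))) (subtopology ?Y (\<Phi> s ` open_disc (dm s))) (\<Phi> s)"
    using char_map_homeo[OF assms(2)]
    by (simp add: subtopology_subtopology union open_cell_def Int_absorb1)
  show "\<Phi> s ` open_disc (dm s) \<inter> cell_union K C = {}"
    using cell_union_disjoint[OF C assms(2,3)] by (simp add: open_cell_def)
  show "topspace ?Y = cell_union K C \<union> \<Phi> s ` open_disc (dm s)"
    using sub by (auto simp: union open_cell_def)
qed

lemma downward_closed_below: "S \<subseteq> {c \<in> cells K. dm c = n} \<Longrightarrow> downward_closed K (cells_below n \<union> S)"
  by (auto simp: downward_closed_def)

text \<open>Attaching the \<open>n\<close>-cells one at a time shows that every class of the pair of consecutive skeleta is an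
  integral combination of the classes of the cells. The combination is recorded by its values under
  homomorphisms to the integers, where it becomes a sum; the homology group itself is written
  multiplicatively.\<close>

lemma relative_homology_skeleton_generated:
  assumes S: "S \<subseteq> {c \<in> cells K. dm c = n}"
    and g: "g \<in> carrier (relative_homology_group p (top_of_set (closed_disc n)) (disc_sphere n))"
    and gen: "\<And>z. z \<in> carrier (relative_homology_group p (top_of_set (closed_disc n)) (disc_sphere n)) \<Longrightarrow>
        \<exists>k::int. z = g [^]\<^bsub>relative_homology_group p (top_of_set (closed_disc n)) (disc_sphere n)\<^esub> k"
    and x: "x \<in> carrier (relative_homology_group p
       (subtopology T (cell_union K (cells_below n \<union> S))) (cell_union K (cells_below n)))"
  shows "\<exists>c :: 'c \<Rightarrow> int. \<forall>h \<in> hom (relative_homology_group p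
          (subtopology T (cell_union K (cells_below n \<union> S))) (cell_union K (cells_below n))) integer_group.
        h x = (\<Sum>s\<in>S. c s * h (hom_induced p (top_of_set (closed_disc n)) (disc_sphere n)
            (subtopology T (cell_union K (cells_below n \<union> S))) (cell_union K (cells_below n)) (\<Phi> s) g))"
proof -
  let ?D = "top_of_set (closed_disc n)" and ?S = "disc_sphere n"
  let ?A = "cell_union K (cells_below n)"
  let ?Y = "\<lambda>S. subtopology T (cell_union K (cells_below n \<union> S))"
  let ?G = "\<lambda>S. relative_homology_group p (?Y S) ?A"
  let ?HD = "relative_homology_group p ?D ?S"
  have "finite S" using S finite_cells finite_subset by (metis (no_types, lifting) mem_Collect_eq subsetI)
  thus ?thesis using S x
  proof (induction S arbitrary: x rule: finite_induct)
    case empty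
    have "cell_union K (cells_below n) \<subseteq> topspace T" by (rule cell_union_subset) auto
    hence "topspace (?Y {}) = ?A" by (simp add: Int_absorb1)
    hence "trivial_group (?G {})"
      using trivial_relative_homology_group_topspace[of p "?Y {}"] by (simp only:)
    hence x1: "x = \<one>\<^bsub>?G {}\<^esub>" using empty(2) by (auto simp: trivial_group_def)
    have "h x = 0" if "h \<in> hom (?G {}) integer_group" for h
      using that hom_one[of h "?G {}" integer_group] x1 by simp
    thus ?case by auto
  next
    case (insert s S)
    let ?B = "cell_union K (cells_below n \<union> S)"
    let ?W = "?Y (insert s S)"
    have s: "s \<in> cells K" "dm s = n" using insert.prems by auto
    have D: "downward_closed K (cells_below n \<union> S)"
      using insert.prems by (intro downward_closed_below) auto
    have un: "cells_below n \<union> insert s S = insert s (cells_below n \<union> S)" by auto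
    interpret attached_cell ?W ?B n "\<Phi> s"
      using attached_cell_insert[OF D s(1)] s insert.hyps unfolding un by auto
    have AY0: "?A \<subseteq> ?B" by (auto simp: cell_union_def)
    have sphA: "\<Phi> s ` disc_sphere n \<subseteq> ?A" using char_map_sphere[OF s(1)] s by simp
    have sub: "subtopology ?W ?B = ?Y S"
      by (simp add: subtopology_subtopology cell_union_def Int_absorb1 Un_mono)
    have x: "x \<in> carrier (relative_homology_group p ?W ?A)" by (rule insert.prems(2))
    obtain x' z where x': "x' \<in> carrier (relative_homology_group p (?Y S) ?A)" and z: "z \<in> carrier ?HD"
      and xeq: "x = hom_induced p (?Y S) ?A ?W ?A id x' \<otimes>\<^bsub>?G (insert s S)\<^esub> hom_induced p ?D ?S ?W ?A (\<Phi> s) z"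
      by (rule relative_homology_decompose[OF AY0 sphA x, unfolded sub])
    obtain k :: int where k: "z = g [^]\<^bsub>?HD\<^esub> k" using gen[OF z] by blast
    have SS: "S \<subseteq> {c \<in> cells K. dm c = n}" using insert.prems by auto
    define G where "G = ?G (insert s S)"
    define \<eta> where "\<eta> t = hom_induced p ?D ?S ?W ?A (\<Phi> t)" for t
    define i where "i = hom_induced p (?Y S) ?A ?W ?A id"
    have \<eta>_hom: "group_hom ?HD G (\<eta> s)"
      unfolding group_hom_def group_hom_axioms_def \<eta>_def G_def by (auto simp only: hom_induced_hom group_relative_homology_group)
    have i_hom: "i \<in> hom (?G S) G"
      unfolding i_def G_def by (rule hom_induced_hom)
    obtain c :: "'c \<Rightarrow> int" where c: "\<And>h. h \<in> hom (?G S) integer_group \<Longrightarrow>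
        h x' = (\<Sum>s\<in>S. c s * h (hom_induced p ?D ?S (?Y S) ?A (\<Phi> s) g))"
      using insert.IH[OF SS x'] by blast
    have i_\<eta>: "i (hom_induced p ?D ?S (?Y S) ?A (\<Phi> t) g) = \<eta> t g" if t: "t \<in> S" for t
    proof -
      have t': "t \<in> cells K" "dm t = n" using insert.prems t by auto
      have sph: "\<Phi> t ` disc_sphere n \<subseteq> ?A" using char_map_sphere[OF t'(1)] unfolding t'(2) .
      have "open_cell K t \<subseteq> ?B" using t by (auto simp: cell_union_def)
      hence "\<Phi> t ` closed_disc n \<subseteq> ?B"
        using sph AY0 by (auto simp: closed_disc_eq open_cell_def t')
      moreover have "continuous_map ?D T (\<Phi> t)"
        using char_map_continuous[OF t'(1)] unfolding t'(2) .
      ultimately have "continuous_map ?D (?Y S) (\<Phi> t)"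
        by (auto simp: continuous_map_in_subtopology)
      moreover have "continuous_map (?Y S) ?W id"
        unfolding sub[symmetric] by (intro continuous_map_from_subtopology continuous_map_id)
      ultimately have "i (hom_induced p ?D ?S (?Y S) ?A (\<Phi> t) g) = hom_induced p ?D ?S ?W ?A (id \<circ> \<Phi> t) g"
        unfolding i_def using sph by (intro hom_induced_compose') (auto simp: image_subset_iff_funcset)
      thus ?thesis by (simp only: \<eta>_def id_comp)
    qed
    have "h x = (\<Sum>t\<in>insert s S. (c(s := k)) t * h (\<eta> t g))"
      if h: "h \<in> hom G integer_group" for h
    proof -
      interpret h: group_hom G integer_group h
        unfolding group_hom_def group_hom_axioms_def using h by (simp add: G_def)
      interpret \<eta>: group_hom ?HD G "\<eta> s" by (rule \<eta>_hom)
      have "h \<circ> i \<in> hom (?G S) integer_group"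
        using i_hom h by (rule hom_compose)
      from c[OF this] have "h (i x') = (\<Sum>t\<in>S. c t * h (i (hom_induced p ?D ?S (?Y S) ?A (\<Phi> t) g)))"
        by simp
      also have "\<dots> = (\<Sum>t\<in>S. c t * h (\<eta> t g))"
        by (intro sum.cong refl) (simp only: i_\<eta>)
      also have "\<dots> = (\<Sum>t\<in>S. (c(s := k)) t * h (\<eta> t g))"
        using insert.hyps by (intro sum.cong) auto
      finally have 1: "h (i x') = (\<Sum>t\<in>S. (c(s := k)) t * h (\<eta> t g))" .
      have "\<eta> s z = \<eta> s g [^]\<^bsub>G\<^esub> k" unfolding k using g by (rule \<eta>.hom_int_pow)
      hence "h (\<eta> s z) = k * h (\<eta> s g)"
        using h.hom_int_pow[of "\<eta> s g" k] g by simp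
      moreover have "h x = h (i x') + h (\<eta> s z)"
        unfolding xeq i_def[symmetric] \<eta>_def[symmetric] G_def[symmetric]
        using h.hom_mult[of "i x'" "\<eta> s z"] hom_in_carrier[OF i_hom x'] z by simp
      ultimately show ?thesis using 1 insert.hyps by simp
    qed
    thus ?case unfolding G_def \<eta>_def by (intro exI allI ballI)
  qed
qed

end

section \<open>The square of the cellular boundary\<close>

text \<open>A normalized isomorphism: it turns degrees into integers without a sign ambiguity.\<close>

lemma nsphere_homology_integer:
  obtains \<theta> v where "\<theta> \<in> iso (reduced_homology_group (int n) (nsphere n)) integer_group"
    "v \<in> carrier (reduced_homology_group (int n) (nsphere n))" "\<theta> v = 1"
proof -
  obtain \<theta> where \<theta>: "\<theta> \<in> iso (reduced_homology_group (int n) (nsphere n)) integer_group"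
    using reduced_homology_group_nsphere(1)[of n] by (auto simp: is_iso_def)
  hence "1 \<in> \<theta> ` carrier (reduced_homology_group (int n) (nsphere n))"
    by (simp add: iso_def bij_betw_def)
  thus thesis using \<theta> that by auto
qed

lemma hom_integer_group_pow:
  assumes "group G" "h \<in> hom G integer_group" "x \<in> carrier G"
  shows "h (x [^]\<^bsub>G\<^esub> (k::int)) = k * h x"
proof -
  interpret group_hom G integer_group h
    unfolding group_hom_def group_hom_axioms_def using assms by simp
  show ?thesis using hom_int_pow[OF assms(3)] by simp
qed

text \<open>The disc is contractible, so the boundary map identifies the relative group with the reduced homology
  of the sphere, which is infinite cyclic.\<close>

lemma disc_relative_homology_generator:
  obtains g where "g \<in> carrier (relative_homology_group (int (Suc m)) (top_of_set (closed_disc (Suc m))) (disc_sphere (Suc m)))"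
    "\<forall>z \<in> carrier (relative_homology_group (int (Suc m)) (top_of_set (closed_disc (Suc m))) (disc_sphere (Suc m))).
        \<exists>k::int. z = g [^]\<^bsub>relative_homology_group (int (Suc m)) (top_of_set (closed_disc (Suc m))) (disc_sphere (Suc m))\<^esub> k"
    "hom_boundary (int (Suc m)) (top_of_set (closed_disc (Suc m))) (disc_sphere (Suc m)) g
       \<in> carrier (reduced_homology_group (int m) (nsphere m))"
    "hom_boundary (int (Suc m)) (top_of_set (closed_disc (Suc m))) (disc_sphere (Suc m)) g
       \<noteq> \<one>\<^bsub>reduced_homology_group (int m) (nsphere m)\<^esub>"
proof -
  let ?D = "top_of_set (closed_disc (Suc m))" and ?S = "disc_sphere (Suc m)"
  let ?H = "relative_homology_group (int (Suc m)) ?D ?S"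
  let ?R = "reduced_homology_group (int m) (nsphere m)"
  let ?b = "hom_boundary (int (Suc m)) ?D ?S"
  have sub: "subtopology ?D ?S = nsphere m"
    by (simp add: nsphere_eq_disc_sphere subtopology_subtopology closed_disc_eq Int_absorb1)
  have "?b \<in> iso ?H (reduced_homology_group (int (Suc m) - 1) (subtopology ?D ?S))"
    using sphere_pole_in_sphere[of m]
    by (intro iso_relative_homology_of_contractible contractible_closed_disc) (auto simp: closed_disc_eq)
  hence b: "?b \<in> iso ?H ?R" by (simp add: sub)
  obtain \<theta> v where \<theta>: "\<theta> \<in> iso ?R integer_group" and v: "v \<in> carrier ?R" "\<theta> v = 1"
    by (rule nsphere_homology_integer)
  have h: "\<theta> \<circ> ?b \<in> iso ?H integer_group" using b \<theta> by (rule iso_set_trans)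
  from v(1) b obtain g where g: "g \<in> carrier ?H" "?b g = v"
    by (auto simp: iso_def bij_betw_def image_iff) (metis (no_types, lifting) imageE)
  have "\<exists>k::int. z = g [^]\<^bsub>?H\<^esub> k" if z: "z \<in> carrier ?H" for z
  proof -
    define k where "k = \<theta> (?b z)"
    have hh: "\<theta> \<circ> ?b \<in> hom ?H integer_group" using h by (simp add: iso_def)
    have "(\<theta> \<circ> ?b) (g [^]\<^bsub>?H\<^esub> k) = k * (\<theta> \<circ> ?b) g"
      by (rule hom_integer_group_pow[OF _ hh g(1)]) simp
    hence "(\<theta> \<circ> ?b) (g [^]\<^bsub>?H\<^esub> k) = (\<theta> \<circ> ?b) z" using g v by (simp add: k_def)
    moreover have "g [^]\<^bsub>?H\<^esub> k \<in> carrier ?H"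
      using g(1) by (intro group.int_pow_closed) auto
    moreover have "inj_on (\<theta> \<circ> ?b) (carrier ?H)" using h by (simp add: iso_def bij_betw_def)
    ultimately have "g [^]\<^bsub>?H\<^esub> k = z" using z by (rule_tac inj_onD)
    thus ?thesis by blast
  qed
  moreover have "v \<noteq> \<one>\<^bsub>?R\<^esub>"
    using hom_one[of \<theta> ?R integer_group] \<theta> v by (auto simp: iso_def)
  ultimately show thesis using g v by (intro that[of g]) auto
qed

context finite_CW_complex begin

lemma sphere_to_skeleton:
  assumes "f \<in> cells K" "dm f = Suc n"
  shows "continuous_map (nsphere n) (subtopology T (cell_union K (cells_below (Suc n)))) (\<Phi> f)"
proof -
  have "continuous_map (subtopology (top_of_set (closed_disc (Suc n))) (disc_sphere (Suc n))) T (\<Phi> f)"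
    using char_map_continuous[OF assms(1)] unfolding assms(2) by (rule continuous_map_from_subtopology)
  hence "continuous_map (nsphere n) T (\<Phi> f)"
    by (simp add: nsphere_eq_disc_sphere subtopology_subtopology closed_disc_eq Int_absorb1)
  thus ?thesis using char_map_sphere[OF assms(1)] assms(2)
    by (auto simp: continuous_map_in_subtopology nsphere_eq_disc_sphere)
qed

lemma collapse_disc:
  assumes "s \<in> cells K" "y \<in> closed_disc (dm s)"
  shows "collapse_onto K s (\<Phi> s y) = wrap_disc (dm s) y"
proof (cases "y \<in> open_disc (dm s)")
  case True
  thus ?thesis using char_map_inj[OF assms(1)] by (simp add: collapse_onto_def open_cell_def)
next
  case False
  hence y: "y \<in> disc_sphere (dm s)" using assms by (simp add: closed_disc_eq)
  have "s \<notin> cells_below (dm s)" by simp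
  hence "open_cell K s \<inter> cell_union K (cells_below (dm s)) = {}"
    using assms by (intro cell_union_disjoint) auto
  hence "\<Phi> s y \<notin> open_cell K s" using char_map_sphere[OF assms(1)] y by blast
  thus ?thesis by (simp add: collapse_onto_def wrap_disc_on_sphere[OF y])
qed

lemma collapse_outside: "x \<notin> open_cell K s \<Longrightarrow> collapse_onto K s x = sphere_pole (dm s)"
  by (simp add: collapse_onto_def)

lemma collapse_continuous:
  assumes s: "s \<in> cells K" "dm s = n"
  shows "continuous_map (subtopology T (cell_union K (cells_below (Suc n)))) (nsphere n) (collapse_onto K s)"
proof -
  define C where "C = cells_below (Suc n) - {s}"
  have ins: "cells_below (Suc n) = insert s C" using s by (auto simp: C_def)
  have "downward_closed K C" using s by (auto simp: C_def downward_closed_def)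
  then interpret attached_cell "subtopology T (cell_union K (insert s C))" "cell_union K C" "dm s" "\<Phi> s"
    using s by (intro attached_cell_insert) (auto simp: C_def)
  have disj: "open_cell K s \<inter> cell_union K C = {}"
    using s by (intro cell_union_disjoint) (auto simp: C_def)
  show ?thesis unfolding ins
  proof (rule continuous_glue)
    have "sphere_pole n \<in> topspace (nsphere n)"
      by (simp add: nsphere_eq_disc_sphere sphere_pole_in_sphere)
    hence "continuous_map (subtopology (subtopology T (cell_union K (insert s C))) (cell_union K C)) (nsphere n)
            (\<lambda>x. sphere_pole n)"
      by simp
    thus "continuous_map (subtopology (subtopology T (cell_union K (insert s C))) (cell_union K C)) (nsphere n)
            (collapse_onto K s)"
    proof (rule continuous_map_eq)
      fix x assume "x \<in> topspace (subtopology (subtopology T (cell_union K (insert s C))) (cell_union K C))"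
      hence "x \<notin> open_cell K s" using disj by auto
      thus "sphere_pole n = collapse_onto K s x" using collapse_outside s by metis
    qed
    have "continuous_map D (nsphere n) (wrap_disc n)"
      using continuous_on_wrap_disc s by (auto simp: nsphere_eq_disc_sphere wrap_disc_in_sphere)
    thus "continuous_map D (nsphere n) (collapse_onto K s \<circ> \<Phi> s)"
      by (rule continuous_map_eq) (use s in \<open>auto simp: collapse_disc\<close>)
  qed
qed

text \<open>Let \<open>x\<close> be the class, relative to the lower skeleton, of the attaching map of \<open>f\<close>. It is a
  combination of the classes of the \<open>(m+1)\<close>-cells with coefficients \<open>c\<close>. Collapsing onto the cell
  \<open>t\<close> kills all cells except \<open>t\<close>, and shows that the incidence number of \<open>f\<close> and \<open>t\<close> is \<open>c t\<close> times
  a constant \<open>w\<close>, the degree of the wrapping map of the disc.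
  On the other hand \<open>x\<close> comes from absolute homology, so its boundary vanishes. Followed by the
  collapse onto \<open>r\<close>, the boundary takes the class of the cell \<open>s\<close> to the incidence number of \<open>s\<close> and
  \<open>r\<close>, up to a nonzero factor \<open>e\<close> common to all cells, so that the sum of \<open>c s\<close> times these
  incidence numbers is zero.\<close>

lemma incidence_sum_zero:
  assumes f: "f \<in> cells K" "dm f = Suc (Suc m)" and r: "r \<in> cells K" "dm r = m"
  shows "(\<Sum>s\<in>{s \<in> cells K. dm s = Suc m}. incidence K s f * incidence K r s) = 0"
proof -
  let ?n = "Suc m" and ?S = "{s \<in> cells K. dm s = Suc m}"
  let ?D = "top_of_set (closed_disc (Suc m))" and ?dD = "disc_sphere (Suc m)"
  let ?H = "relative_homology_group (int (Suc m)) ?D ?dD"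
  define B where "B = cell_union K (cells_below (Suc m))"
  define Y where "Y = subtopology T (cell_union K (cells_below (Suc (Suc m))))"
  let ?G = "relative_homology_group (int (Suc m)) Y B"
  have below: "cells_below (Suc (Suc m)) = cells_below (Suc m) \<union> ?S" by auto
  have BY: "subtopology Y B = subtopology T B"
  proof -
    have "B \<subseteq> cell_union K (cells_below (Suc (Suc m)))" by (auto simp: B_def cell_union_def)
    thus ?thesis by (simp add: Y_def subtopology_subtopology Int_absorb1)
  qed
  obtain g where g: "g \<in> carrier ?H"
    and gen: "\<forall>z\<in>carrier ?H. \<exists>k::int. z = g [^]\<^bsub>?H\<^esub> k"
    and bg: "hom_boundary (int (Suc m)) ?D ?dD g \<in> carrier (reduced_homology_group (int m) (nsphere m))"
      "hom_boundary (int (Suc m)) ?D ?dD g \<noteq> \<one>\<^bsub>reduced_homology_group (int m) (nsphere m)\<^esub>"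
    by (rule disc_relative_homology_generator[of m])
  obtain \<theta> \<iota> where \<theta>: "\<theta> \<in> iso (reduced_homology_group (int (Suc m)) (nsphere (Suc m))) integer_group"
    and \<iota>: "\<iota> \<in> carrier (reduced_homology_group (int (Suc m)) (nsphere (Suc m)))" "\<theta> \<iota> = 1"
    by (rule nsphere_homology_integer)
  have \<phi>f: "continuous_map (nsphere (Suc m)) Y (\<Phi> f)"
    using sphere_to_skeleton[OF f] by (simp add: Y_def)
  define a where "a = hom_induced (int (Suc m)) (nsphere (Suc m)) {} Y {} (\<Phi> f) \<iota>"
  have a: "a \<in> carrier (homology_group (int (Suc m)) Y)"
    unfolding a_def by (rule hom_induced_carrier)
  define x where "x = hom_induced (int (Suc m)) Y {} Y B id a"
  have x: "x \<in> carrier ?G" unfolding x_def by (rule hom_induced_carrier)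
  \<comment> \<open>the class of the attaching map of \<open>f\<close>, expressed through the \<open>(m + 1)\<close>-cells\<close>
  have "\<exists>c :: 'c \<Rightarrow> int. \<forall>h \<in> hom ?G integer_group.
       h x = (\<Sum>s\<in>?S. c s * h (hom_induced (int (Suc m)) ?D ?dD Y B (\<Phi> s) g))"
    unfolding Y_def B_def below
    by (rule relative_homology_skeleton_generated[OF order_refl g gen[rule_format] x[unfolded Y_def B_def below]])
  then obtain c :: "'c \<Rightarrow> int" where "\<forall>h \<in> hom ?G integer_group.
       h x = (\<Sum>s\<in>?S. c s * h (hom_induced (int (Suc m)) ?D ?dD Y B (\<Phi> s) g))"
    by (rule exE)
  note c = this[rule_format]
  have char: "continuous_map ?D Y (\<Phi> s)" "\<Phi> s \<in> ?dD \<rightarrow> B" if "s \<in> ?S" for s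
  proof -
    have s: "s \<in> cells K" "dm s = Suc m" using that by auto
    have sph: "\<Phi> s ` ?dD \<subseteq> B" using char_map_sphere[OF s(1)] unfolding s(2) B_def .
    thus "\<Phi> s \<in> ?dD \<rightarrow> B" by blast
    have "open_cell K s \<subseteq> cell_union K (cells_below (Suc (Suc m)))"
      using s by (auto simp: cell_union_def)
    moreover have "B \<subseteq> cell_union K (cells_below (Suc (Suc m)))"
      by (auto simp: cell_union_def B_def)
    ultimately have "\<Phi> s ` closed_disc (Suc m) \<subseteq> cell_union K (cells_below (Suc (Suc m)))"
      using sph s by (auto simp: closed_disc_eq open_cell_def)
    moreover have "continuous_map ?D T (\<Phi> s)"
      using char_map_continuous[OF s(1)] unfolding s(2) .
    ultimately show "continuous_map ?D Y (\<Phi> s)"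
      by (auto simp: Y_def continuous_map_in_subtopology)
  qed

  \<comment> \<open>the collapses onto the \<open>(m + 1)\<close>-cells read off the coefficients \<open>c\<close>, up to a common factor\<close>
  have "\<exists>w. \<forall>t\<in>?S. incidence K t f = c t * w"
  proof -
    let ?p = "sphere_pole (Suc m)"
    let ?N = "nsphere (Suc m)"
    let ?R = "reduced_homology_group (int (Suc m)) ?N"
    let ?RP = "relative_homology_group (int (Suc m)) ?N {?p}"
    define \<kappa> where "\<kappa> = hom_induced (int (Suc m)) ?N {} ?N {?p} id"
    have pole: "?p \<in> topspace ?N" by (simp add: nsphere_eq_disc_sphere sphere_pole_in_sphere)
    have \<kappa>: "\<kappa> \<in> iso ?R ?RP" unfolding \<kappa>_def
      by (rule iso_reduced_homology_by_contractible)
        (use pole in \<open>auto simp: contractible_space_subtopology_singleton\<close>)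
    define \<rho> where "\<rho> = \<theta> \<circ> inv_into (carrier ?R) \<kappa>"
    have \<rho>: "\<rho> \<in> iso ?RP integer_group"
      unfolding \<rho>_def using group.iso_set_sym[OF group_reduced_homology_group \<kappa>] \<theta> by (rule iso_set_trans)
    define w where "w = \<rho> (hom_induced (int (Suc m)) ?D ?dD ?N {?p} (wrap_disc (Suc m)) g)"
    have "incidence K t f = c t * w" if t: "t \<in> ?S" for t
    proof -
      have t': "t \<in> cells K" "dm t = Suc m" using t by auto
      define q where "q = collapse_onto K t"
      have qc: "continuous_map Y ?N q"
        unfolding Y_def q_def by (rule collapse_continuous[OF t'])
      have "open_cell K t \<inter> B = {}"
        unfolding B_def by (rule cell_union_disjoint) (use t' in auto)
      hence qB: "q \<in> B \<rightarrow> {?p}" using collapse_outside[of _ t] unfolding q_def t'(2) by blast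
      define h where "h = \<rho> \<circ> hom_induced (int (Suc m)) Y B ?N {?p} q"
      have "h \<in> hom ?G integer_group"
        unfolding h_def by (rule hom_compose[OF hom_induced_hom]) (use \<rho> in \<open>simp add: iso_def\<close>)
      from c[OF this] have hx: "h x = (\<Sum>s\<in>?S. c s * h (hom_induced (int (Suc m)) ?D ?dD Y B (\<Phi> s) g))" .
      have h_cell: "h (hom_induced (int (Suc m)) ?D ?dD Y B (\<Phi> s) g) = (if s = t then w else 0)"
        if s: "s \<in> ?S" for s
      proof -
        have s': "s \<in> cells K" "dm s = Suc m" using s by auto
        have eq: "h (hom_induced (int (Suc m)) ?D ?dD Y B (\<Phi> s) g)
           = \<rho> (hom_induced (int (Suc m)) ?D ?dD ?N {?p} (q \<circ> \<Phi> s) g)"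
          by (simp only: h_def o_apply[of \<rho>] hom_induced_compose'[OF char[OF s] qc qB])
        show ?thesis
        proof (cases "s = t")
          case True
          have "hom_induced (int (Suc m)) ?D ?dD ?N {?p} (q \<circ> \<Phi> s)
              = hom_induced (int (Suc m)) ?D ?dD ?N {?p} (wrap_disc (Suc m))"
            by (rule hom_induced_eq) (use s' in \<open>auto simp: q_def True[symmetric] collapse_disc\<close>)
          thus ?thesis unfolding eq w_def using True by simp
        next
          case False
          let ?P = "subtopology ?N {?p}"
          have "open_cell K t \<inter> open_cell K s = {}"
            using open_cells_disjoint[OF t'(1) s'(1)] False by auto
          moreover have "\<Phi> s ` closed_disc (Suc m) \<subseteq> open_cell K s \<union> B"
            using char(2)[OF s] s' by (auto simp: closed_disc_eq open_cell_def)
          ultimately have "q (\<Phi> s y) = ?p" if "y \<in> closed_disc (Suc m)" for y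
            using that \<open>open_cell K t \<inter> B = {}\<close> t' unfolding q_def
            by (subst collapse_outside) auto
          hence "hom_induced (int (Suc m)) ?D ?dD ?N {?p} (q \<circ> \<Phi> s)
              = hom_induced (int (Suc m)) ?D ?dD ?N {?p} (id \<circ> (\<lambda>y. ?p))"
            by (intro hom_induced_eq) auto
          also have "\<dots> = hom_induced (int (Suc m)) ?P {?p} ?N {?p} id \<circ>
               hom_induced (int (Suc m)) ?D ?dD ?P {?p} (\<lambda>y. ?p)"
            by (rule hom_induced_compose) (use pole in \<open>auto intro: continuous_map_from_subtopology\<close>)
          finally have const: "hom_induced (int (Suc m)) ?D ?dD ?N {?p} (q \<circ> \<Phi> s) g
             = hom_induced (int (Suc m)) ?P {?p} ?N {?p} id (hom_induced (int (Suc m)) ?D ?dD ?P {?p} (\<lambda>y. ?p) g)"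
            by (simp only: o_apply)
          have "topspace ?P = {?p}" using pole by auto
          hence "trivial_group (relative_homology_group (int (Suc m)) ?P {?p})"
            using trivial_relative_homology_group_topspace[of "int (Suc m)" ?P] by (simp only:)
          hence P1: "hom_induced (int (Suc m)) ?D ?dD ?P {?p} (\<lambda>y. ?p) g
             = \<one>\<^bsub>relative_homology_group (int (Suc m)) ?P {?p}\<^esub>"
            using hom_induced_carrier[of "int (Suc m)" ?D ?dD ?P "{?p}" "\<lambda>y. ?p" g]
            unfolding trivial_group_def by blast
          have "hom_induced (int (Suc m)) ?P {?p} ?N {?p} id
              \<one>\<^bsub>relative_homology_group (int (Suc m)) ?P {?p}\<^esub> = \<one>\<^bsub>?RP\<^esub>"
            by (rule hom_one[OF hom_induced_hom group_relative_homology_group group_relative_homology_group])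
          moreover have "\<rho> \<one>\<^bsub>?RP\<^esub> = 0"
            using hom_one[of \<rho> ?RP integer_group] \<rho> by (simp add: iso_def)
          ultimately show ?thesis unfolding eq const P1 using False by (simp only: if_False)
        qed
      qed
      have "h x = (\<Sum>s\<in>?S. if s = t then c t * w else 0)"
        unfolding hx
      proof (intro sum.cong refl)
        fix s assume "s \<in> ?S"
        thus "c s * h (hom_induced (int (Suc m)) ?D ?dD Y B (\<Phi> s) g) = (if s = t then c t * w else 0)"
          by (simp only: h_cell) auto
      qed
      also have "\<dots> = c t * w"
        using t finite_cells by (subst sum.delta) auto
      finally have hx: "h x = c t * w" .
      have "hom_induced (int (Suc m)) Y B ?N {?p} q x
          = hom_induced (int (Suc m)) Y {} ?N {?p} (q \<circ> id) a"
        unfolding x_def using qc qB by (intro hom_induced_compose') auto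
      also have "\<dots> = hom_induced (int (Suc m)) ?N {} ?N {?p} (q \<circ> id \<circ> \<Phi> f) \<iota>"
        unfolding a_def using \<phi>f qc by (intro hom_induced_compose') auto
      also have "\<dots> = hom_induced (int (Suc m)) ?N {} ?N {?p} (id \<circ> (q \<circ> \<Phi> f)) \<iota>"
        by (simp only: comp_id id_comp)
      also have "\<dots> = \<kappa> (hom_induced (int (Suc m)) ?N {} ?N {} (q \<circ> \<Phi> f) \<iota>)"
        unfolding \<kappa>_def using \<phi>f qc
        by (intro hom_induced_compose'[symmetric] continuous_map_compose[of _ Y]) auto
      finally have qx: "hom_induced (int (Suc m)) Y B ?N {?p} q x
          = \<kappa> (hom_induced (int (Suc m)) ?N {} ?N {} (q \<circ> \<Phi> f) \<iota>)" .
      have deg: "hom_induced (int (Suc m)) ?N {} ?N {} (q \<circ> \<Phi> f) \<iota> = \<iota> [^]\<^bsub>?R\<^esub> incidence K t f"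
        using Brouwer_degree2[OF \<iota>(1)] by (simp only: incidence_def q_def t'(2))
      have "h x = \<rho> (\<kappa> (\<iota> [^]\<^bsub>?R\<^esub> incidence K t f))" by (simp only: h_def o_apply qx deg)
      also have "\<dots> = \<theta> (\<iota> [^]\<^bsub>?R\<^esub> incidence K t f)"
      proof -
        have "\<iota> [^]\<^bsub>?R\<^esub> incidence K t f \<in> carrier ?R"
          using \<iota>(1) by (intro group.int_pow_closed group_reduced_homology_group)
        moreover have "inj_on \<kappa> (carrier ?R)" using \<kappa> by (simp add: iso_def bij_betw_def)
        ultimately show ?thesis by (simp only: \<rho>_def o_apply inv_into_f_f)
      qed
      also have "\<dots> = incidence K t f * \<theta> \<iota>"
        using \<theta> by (intro hom_integer_group_pow \<iota>(1) group_reduced_homology_group) (simp add: iso_def)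
      finally show ?thesis using hx \<iota>(2) by simp
    qed
    thus ?thesis by blast
  qed
  then obtain w where w: "\<And>t. t \<in> ?S \<Longrightarrow> incidence K t f = c t * w" by blast

  \<comment> \<open>the boundary of a class coming from the absolute homology vanishes\<close>
  have "(\<Sum>s\<in>?S. c s * incidence K r s) = 0"
  proof -
    let ?R = "reduced_homology_group (int m) (nsphere m)"
    define q where "q = collapse_onto K r"
    have qc: "continuous_map (subtopology Y B) (nsphere m) q"
      unfolding BY unfolding B_def q_def by (rule collapse_continuous[OF r])
    obtain \<theta>' v where \<theta>': "\<theta>' \<in> iso ?R integer_group"
      by (rule nsphere_homology_integer)
    define \<beta> where "\<beta> = hom_induced (int m) (subtopology Y B) {} (nsphere m) {} q"
    define h where "h = \<theta>' \<circ> (\<beta> \<circ> hom_boundary (int (Suc m)) Y B)"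
    have im: "int (Suc m) - 1 = int m" by simp
    have bd: "hom_boundary (int (Suc m)) Y B \<in> hom ?G (reduced_homology_group (int m) (subtopology Y B))"
      using hom_boundary_reduced_hom[of "int (Suc m)" Y B] unfolding im .
    have "h \<in> hom ?G integer_group"
      unfolding h_def \<beta>_def
      by (intro hom_compose[OF hom_compose[OF bd hom_induced_reduced_hom]]) (use \<theta>' in \<open>simp add: iso_def\<close>)
    from c[OF this] have hx: "h x = (\<Sum>s\<in>?S. c s * h (hom_induced (int (Suc m)) ?D ?dD Y B (\<Phi> s) g))" .
    define e where "e = \<theta>' (hom_boundary (int (Suc m)) ?D ?dD g)"
    have h_cell: "h (hom_induced (int (Suc m)) ?D ?dD Y B (\<Phi> s) g) = incidence K r s * e"
      if s: "s \<in> ?S" for s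
    proof -
      have s': "s \<in> cells K" "dm s = Suc m" using s by auto
      have sub: "subtopology ?D ?dD = nsphere m"
        by (simp add: nsphere_eq_disc_sphere subtopology_subtopology closed_disc_eq Int_absorb1)
      have b1: "hom_boundary (int (Suc m)) Y B (hom_induced (int (Suc m)) ?D ?dD Y B (\<Phi> s) g)
          = hom_induced (int m) (nsphere m) {} (subtopology Y B) {} (\<Phi> s) (hom_boundary (int (Suc m)) ?D ?dD g)"
        using fun_cong[OF naturality_hom_induced[OF char[OF s], of "int (Suc m)"], of g]
        unfolding im sub by (simp only: o_apply)
      have b2: "\<beta> (hom_induced (int m) (nsphere m) {} (subtopology Y B) {} (\<Phi> s) (hom_boundary (int (Suc m)) ?D ?dD g))
         = hom_induced (int m) (nsphere m) {} (nsphere m) {} (q \<circ> \<Phi> s) (hom_boundary (int (Suc m)) ?D ?dD g)"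
        unfolding \<beta>_def
      proof (rule hom_induced_compose'[OF _ _ qc])
        show "continuous_map (nsphere m) (subtopology Y B) (\<Phi> s)"
          using sphere_to_skeleton[OF s'] unfolding BY unfolding B_def .
      qed auto
      have b3: "hom_induced (int m) (nsphere m) {} (nsphere m) {} (q \<circ> \<Phi> s) (hom_boundary (int (Suc m)) ?D ?dD g)
          = hom_boundary (int (Suc m)) ?D ?dD g [^]\<^bsub>?R\<^esub> incidence K r s"
        using Brouwer_degree2[OF bg(1)] by (simp only: incidence_def q_def r(2))
      have "\<theta>' (hom_boundary (int (Suc m)) ?D ?dD g [^]\<^bsub>?R\<^esub> incidence K r s) = incidence K r s * e"
        unfolding e_def
        using \<theta>' by (intro hom_integer_group_pow bg(1) group_reduced_homology_group) (simp add: iso_def)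
      thus ?thesis by (simp only: h_def o_apply b1 b2 b3)
    qed
    have "hom_boundary (int (Suc m)) Y B x = \<one>\<^bsub>homology_group (int m) (subtopology Y B)\<^esub>"
    proof -
      have "x \<in> hom_induced (int (Suc m)) Y {} Y B id ` carrier (homology_group (int (Suc m)) Y)"
        unfolding x_def using a by (rule imageI)
      also have "\<dots> = kernel ?G (homology_group (int (Suc m) - 1) (subtopology Y B)) (hom_boundary (int (Suc m)) Y B)"
        using homology_exactness_axiom_1[of "int (Suc m)" Y B] by simp
      finally show ?thesis unfolding im by (simp add: kernel_def)
    qed
    hence "h x = \<theta>' (\<beta> \<one>\<^bsub>reduced_homology_group (int m) (subtopology Y B)\<^esub>)"
      by (simp only: h_def o_apply one_reduced_homology_group)
    moreover have "\<beta> \<one>\<^bsub>reduced_homology_group (int m) (subtopology Y B)\<^esub> = \<one>\<^bsub>?R\<^esub>"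
      unfolding \<beta>_def
      by (rule hom_one[OF hom_induced_reduced_hom group_reduced_homology_group group_reduced_homology_group])
    moreover have \<theta>'1: "\<theta>' \<one>\<^bsub>?R\<^esub> = 0"
      using hom_one[of \<theta>' ?R integer_group] \<theta>' by (simp add: iso_def)
    ultimately have "h x = 0" by (simp only:)
    moreover have "h x = (\<Sum>s\<in>?S. c s * (incidence K r s * e))"
      unfolding hx by (intro sum.cong refl) (simp only: h_cell)
    ultimately have "0 = (\<Sum>s\<in>?S. c s * (incidence K r s * e))" by simp
    also have "\<dots> = (\<Sum>s\<in>?S. c s * incidence K r s) * e"
      by (simp add: sum_distrib_right mult.assoc)
    finally have "(\<Sum>s\<in>?S. c s * incidence K r s) * e = 0" by simp
    moreover have "e \<noteq> 0"
    proof
      assume "e = 0"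
      hence "\<theta>' (hom_boundary (int (Suc m)) ?D ?dD g) = \<theta>' \<one>\<^bsub>?R\<^esub>"
        using \<theta>'1 by (simp add: e_def)
      moreover have "inj_on \<theta>' (carrier ?R)" using \<theta>' by (simp add: iso_def bij_betw_def)
      moreover have "\<one>\<^bsub>?R\<^esub> \<in> carrier ?R"
        by (intro monoid.one_closed group.is_monoid group_reduced_homology_group)
      ultimately show False using bg by (meson inj_onD)
    qed
    ultimately show ?thesis by simp
  qed
  hence "(\<Sum>s\<in>?S. c s * incidence K r s) * w = 0" by simp
  also have "(\<Sum>s\<in>?S. c s * incidence K r s) * w = (\<Sum>s\<in>?S. incidence K s f * incidence K r s)"
    unfolding sum_distrib_right by (intro sum.cong refl) (simp add: w)
  finally show ?thesis .
qed

end

section \<open>The augmented cellular chain complex\<close>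

lemma disc_sphere_1: "y \<in> disc_sphere 1 \<Longrightarrow> y = sphere_pole 0 \<or> y = (\<lambda>i. if i = 0 then -1 else 0)"
proof -
  assume "y \<in> disc_sphere 1"
  hence "(y 0)\<^sup>2 = 1" "\<And>i. i \<noteq> 0 \<Longrightarrow> y i = 0" by (auto simp: disc_simps sq_norm_def)
  moreover from this have "y 0 = 1 \<or> y 0 = -1" by (simp add: power2_eq_1_iff)
  ultimately show ?thesis by (auto simp: sphere_pole_def fun_eq_iff)
qed

context finite_CW_complex begin

text \<open>On the sphere of dimension \<open>0\<close>, composing the attaching map with the collapse onto a vertex gives the
  identity if the edge starts there, the reflection if it ends there, and a constant map if it does
  neither or both.\<close>

lemma incidence_vertices_sum_zero:
  assumes f: "f \<in> cells K" "dm f = 1"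
  shows "(\<Sum>s\<in>{s \<in> cells K. dm s = 0}. incidence K s f) = 0"
proof -
  define p where "p = sphere_pole 0"
  define m where "m = (\<lambda>i::nat. if i = 0 then -1 else 0 :: real)"
  have S: "y = p \<or> y = m" if "y \<in> disc_sphere 1" for y
    using disc_sphere_1[OF that] by (simp add: p_def m_def)
  have pm: "p \<in> disc_sphere 1" "m \<in> disc_sphere 1" "p \<noteq> m"
    by (auto simp: p_def m_def sphere_pole_def disc_simps sq_norm_def dest: fun_cong[of _ _ 0])
  have swap: "(\<lambda>x i. if i = 0 then - x i else x i) p = m" "(\<lambda>x i. if i = 0 then - x i else x i) m = p"
    by (auto simp: p_def m_def sphere_pole_def)
  have vertex: "\<exists>s. s \<in> cells K \<and> dm s = 0 \<and> \<Phi> f y \<in> open_cell K s" if "y \<in> disc_sphere 1" for y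
    using char_map_sphere[OF f(1)] that f(2) by (auto simp: cell_union_def)
  obtain a where a: "a \<in> cells K" "dm a = 0" "\<Phi> f m \<in> open_cell K a" using vertex pm by blast
  obtain b where b: "b \<in> cells K" "dm b = 0" "\<Phi> f p \<in> open_cell K b" using vertex pm by blast
  have collapse: "collapse_onto K s (\<Phi> f y) = (if s = c then m else p)"
    if s: "s \<in> cells K" "dm s = 0" and c: "c \<in> cells K" "\<Phi> f y \<in> open_cell K c" for s c y
  proof (cases "s = c")
    case True
    moreover have "wrap_disc 0 z = m" for z by (auto simp: wrap_disc_def m_def sq_norm_def)
    ultimately show ?thesis using s c by (simp add: collapse_onto_def)
  next
    case False
    hence "\<Phi> f y \<notin> open_cell K s" using open_cells_disjoint[OF s(1) c(1)] c by auto
    thus ?thesis using False s by (simp add: collapse_outside p_def)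
  qed
  have deg: "incidence K s f = (if s = a then 1 else 0) - (if s = b then 1 else 0)"
    if s: "s \<in> cells K" "dm s = 0" for s
  proof -
    have inc: "incidence K s f = Brouwer_degree2 0 g"
      if "g m = (if s = a then m else p)" "g p = (if s = b then m else p)" for g
      unfolding incidence_def s(2)
    proof (rule Brouwer_degree2_eq)
      fix x assume "x \<in> topspace (nsphere 0)"
      hence "x = p \<or> x = m" using S by (simp add: nsphere_eq_disc_sphere)
      thus "(collapse_onto K s \<circ> \<Phi> f) x = g x"
        using that collapse[OF s a(1,3)] collapse[OF s b(1,3)] by auto
    qed
    consider "s = a" "s = b" | "s = a" "s \<noteq> b" | "s \<noteq> a" "s = b" | "s \<noteq> a" "s \<noteq> b" by blast
    thus ?thesis
    proof cases
      case 1 thus ?thesis using inc[of "\<lambda>x. m"] by (simp add: Brouwer_degree2_const)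
    next
      case 2 thus ?thesis using inc[of id] by simp
    next
      case 3 thus ?thesis using inc[of "\<lambda>x i. if i = 0 then - x i else x i"] swap
        by (simp add: Brouwer_degree2_reflection)
    next
      case 4 thus ?thesis using inc[of "\<lambda>x. p"] by (simp add: Brouwer_degree2_const)
    qed
  qed
  have "finite {s \<in> cells K. dm s = 0}" using finite_cells by simp
  thus ?thesis using a b by (simp add: deg sum_subtractf sum.delta)
qed

lemma basis_boundary_keys:
  assumes "x \<in> chain_basis K j"
  shows "Poly_Mapping.keys (basis_boundary K x) \<subseteq> chain_basis K (j - 1)"
proof (cases x)
  case (Some f)
  hence f: "int (dm f) = j" using assms by (auto simp: chain_basis_def k_cells_def split: if_splits)
  show ?thesis
  proof (cases "dm f = 0")
    case False
    hence "chain_basis K (j - 1) = Some ` k_cells K (int (dm f) - 1)" using f by (auto simp: chain_basis_def)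
    thus ?thesis using False Some
      by (auto dest!: subsetD[OF Poly_Mapping.keys_sum] subsetD[OF keys_cmul])
  qed (use Some f in \<open>simp add: chain_basis_def\<close>)
qed simp

lemma boundary_keys:
  assumes "Poly_Mapping.keys z \<subseteq> chain_basis K j"
  shows "Poly_Mapping.keys (cell_boundary K z) \<subseteq> chain_basis K (j - 1)"
  using keys_frag_extend[of "basis_boundary K" z] basis_boundary_keys assms
  unfolding cell_boundary_def by blast

text \<open>In dimension one the claim concerns the augmentation, in higher dimensions incidence numbers of
  consecutive cells, hence the two different inputs.\<close>

lemma boundary_boundary_basis:
  assumes "x \<in> chain_basis K j"
  shows "cell_boundary K (basis_boundary K x) = 0"
proof (cases x)
  case None
  thus ?thesis by (simp add: cell_boundary_def)
next
  case (Some f)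
  hence f: "f \<in> cells K" using assms by (auto simp: chain_basis_def k_cells_def split: if_splits)
  have fin: "finite (k_cells K i)" for i using finite_cells by (simp add: k_cells_def)
  have bd: "cell_boundary K (basis_boundary K x)
      = (\<Sum>s\<in>k_cells K (int (dm f) - 1). frag_cmul (incidence K s f) (basis_boundary K (Some s)))"
    if "dm f \<noteq> 0"
    using that Some fin by (simp add: cell_boundary_def frag_extend_sum frag_extend_cmul)
  consider "dm f = 0" | "dm f = 1" | m where "dm f = Suc (Suc m)"
    by (metis One_nat_def not0_implies_Suc)
  thus ?thesis
  proof cases
    case 1 thus ?thesis using Some by (simp add: cell_boundary_def)
  next
    case 2
    have V: "k_cells K (int (dm f) - 1) = {s \<in> cells K. dm s = 0}" using 2 by (auto simp: k_cells_def)
    have "cell_boundary K (basis_boundary K x)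
        = (\<Sum>s\<in>{s \<in> cells K. dm s = 0}. frag_cmul (incidence K s f) (frag_of None))"
      using bd 2 unfolding V by simp
    also have "\<dots> = frag_cmul (\<Sum>s\<in>{s \<in> cells K. dm s = 0}. incidence K s f) (frag_of None)"
      by (rule poly_mapping_eqI) (simp add: lookup_sum sum_distrib_right)
    finally show ?thesis using incidence_vertices_sum_zero[OF f 2] by simp
  next
    case 3
    have V: "k_cells K (int (dm f) - 1) = {s \<in> cells K. dm s = Suc m}" using 3 by (auto simp: k_cells_def)
    let ?R = "{r \<in> cells K. dm r = m}"
    have R: "k_cells K (int m) = ?R" by (auto simp: k_cells_def)
    have "cell_boundary K (basis_boundary K x)
        = (\<Sum>s\<in>{s \<in> cells K. dm s = Suc m}. frag_cmul (incidence K s f)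
             (\<Sum>r\<in>?R. frag_cmul (incidence K r s) (frag_of (Some r))))"
      using bd 3 unfolding V by (simp add: R)
    also have "\<dots> = (\<Sum>s\<in>{s \<in> cells K. dm s = Suc m}. \<Sum>r\<in>?R.
        frag_cmul (incidence K s f * incidence K r s) (frag_of (Some r)))"
      by (simp add: frag_cmul_sum)
    also have "\<dots> = (\<Sum>r\<in>?R. \<Sum>s\<in>{s \<in> cells K. dm s = Suc m}.
        frag_cmul (incidence K s f * incidence K r s) (frag_of (Some r)))"
      by (rule sum.swap)
    also have "\<dots> = (\<Sum>r\<in>?R. frag_cmul (\<Sum>s\<in>{s \<in> cells K. dm s = Suc m}.
        incidence K s f * incidence K r s) (frag_of (Some r)))"
      by (intro sum.cong refl poly_mapping_eqI) (simp add: lookup_sum sum_distrib_right)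
    also have "\<dots> = 0"
      by (intro sum.neutral ballI) (use incidence_sum_zero[OF f 3] in auto)
    finally show ?thesis .
  qed
qed

lemma boundary_boundary:
  assumes "Poly_Mapping.keys z \<subseteq> chain_basis K j"
  shows "cell_boundary K (cell_boundary K z) = 0"
  using assms
  by (rule frag_induction)
    (use boundary_boundary_basis in \<open>auto simp: cell_boundary_def frag_extend_diff\<close>)

end

section \<open>Determinants indexed by finite sets\<close>

text \<open>A determinant whose rows and columns are indexed by the same finite set, so that no enumeration of the
  cells has to be chosen. A minor with rows \<open>S\<close> and columns \<open>F\<close> is obtained by identifying \<open>S\<close> with
  \<open>F\<close> by some bijection, whose choice affects only the sign.\<close>

definition det_on :: "'i set \<Rightarrow> ('i \<Rightarrow> 'i \<Rightarrow> 'k::comm_ring_1) \<Rightarrow> 'k" where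
  "det_on S M = (\<Sum>p | p permutes S. of_int (sign p) * (\<Prod>i\<in>S. M i (p i)))"

lemma det_on_cong:
  assumes "\<And>i j. i \<in> S \<Longrightarrow> j \<in> S \<Longrightarrow> M i j = N i j"
  shows "det_on S M = det_on S N"
  unfolding det_on_def
proof (rule sum.cong[OF refl])
  fix p assume "p \<in> {p. p permutes S}"
  hence "(\<Prod>i\<in>S. M i (p i)) = (\<Prod>i\<in>S. N i (p i))"
    using assms by (intro prod.cong refl) (auto simp: permutes_in_image)
  thus "of_int (sign p) * (\<Prod>i\<in>S. M i (p i)) = of_int (sign p) * (\<Prod>i\<in>S. N i (p i))" by simp
qed

text \<open>This bridge to matrices indexed by numbers imports transposition, alternation and the
  characterization of singular matrices.\<close>

lemma det_on_enumerate:
  assumes e: "bij_betw e {0..<n} S"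
  shows "det_on S M = Determinant.det (mat n n (\<lambda>(i, j). M (e i) (e j)))"
proof -
  let ?e' = "inv_into {0..<n} e"
  let ?T = "\<lambda>p x. if x \<in> S then e (p (?e' x)) else x"
  have e': "?e' (e i) = i" if "i \<in> {0..<n}" for i
    using e that by (simp add: bij_betw_def)
  have "det_on S M = (\<Sum>p | p permutes {0..<n}. of_int (sign (?T p)) * (\<Prod>i\<in>S. M i (?T p i)))"
    unfolding det_on_def
    by (rule sum.reindex_bij_betw[symmetric, OF bij_betw_permutations[OF e]])
  also have "\<dots> = (\<Sum>p | p permutes {0..<n}. of_int (sign p) * (\<Prod>i = 0..<n. M (e i) (e (p i))))"
  proof (rule sum.cong[OF refl])
    fix p assume p: "p \<in> {p. p permutes {0..<n}}"
    interpret permutes_bij_finite p "{0..<n}" S e ?e' "?T p"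
      by unfold_locales (use p e e' in auto)
    have "(\<Prod>i\<in>S. M i (?T p i)) = (\<Prod>i = 0..<n. M (e i) (?T p (e i)))"
      by (rule prod.reindex_bij_betw[OF e, symmetric])
    also have "\<dots> = (\<Prod>i = 0..<n. M (e i) (e (p i)))"
      by (rule prod.cong[OF refl]) (use e e' in \<open>auto simp: bij_betw_def\<close>)
    finally show "of_int (sign (?T p)) * (\<Prod>i\<in>S. M i (?T p i))
        = of_int (sign p) * (\<Prod>i = 0..<n. M (e i) (e (p i)))"
      by (simp add: sign_p')
  qed
  also have "\<dots> = Determinant.det (mat n n (\<lambda>(i, j). M (e i) (e j)))"
    by (subst det_def'[where n = n]) (auto intro!: sum.cong prod.cong simp: permutes_in_image)
  finally show ?thesis .
qed

lemma det_square_matrix: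
  assumes "finite S" shows "Determinant.det (square_matrix S M) = det_on S M"
proof -
  have "bij_betw (\<lambda>i. sorted_list_of_set S ! i) {0..<card S} S"
    using assms by (intro bij_betw_nth) auto
  from det_on_enumerate[OF this, of M] show ?thesis by (simp add: square_matrix_def)
qed

lemma obtain_enumeration:
  assumes "finite S" obtains e where "bij_betw e {0..<card S} S"
  using ex_bij_betw_nat_finite[OF assms] by blast

lemma det_on_transpose:
  assumes "finite S" shows "det_on S (\<lambda>i j. M j i) = det_on S M"
proof -
  obtain e where e: "bij_betw e {0..<card S} S" using obtain_enumeration[OF assms] .
  have "transpose_mat (mat (card S) (card S) (\<lambda>(i, j). M (e i) (e j))) = mat (card S) (card S) (\<lambda>(i, j). M (e j) (e i))"
    by auto
  thus ?thesis unfolding det_on_enumerate[OF e]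
    using det_transpose[of "mat (card S) (card S) (\<lambda>(i, j). M (e i) (e j))" "card S"] by simp
qed

lemma det_on_identical_rows:
  assumes "finite S" "i \<in> S" "j \<in> S" "i \<noteq> j" "\<And>t. t \<in> S \<Longrightarrow> M i t = M j t"
  shows "det_on S M = 0"
proof -
  obtain e where e: "bij_betw e {0..<card S} S" using obtain_enumeration[OF assms(1)] .
  have eS: "e ` {0..<card S} = S" using e by (simp add: bij_betw_def)
  have "i \<in> e ` {0..<card S}" "j \<in> e ` {0..<card S}" unfolding eS by (fact assms(2,3))+
  then obtain a b where ab: "a < card S" "b < card S" "e a = i" "e b = j"
    by (force simp: image_iff)
  have "e t \<in> S" if "t < card S" for t using e that by (auto simp: bij_betw_def)
  thus ?thesis unfolding det_on_enumerate[OF e]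
    using ab assms by (intro det_identical_rows[where i = a and j = b and n = "card S"]) auto
qed

lemma det_on_permute_rows:
  assumes "finite S" "\<sigma> permutes S"
  shows "det_on S (\<lambda>i. M (\<sigma> i)) = of_int (sign \<sigma>) * det_on S M"
proof -
  have "det_on S (\<lambda>i. M (\<sigma> i))
      = (\<Sum>p | p permutes S. of_int (sign (p \<circ> \<sigma>)) * (\<Prod>i\<in>S. M (\<sigma> i) ((p \<circ> \<sigma>) i)))"
    unfolding det_on_def by (rule sum_permutations_compose_right[OF assms(2)])
  also have "\<dots> = (\<Sum>p | p permutes S. of_int (sign \<sigma>) * (of_int (sign p) * (\<Prod>i\<in>S. M i (p i))))"
  proof (rule sum.cong[OF refl])
    fix p assume "p \<in> {p. p permutes S}"
    hence p: "p permutes S" by simp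
    have "sign (p \<circ> \<sigma>) = sign p * sign \<sigma>"
      using p assms by (intro sign_compose) (auto simp: permutation_permutes)
    moreover have "(\<Prod>i\<in>S. M i (p i)) = (\<Prod>i\<in>S. M (\<sigma> i) (p (\<sigma> i)))"
      using prod.permute[OF assms(2), of "\<lambda>i. M i (p i)"] by (simp add: o_def)
    ultimately show "of_int (sign (p \<circ> \<sigma>)) * (\<Prod>i\<in>S. M (\<sigma> i) ((p \<circ> \<sigma>) i))
        = of_int (sign \<sigma>) * (of_int (sign p) * (\<Prod>i\<in>S. M i (p i)))"
      by (simp add: mult_ac)
  qed
  finally show ?thesis by (simp add: det_on_def sum_distrib_left)
qed

lemma det_on_row_linear:
  assumes "finite S" "i \<in> S"
  shows "det_on S (M(i := (\<lambda>t. a t + c * b t))) = det_on S (M(i := a)) + c * det_on S (M(i := b))"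
proof -
  have split: "(\<Prod>s\<in>S. (M(i := r)) s (p s)) = r (p i) * (\<Prod>s\<in>S - {i}. M s (p s))" for r p
    using assms by (subst prod.remove[of S i]) (auto intro!: prod.cong)
  show ?thesis
    unfolding det_on_def split
    by (simp add: algebra_simps sum.distrib sum_distrib_left)
qed

lemma det_on_add_row:
  assumes "finite S" "i \<in> S" "j \<in> S" "i \<noteq> j"
  shows "det_on S (M(i := (\<lambda>t. M i t + c * M j t))) = det_on S M"
proof -
  have "det_on S (M(i := M j)) = 0"
    using assms by (intro det_on_identical_rows[of S i j]) auto
  thus ?thesis using det_on_row_linear[OF assms(1,2), of M "M i" c "M j"] by simp
qed

lemma det_on_expand_column:
  assumes "finite S" "k \<in> S" "\<And>i. i \<in> S \<Longrightarrow> i \<noteq> k \<Longrightarrow> M i k = 0"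
  shows "det_on S M = M k k * det_on (S - {k}) M"
proof -
  have "det_on S M = (\<Sum>p | p permutes (S - {k}). of_int (sign p) * (\<Prod>i\<in>S. M i (p i)))"
    unfolding det_on_def
  proof (rule sum.mono_neutral_right)
    show "finite {p. p permutes S}" using assms by (simp add: finite_permutations)
    show "{p. p permutes (S - {k})} \<subseteq> {p. p permutes S}" by (auto intro: permutes_subset)
    show "\<forall>p\<in>{p. p permutes S} - {p. p permutes (S - {k})}. of_int (sign p) * (\<Prod>i\<in>S. M i (p i)) = 0"
    proof
      fix p assume p: "p \<in> {p. p permutes S} - {p. p permutes (S - {k})}"
      hence "p k \<noteq> k" using permutes_superset[of p S "S - {k}"] by auto
      then obtain i where "i \<in> S" "p i = k" "i \<noteq> k"
        using p assms(2) permutes_image[of p S] by (metis DiffD1 imageE mem_Collect_eq)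
      hence "(\<Prod>i\<in>S. M i (p i)) = 0" using assms by (intro prod_zero) auto
      thus "of_int (sign p) * (\<Prod>i\<in>S. M i (p i)) = 0" by simp
    qed
  qed
  also have "\<dots> = (\<Sum>p | p permutes (S - {k}). M k k * (of_int (sign p) * (\<Prod>i\<in>S - {k}. M i (p i))))"
  proof (rule sum.cong[OF refl])
    fix p assume "p \<in> {p. p permutes (S - {k})}"
    hence "p k = k" by (auto intro: permutes_not_in)
    thus "of_int (sign p) * (\<Prod>i\<in>S. M i (p i)) = M k k * (of_int (sign p) * (\<Prod>i\<in>S - {k}. M i (p i)))"
      using assms by (subst prod.remove[of S k]) (auto simp: mult_ac)
  qed
  finally show ?thesis by (simp add: det_on_def sum_distrib_left)
qed

lemma det_on_eq_0_iff:
  fixes M :: "'i \<Rightarrow> 'i \<Rightarrow> 'k::idom"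
  assumes "finite S"
  shows "det_on S M = 0 \<longleftrightarrow> (\<exists>v. (\<exists>t\<in>S. v t \<noteq> 0) \<and> (\<forall>s\<in>S. (\<Sum>t\<in>S. M s t * v t) = 0))"
proof -
  let ?n = "card S"
  obtain e where e: "bij_betw e {0..<?n} S" using obtain_enumeration[OF assms] .
  let ?A = "mat ?n ?n (\<lambda>(i, j). M (e i) (e j))"
  have eS: "e ` {0..<?n} = S" using e by (simp add: bij_betw_def)
  have mv: "(?A *\<^sub>v vec ?n (v \<circ> e)) $ i = (\<Sum>t\<in>S. M (e i) t * v t)" if "i < ?n" for i v
  proof -
    have "(?A *\<^sub>v vec ?n (v \<circ> e)) $ i = (\<Sum>j = 0..<?n. M (e i) (e j) * v (e j))"
      using that by (simp add: scalar_prod_def)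
    also have "\<dots> = (\<Sum>t\<in>S. M (e i) t * v t)"
      by (rule sum.reindex_bij_betw[OF e, where g = "\<lambda>t. M (e i) t * v t"])
    finally show ?thesis .
  qed
  have "det_on S M = 0 \<longleftrightarrow> (\<exists>w. w \<in> carrier_vec ?n \<and> w \<noteq> 0\<^sub>v ?n \<and> ?A *\<^sub>v w = 0\<^sub>v ?n)"
    unfolding det_on_enumerate[OF e] by (rule det_0_iff_vec_prod_zero) simp
  also have "\<dots> \<longleftrightarrow> (\<exists>v. (\<exists>t\<in>S. v t \<noteq> 0) \<and> (\<forall>s\<in>S. (\<Sum>t\<in>S. M s t * v t) = 0))"
  proof
    assume "\<exists>w. w \<in> carrier_vec ?n \<and> w \<noteq> 0\<^sub>v ?n \<and> ?A *\<^sub>v w = 0\<^sub>v ?n"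
    then obtain w where w: "w \<in> carrier_vec ?n" "w \<noteq> 0\<^sub>v ?n" "?A *\<^sub>v w = 0\<^sub>v ?n" by blast
    define v where "v t = w $ (inv_into {0..<?n} e t)" for t
    have ve: "v (e i) = w $ i" if "i < ?n" for i
      using e that by (simp add: v_def bij_betw_def)
    have "vec ?n (v \<circ> e) = w" using w(1) ve by auto
    have "(\<Sum>t\<in>S. M s t * v t) = 0" if "s \<in> S" for s
    proof -
      from that have "s \<in> e ` {0..<?n}" unfolding eS .
      then obtain i where i: "i < ?n" "s = e i" by (meson atLeastLessThan_iff imageE)
      show ?thesis using mv[OF i(1), of v] w(3) i unfolding \<open>vec ?n (v \<circ> e) = w\<close> by simp
    qed
    moreover have "\<exists>t\<in>S. v t \<noteq> 0"
    proof (rule ccontr)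
      assume "\<not> (\<exists>t\<in>S. v t \<noteq> 0)"
      hence "w $ i = 0" if "i < ?n" for i
        using ve[OF that] that e by (metis atLeastLessThan_iff bij_betwE zero_le)
      hence "w = 0\<^sub>v ?n" using w(1) by auto
      thus False using w(2) by simp
    qed
    ultimately show "\<exists>v. (\<exists>t\<in>S. v t \<noteq> 0) \<and> (\<forall>s\<in>S. (\<Sum>t\<in>S. M s t * v t) = 0)" by blast
  next
    assume "\<exists>v. (\<exists>t\<in>S. v t \<noteq> 0) \<and> (\<forall>s\<in>S. (\<Sum>t\<in>S. M s t * v t) = 0)"
    then obtain v where v: "\<exists>t\<in>S. v t \<noteq> 0" "\<forall>s\<in>S. (\<Sum>t\<in>S. M s t * v t) = 0" by blast
    have "?A *\<^sub>v vec ?n (v \<circ> e) = 0\<^sub>v ?n"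
    proof (rule eq_vecI)
      fix i assume "i < dim_vec (0\<^sub>v ?n :: 'k vec)"
      hence i: "i < ?n" by simp
      hence "e i \<in> S" using eS by auto
      thus "(?A *\<^sub>v vec ?n (v \<circ> e)) $ i = 0\<^sub>v ?n $ i" using mv[OF i, of v] v(2) i by simp
    qed simp
    moreover have "vec ?n (v \<circ> e) \<noteq> 0\<^sub>v ?n"
    proof
      assume "vec ?n (v \<circ> e) = 0\<^sub>v ?n"
      hence "v (e i) = 0" if "i < ?n" for i using that by (metis comp_apply index_vec index_zero_vec(1))
      thus False using v(1) eS by (metis atLeastLessThan_iff imageE)
    qed
    ultimately show "\<exists>w. w \<in> carrier_vec ?n \<and> w \<noteq> 0\<^sub>v ?n \<and> ?A *\<^sub>v w = 0\<^sub>v ?n"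
      by (intro exI[of _ "vec ?n (v \<circ> e)"]) auto
  qed
  finally show ?thesis .
qed

text \<open>Expanding every diagonal entry splits the determinant according to the set \<open>U\<close> of rows in which the
  summand \<open>x\<close> is chosen; a permutation contributes to \<open>U\<close> only if it fixes \<open>U\<close> pointwise.\<close>

lemma det_on_add_diagonal:
  assumes "finite I"
  shows "det_on I (\<lambda>s t. (if s = t then x else 0) + M s t) = (\<Sum>U\<in>Pow I. x ^ card U * det_on (I - U) M)"
proof -
  let ?f = "\<lambda>p i. if i = p i then x else 0"
  have "det_on I (\<lambda>s t. (if s = t then x else 0) + M s t)
      = (\<Sum>p | p permutes I. \<Sum>U\<in>Pow I. of_int (sign p) * ((\<Prod>i\<in>U. ?f p i) * (\<Prod>i\<in>I - U. M i (p i))))"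
    using assms by (simp add: det_on_def prod_add sum_distrib_left)
  also have "\<dots> = (\<Sum>U\<in>Pow I. \<Sum>p | p permutes I. of_int (sign p) * ((\<Prod>i\<in>U. ?f p i) * (\<Prod>i\<in>I - U. M i (p i))))"
    by (rule sum.swap)
  also have "\<dots> = (\<Sum>U\<in>Pow I. x ^ card U * det_on (I - U) M)"
  proof (rule sum.cong[OF refl])
    fix U assume "U \<in> Pow I"
    hence U: "U \<subseteq> I" "finite U" using assms finite_subset by auto
    have "(\<Sum>p | p permutes I. of_int (sign p) * ((\<Prod>i\<in>U. ?f p i) * (\<Prod>i\<in>I - U. M i (p i))))
       = (\<Sum>p | p permutes (I - U). of_int (sign p) * ((\<Prod>i\<in>U. ?f p i) * (\<Prod>i\<in>I - U. M i (p i))))"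
    proof (rule sum.mono_neutral_right)
      show "finite {p. p permutes I}" using assms by (simp add: finite_permutations)
      show "{p. p permutes (I - U)} \<subseteq> {p. p permutes I}" by (auto intro: permutes_subset)
      show "\<forall>p\<in>{p. p permutes I} - {p. p permutes (I - U)}.
          of_int (sign p) * ((\<Prod>i\<in>U. ?f p i) * (\<Prod>i\<in>I - U. M i (p i))) = 0"
      proof
        fix p assume p: "p \<in> {p. p permutes I} - {p. p permutes (I - U)}"
        then obtain i where "i \<in> U" "p i \<noteq> i" using permutes_superset[of p I "I - U"] by auto
        hence "(\<Prod>i\<in>U. ?f p i) = 0" using U by (intro prod_zero) (auto intro!: bexI[of _ i])
        thus "of_int (sign p) * ((\<Prod>i\<in>U. ?f p i) * (\<Prod>i\<in>I - U. M i (p i))) = 0" by simp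
      qed
    qed
    also have "\<dots> = (\<Sum>p | p permutes (I - U). x ^ card U * (of_int (sign p) * (\<Prod>i\<in>I - U. M i (p i))))"
    proof (rule sum.cong[OF refl])
      fix p assume "p \<in> {p. p permutes (I - U)}"
      hence "p i = i" if "i \<in> U" for i using that by (auto intro: permutes_not_in)
      hence "(\<Prod>i\<in>U. ?f p i) = (\<Prod>i\<in>U. x)" by (intro prod.cong) auto
      thus "of_int (sign p) * ((\<Prod>i\<in>U. ?f p i) * (\<Prod>i\<in>I - U. M i (p i)))
          = x ^ card U * (of_int (sign p) * (\<Prod>i\<in>I - U. M i (p i)))" by (simp add: mult_ac)
    qed
    finally show "(\<Sum>p | p permutes I. of_int (sign p) * ((\<Prod>i\<in>U. ?f p i) * (\<Prod>i\<in>I - U. M i (p i))))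
        = x ^ card U * det_on (I - U) M" by (simp add: det_on_def sum_distrib_left)
  qed
  finally show ?thesis .
qed

text \<open>Expand the product in each row over functions \<open>h\<close> from \<open>S\<close> to \<open>J\<close>. If \<open>h\<close> is not injective, the
  remaining determinant in \<open>B\<close> has two equal rows. The injective ones with image \<open>F\<close> are
  \<open>\<gamma> F \<circ> \<sigma>\<close> for permutations \<open>\<sigma>\<close>, and summing over \<open>\<sigma>\<close> produces the minor of \<open>A\<close>.\<close>

lemma Cauchy_Binet:
  assumes S: "finite S" and J: "finite J"
    and \<gamma>: "\<And>F. F \<subseteq> J \<Longrightarrow> card F = card S \<Longrightarrow> bij_betw (\<gamma> F) S F"
  shows "det_on S (\<lambda>s t. \<Sum>f\<in>J. A s f * B t f) =
    (\<Sum>F | F \<subseteq> J \<and> card F = card S. det_on S (\<lambda>s t. A s (\<gamma> F t)) * det_on S (\<lambda>s t. B s (\<gamma> F t)))"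
proof -
  let ?P = "S \<rightarrow>\<^sub>E J"
  let ?g = "\<lambda>h. (\<Prod>s\<in>S. A s (h s)) * det_on S (\<lambda>s t. B t (h s))"
  let ?Fs = "{F. F \<subseteq> J \<and> card F = card S}"
  have "det_on S (\<lambda>s t. \<Sum>f\<in>J. A s f * B t f)
      = (\<Sum>p | p permutes S. \<Sum>h\<in>?P. of_int (sign p) * (\<Prod>s\<in>S. A s (h s) * B (p s) (h s)))"
    using S J by (simp add: det_on_def prod_sum_PiE sum_distrib_left)
  also have "\<dots> = (\<Sum>h\<in>?P. \<Sum>p | p permutes S. of_int (sign p) * (\<Prod>s\<in>S. A s (h s) * B (p s) (h s)))"
    by (rule sum.swap)
  also have "\<dots> = (\<Sum>h\<in>?P. ?g h)"
    by (simp add: det_on_def sum_distrib_left prod.distrib mult_ac)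
  also have "\<dots> = (\<Sum>h\<in>{h\<in>?P. inj_on h S}. ?g h)"
  proof (rule sum.mono_neutral_right)
    show "finite ?P" using S J by (simp add: finite_PiE)
    show "\<forall>h\<in>?P - {h \<in> ?P. inj_on h S}. ?g h = 0"
    proof
      fix h assume "h \<in> ?P - {h \<in> ?P. inj_on h S}"
      then obtain i j where "i \<in> S" "j \<in> S" "i \<noteq> j" "h i = h j" by (auto simp: inj_on_def)
      hence "det_on S (\<lambda>s t. B t (h s)) = 0" using S by (intro det_on_identical_rows[of S i j]) auto
      thus "?g h = 0" by simp
    qed
  qed auto
  also have "\<dots> = (\<Sum>F\<in>?Fs. \<Sum>h\<in>{h \<in> {h\<in>?P. inj_on h S}. h ` S = F}. ?g h)"
  proof (rule sum.group[symmetric])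
    have "finite ?P" using S J by (simp add: finite_PiE)
    thus "finite {h\<in>?P. inj_on h S}" by simp
    show "finite ?Fs" using J by simp
    show "(\<lambda>h. h ` S) ` {h\<in>?P. inj_on h S} \<subseteq> ?Fs" by (auto simp: card_image)
  qed
  also have "\<dots> = (\<Sum>F\<in>?Fs. det_on S (\<lambda>s t. A s (\<gamma> F t)) * det_on S (\<lambda>s t. B s (\<gamma> F t)))"
  proof (rule sum.cong[OF refl])
    fix F assume F: "F \<in> ?Fs"
    hence b: "bij_betw (\<gamma> F) S F" using \<gamma> by auto
    let ?c = "\<lambda>\<sigma>. restrict (\<gamma> F \<circ> \<sigma>) S"
    let ?d = "\<lambda>h s. if s \<in> S then inv_into S (\<gamma> F) (h s) else s"
    have "(\<Sum>h\<in>{h \<in> {h\<in>?P. inj_on h S}. h ` S = F}. ?g h) = (\<Sum>\<sigma> | \<sigma> permutes S. ?g (?c \<sigma>))"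
    proof (rule sum.reindex_bij_witness[where i = ?c and j = ?d])
      fix h assume "h \<in> {h \<in> {h\<in>?P. inj_on h S}. h ` S = F}"
      hence h: "h \<in> ?P" "inj_on h S" "h ` S = F" by auto
      have hb: "bij_betw h S F" using h by (simp add: bij_betw_def)
      show "?c (?d h) = h"
      proof
        fix s show "?c (?d h) s = h s"
        proof (cases "s \<in> S")
          case True
          hence "h s \<in> \<gamma> F ` S" using h b by (auto simp: bij_betw_def)
          thus ?thesis using True by (simp add: f_inv_into_f)
        qed (use h in \<open>auto simp: PiE_def extensional_def\<close>)
      qed
      thus "?g (?c (?d h)) = ?g h" by simp
      have "bij_betw (inv_into S (\<gamma> F) \<circ> h) S S"
        using hb bij_betw_inv_into[OF b] by (rule bij_betw_trans)
      hence "bij_betw (?d h) S S" by (rule bij_betw_cong[THEN iffD1, rotated]) auto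
      thus "?d h \<in> {\<sigma>. \<sigma> permutes S}" by (auto intro: bij_imp_permutes)
    next
      fix \<sigma> assume "\<sigma> \<in> {\<sigma>. \<sigma> permutes S}"
      hence \<sigma>: "\<sigma> permutes S" by simp
      have \<sigma>S: "\<sigma> s \<in> S \<longleftrightarrow> s \<in> S" for s using \<sigma> by (rule permutes_in_image)
      show "?d (?c \<sigma>) = \<sigma>"
        using b \<sigma> \<sigma>S by (auto simp: bij_betw_def fun_eq_iff permutes_not_in)
      have "bij_betw (\<gamma> F \<circ> \<sigma>) S F" using permutes_imp_bij[OF \<sigma>] b by (rule bij_betw_trans)
      hence "bij_betw (?c \<sigma>) S F" by (rule bij_betw_cong[THEN iffD1, rotated]) auto
      hence "inj_on (?c \<sigma>) S" "?c \<sigma> ` S = F" by (auto simp only: bij_betw_def)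
      moreover from this have "?c \<sigma> \<in> ?P" using F by fastforce
      ultimately show "?c \<sigma> \<in> {h \<in> {h\<in>?P. inj_on h S}. h ` S = F}" by blast
    qed
    also have "\<dots> = (\<Sum>\<sigma> | \<sigma> permutes S. of_int (sign \<sigma>) * (\<Prod>s\<in>S. A s (\<gamma> F (\<sigma> s))) * det_on S (\<lambda>s t. B s (\<gamma> F t)))"
    proof (rule sum.cong[OF refl])
      fix \<sigma> assume "\<sigma> \<in> {\<sigma>. \<sigma> permutes S}"
      hence \<sigma>: "\<sigma> permutes S" by simp
      have 1: "det_on S (\<lambda>s t. B t (?c \<sigma> s)) = det_on S (\<lambda>s t. B t (\<gamma> F (\<sigma> s)))"
        by (rule det_on_cong) auto
      have 2: "det_on S (\<lambda>s t. B t (\<gamma> F (\<sigma> s))) = of_int (sign \<sigma>) * det_on S (\<lambda>s t. B t (\<gamma> F s))"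
        using det_on_permute_rows[OF S \<sigma>, of "\<lambda>s t. B t (\<gamma> F s)"] .
      have 3: "det_on S (\<lambda>s t. B t (\<gamma> F s)) = det_on S (\<lambda>s t. B s (\<gamma> F t))"
        using det_on_transpose[OF S, of "\<lambda>s t. B s (\<gamma> F t)"] .
      have 4: "(\<Prod>s\<in>S. A s (?c \<sigma> s)) = (\<Prod>s\<in>S. A s (\<gamma> F (\<sigma> s)))"
        by (rule prod.cong) auto
      show "?g (?c \<sigma>) = of_int (sign \<sigma>) * (\<Prod>s\<in>S. A s (\<gamma> F (\<sigma> s))) * det_on S (\<lambda>s t. B s (\<gamma> F t))"
        unfolding 1 2 3 4 by (simp only: mult_ac)
    qed
    finally show "(\<Sum>h\<in>{h \<in> {h\<in>?P. inj_on h S}. h ` S = F}. ?g h)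
        = det_on S (\<lambda>s t. A s (\<gamma> F t)) * det_on S (\<lambda>s t. B s (\<gamma> F t))"
      by (simp add: det_on_def sum_distrib_right)
  qed
  finally show ?thesis .
qed

section \<open>Indices of sublattices\<close>

definition add_subgroup :: "'a::ab_group_add set \<Rightarrow> bool" where
  "add_subgroup A \<longleftrightarrow> 0 \<in> A \<and> (\<forall>x\<in>A. \<forall>y\<in>A. x - y \<in> A)"

text \<open>The index \<open>[A : B]\<close> as the number of translates \<open>a + B\<close>. An infinite index has value \<open>0\<close>, and
  therefore a nonzero value certifies finiteness.\<close>

definition sub_index :: "'a::ab_group_add set \<Rightarrow> 'a set \<Rightarrow> nat" where
  "sub_index A B = card ((\<lambda>a. (+) a ` B) ` A)"

lemma add_subgroupD:
  assumes "add_subgroup A"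
  shows "0 \<in> A" "x \<in> A \<Longrightarrow> y \<in> A \<Longrightarrow> x - y \<in> A" "x \<in> A \<Longrightarrow> - x \<in> A" "x \<in> A \<Longrightarrow> y \<in> A \<Longrightarrow> x + y \<in> A"
proof -
  show 0: "0 \<in> A" and d: "x \<in> A \<Longrightarrow> y \<in> A \<Longrightarrow> x - y \<in> A" for x y
    using assms by (auto simp: add_subgroup_def)
  show m: "x \<in> A \<Longrightarrow> - x \<in> A" for x using d[OF 0, of x] by simp
  show "x \<in> A \<Longrightarrow> y \<in> A \<Longrightarrow> x + y \<in> A" using d[of x "- y"] m by simp
qed

lemma translate_eq_iff:
  assumes "add_subgroup B"
  shows "(+) a ` B = (+) b ` B \<longleftrightarrow> a - b \<in> B"
proof
  assume "(+) a ` B = (+) b ` B"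
  hence "a + 0 \<in> (+) b ` B" using add_subgroupD(1)[OF assms] by blast
  thus "a - b \<in> B" by auto
next
  assume ab: "a - b \<in> B"
  have "(+) c ` B \<subseteq> (+) d ` B" if "c - d \<in> B" for c d
  proof
    fix x assume "x \<in> (+) c ` B"
    then obtain y where "y \<in> B" "x = c + y" by blast
    hence "x = d + ((c - d) + y)" "(c - d) + y \<in> B" using that add_subgroupD(4)[OF assms] by auto
    thus "x \<in> (+) d ` B" by blast
  qed
  moreover have "b - a \<in> B" using add_subgroupD(3)[OF assms ab] by simp
  ultimately show "(+) a ` B = (+) b ` B" using ab by blast
qed

text \<open>Two functions that identify the same pairs of points have images of the same size; this compares
  numbers of cosets without choosing a map between the sets of cosets.\<close>

lemma card_image_eq_card_image:
  assumes "\<And>a b. a \<in> A \<Longrightarrow> b \<in> A \<Longrightarrow> F a = F b \<longleftrightarrow> G a = G b"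
  shows "card (F ` A) = card (G ` A)"
proof -
  let ?h = "\<lambda>y. G (inv_into A F y)"
  have h: "?h (F a) = G a" if "a \<in> A" for a
  proof -
    have "inv_into A F (F a) \<in> A" "F (inv_into A F (F a)) = F a"
      using that by (auto intro: inv_into_into f_inv_into_f)
    thus ?thesis using assms[of "inv_into A F (F a)" a] that by simp
  qed
  have "bij_betw ?h (F ` A) (G ` A)"
    unfolding bij_betw_def
  proof
    show "inj_on ?h (F ` A)"
      by (rule inj_onI) (use h assms in auto)
    show "?h ` F ` A = G ` A" using h by (force simp: image_image)
  qed
  thus ?thesis by (rule bij_betw_same_card)
qed

text \<open>The conditions say that \<open>f\<close> induces a bijection of cosets. They cover images under
  homomorphisms and the isomorphism theorems alike.\<close>

lemma sub_index_eqI: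
  assumes "add_subgroup B" "add_subgroup B'" "\<And>a. a \<in> A \<Longrightarrow> f a \<in> A'"
    and "\<And>a'. a' \<in> A' \<Longrightarrow> \<exists>a\<in>A. f a - a' \<in> B'"
    and "\<And>a b. a \<in> A \<Longrightarrow> b \<in> A \<Longrightarrow> f a - f b \<in> B' \<longleftrightarrow> a - b \<in> B"
  shows "sub_index A B = sub_index A' B'"
proof -
  have "card ((\<lambda>a. (+) a ` B) ` A) = card ((\<lambda>a. (+) (f a) ` B') ` A)"
    by (rule card_image_eq_card_image) (use assms in \<open>auto simp: translate_eq_iff\<close>)
  moreover have "(\<lambda>a. (+) (f a) ` B') ` A = (\<lambda>a. (+) a ` B') ` A'"
  proof
    show "(\<lambda>a. (+) (f a) ` B') ` A \<subseteq> (\<lambda>a. (+) a ` B') ` A'" using assms(3) by auto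
    show "(\<lambda>a. (+) a ` B') ` A' \<subseteq> (\<lambda>a. (+) (f a) ` B') ` A"
    proof
      fix C assume "C \<in> (\<lambda>a. (+) a ` B') ` A'"
      then obtain a' where "a' \<in> A'" "C = (+) a' ` B'" by blast
      moreover from this obtain a where "a \<in> A" "f a - a' \<in> B'" using assms(4) by blast
      ultimately show "C \<in> (\<lambda>a. (+) (f a) ` B') ` A"
        using translate_eq_iff[OF assms(2), of "f a" a'] by blast
    qed
  qed
  ultimately show ?thesis by (simp add: sub_index_def)
qed

text \<open>With a representative \<open>r a\<close> chosen in each coset of \<open>B\<close>, the coset of \<open>a\<close> modulo \<open>C\<close> is determined
  by the coset of \<open>a\<close> modulo \<open>B\<close> and the coset of \<open>a - r a\<close> modulo \<open>C\<close>, and both can be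
  prescribed freely. The count stays valid for infinite indices.\<close>

lemma sub_index_tower:
  assumes "add_subgroup A" "add_subgroup B" "add_subgroup C" "C \<subseteq> B" "B \<subseteq> A"
  shows "sub_index A C = sub_index A B * sub_index B C"
proof -
  define r where "r a = (SOME b. b \<in> A \<and> a - b \<in> B)" for a
  have r: "r a \<in> A \<and> a - r a \<in> B" if "a \<in> A" for a
    unfolding r_def by (rule someI[of _ a]) (use that add_subgroupD(1)[OF assms(2)] in auto)
  have r_eq: "r a = r b" if "a - b \<in> B" for a b
  proof -
    have "a - c \<in> B \<longleftrightarrow> b - c \<in> B" for c
    proof -
      have e: "a - c = (a - b) + (b - c)" "b - c = (a - c) - (a - b)" by simp_all
      show ?thesis
      proof
        assume "a - c \<in> B" thus "b - c \<in> B" by (subst e(2)) (rule add_subgroupD(2)[OF assms(2) _ that])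
      next
        assume "b - c \<in> B" thus "a - c \<in> B" by (subst e(1)) (rule add_subgroupD(4)[OF assms(2) that])
      qed
    qed
    thus ?thesis by (simp add: r_def)
  qed
  let ?G = "\<lambda>a. ((+) a ` B, (+) (a - r a) ` C)"
  have "sub_index A C = card (?G ` A)"
    unfolding sub_index_def
  proof (rule card_image_eq_card_image)
    fix a b assume "a \<in> A" "b \<in> A"
    show "(+) a ` C = (+) b ` C \<longleftrightarrow> ?G a = ?G b"
      using r_eq[of a b] assms by (auto simp: translate_eq_iff)
  qed
  also have "?G ` A = ((\<lambda>a. (+) a ` B) ` A) \<times> ((\<lambda>a. (+) a ` C) ` B)"
  proof
    show "?G ` A \<subseteq> ((\<lambda>a. (+) a ` B) ` A) \<times> ((\<lambda>a. (+) a ` C) ` B)" using r by blast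
    show "((\<lambda>a. (+) a ` B) ` A) \<times> ((\<lambda>a. (+) a ` C) ` B) \<subseteq> ?G ` A"
    proof clarify
      fix a b assume ab: "a \<in> A" "b \<in> B"
      let ?x = "r a + b"
      have ra: "r a \<in> A" "a - r a \<in> B" using r ab by auto
      have "?x - a = b - (a - r a)" by simp
      hence xa: "?x - a \<in> B" using add_subgroupD(2)[OF assms(2) ab(2) ra(2)] by (simp only:)
      have "?x \<in> A" using ra ab assms add_subgroupD(4)[OF assms(1)] by blast
      moreover have "?G ?x = ((+) a ` B, (+) b ` C)"
        using xa r_eq[OF xa] assms(2) by (simp add: translate_eq_iff)
      ultimately show "((+) a ` B, (+) b ` C) \<in> ?G ` A" by (rule rev_image_eqI[OF _ sym])
    qed
  qed
  finally show ?thesis by (simp add: card_cartesian_product sub_index_def)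
qed

abbreviation (input) coord :: "('i \<Rightarrow>\<^sub>0 int) \<Rightarrow> 'i \<Rightarrow> int" where "coord \<equiv> Poly_Mapping.lookup"

text \<open>The coordinate sublattice \<open>\<int>\<^sup>S\<close>.\<close>

definition chains_on :: "'i set \<Rightarrow> ('i \<Rightarrow>\<^sub>0 int) set" where
  "chains_on S = {c. Poly_Mapping.keys c \<subseteq> S}"

definition lin_comb :: "'j set \<Rightarrow> ('j \<Rightarrow> 'i \<Rightarrow>\<^sub>0 int) \<Rightarrow> ('j \<Rightarrow> int) \<Rightarrow> 'i \<Rightarrow>\<^sub>0 int" where
  "lin_comb S b k = (\<Sum>t\<in>S. frag_cmul (k t) (b t))"

lemma chains_on_iff: "c \<in> chains_on S \<longleftrightarrow> (\<forall>i. i \<notin> S \<longrightarrow> coord c i = 0)"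
  by (auto simp: chains_on_def in_keys_iff)

lemma lookup_lin_comb: "coord (lin_comb S b k) i = (\<Sum>t\<in>S. k t * coord (b t) i)"
  by (simp add: lin_comb_def lookup_sum)

lemma add_subgroup_chains_on: "add_subgroup (chains_on S)"
  by (simp add: add_subgroup_def chains_on_iff lookup_minus)

lemma add_subgroup_lin_comb: "add_subgroup (range (lin_comb S b))"
proof -
  have "lin_comb S b k - lin_comb S b l = lin_comb S b (\<lambda>t. k t - l t)" for k l
    by (rule poly_mapping_eqI) (simp add: lookup_minus lookup_lin_comb sum_subtractf algebra_simps)
  moreover have "0 = lin_comb S b (\<lambda>t. 0)"
    by (rule poly_mapping_eqI) (simp add: lookup_lin_comb)
  ultimately show ?thesis unfolding add_subgroup_def by (auto intro: range_eqI)
qed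

lemma lin_comb_row_operation:
  assumes "finite S" "i \<in> S" "j \<in> S" "i \<noteq> j"
  shows "range (lin_comb S (b(i := b i + frag_cmul c (b j)))) = range (lin_comb S b)"
proof -
  have eq: "lin_comb S (b(i := b i + frag_cmul c (b j))) k = lin_comb S b (k(j := k j + c * k i))" for b k c
  proof (rule poly_mapping_eqI)
    fix x
    have "(\<Sum>t\<in>S. k t * coord ((b(i := b i + frag_cmul c (b j))) t) x)
        = (\<Sum>t\<in>S. k t * coord (b t) x + (if t = i then c * k i * coord (b j) x else 0))"
      by (rule sum.cong) (auto simp: lookup_add algebra_simps)
    also have "\<dots> = (\<Sum>t\<in>S. k t * coord (b t) x) + c * k i * coord (b j) x"
      using assms by (simp add: sum.distrib sum.delta)
    also have "\<dots> = (\<Sum>t\<in>S. k t * coord (b t) x + (if t = j then c * k i * coord (b j) x else 0))"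
      using assms by (simp add: sum.distrib sum.delta)
    also have "\<dots> = (\<Sum>t\<in>S. (k(j := k j + c * k i)) t * coord (b t) x)"
      by (rule sum.cong) (auto simp: algebra_simps)
    finally show "coord (lin_comb S (b(i := b i + frag_cmul c (b j))) k) x = coord (lin_comb S b (k(j := k j + c * k i))) x"
      by (simp only: lookup_lin_comb)
  qed
  show ?thesis
  proof
    show "range (lin_comb S (b(i := b i + frag_cmul c (b j)))) \<subseteq> range (lin_comb S b)"
      using eq by auto
    have "lin_comb S b k = lin_comb S (b(i := b i + frag_cmul c (b j))) (k(j := k j - c * k i))" for k
      using assms by (simp add: eq)
    thus "range (lin_comb S b) \<subseteq> range (lin_comb S (b(i := b i + frag_cmul c (b j))))" by auto
  qed
qed

lemma det_row_operation:
  assumes "finite S" "i \<in> S" "j \<in> S" "i \<noteq> j"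
  shows "det_on S (\<lambda>t s. coord ((b(i := b i + frag_cmul c (b j))) t) s) = det_on S (\<lambda>t s. coord (b t) s)"
proof -
  have "det_on S (\<lambda>t s. coord ((b(i := b i + frag_cmul c (b j))) t) s)
      = det_on S ((\<lambda>t s. coord (b t) s)(i := (\<lambda>s. coord (b i) s + c * coord (b j) s)))"
    by (rule det_on_cong) (auto simp: lookup_add)
  thus ?thesis using det_on_add_row[OF assms, of "\<lambda>t s. coord (b t) s" c] by simp
qed

lemma sub_index_multiples:
  assumes "s \<in> S" "x \<noteq> 0"
  shows "sub_index (chains_on S) {c \<in> chains_on S. x dvd coord c s} = nat \<bar>x\<bar>"
proof -
  let ?B = "{c \<in> chains_on S. x dvd coord c s}"
  have B: "add_subgroup ?B"
    using add_subgroup_chains_on[of S] by (auto simp: add_subgroup_def lookup_minus)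
  have "sub_index (chains_on S) ?B = card ((\<lambda>c. coord c s mod \<bar>x\<bar>) ` chains_on S)"
    unfolding sub_index_def
  proof (rule card_image_eq_card_image)
    fix a b assume "a \<in> chains_on S" "b \<in> chains_on S"
    thus "(+) a ` ?B = (+) b ` ?B \<longleftrightarrow> coord a s mod \<bar>x\<bar> = coord b s mod \<bar>x\<bar>"
      unfolding translate_eq_iff[OF B]
      by (simp add: lookup_minus add_subgroupD(2)[OF add_subgroup_chains_on] mod_eq_dvd_iff)
  qed
  also have "(\<lambda>c. coord c s mod \<bar>x\<bar>) ` chains_on S = {0..<\<bar>x\<bar>}"
  proof
    show "(\<lambda>c. coord c s mod \<bar>x\<bar>) ` chains_on S \<subseteq> {0..<\<bar>x\<bar>}" using assms by auto
    show "{0..<\<bar>x\<bar>} \<subseteq> (\<lambda>c. coord c s mod \<bar>x\<bar>) ` chains_on S"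
    proof
      fix y assume "y \<in> {0..<\<bar>x\<bar>}"
      hence "y = coord (frag_cmul y (frag_of s)) s mod \<bar>x\<bar>" by simp
      moreover have "frag_cmul y (frag_of s) \<in> chains_on S" using assms by (auto simp: chains_on_iff)
      ultimately show "y \<in> (\<lambda>c. coord c s mod \<bar>x\<bar>) ` chains_on S" by blast
    qed
  qed
  finally show ?thesis by simp
qed

text \<open>Expansion of the index along a coordinate \<open>k\<close> in which only \<open>b k\<close> is nonzero. The intermediate
  lattice consists of the vectors whose coordinate at \<open>k\<close> is divisible by that of \<open>b k\<close>.\<close>

lemma sub_index_lin_comb_insert:
  assumes S: "finite S" "k \<notin> S" and b: "\<And>t. t \<in> S \<Longrightarrow> b t \<in> chains_on S" "b k \<in> chains_on (insert k S)"
    and x: "coord (b k) k \<noteq> 0"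
  shows "sub_index (chains_on (insert k S)) (range (lin_comb (insert k S) b))
       = nat \<bar>coord (b k) k\<bar> * sub_index (chains_on S) (range (lin_comb S b))"
proof -
  let ?x = "coord (b k) k" and ?L = "range (lin_comb (insert k S) b)"
  let ?M = "{c \<in> chains_on (insert k S). ?x dvd coord c k}"
  have insert: "lin_comb (insert k S) b l = frag_cmul (l k) (b k) + lin_comb S b l" for l
    using S by (simp add: lin_comb_def)
  have bS: "lin_comb S b l \<in> chains_on S" for l
    using b(1) by (auto simp: chains_on_iff lookup_lin_comb)
  hence 0: "coord (lin_comb S b l) k = 0" for l using S by (auto simp: chains_on_iff)
  have M: "add_subgroup ?M"
    using add_subgroup_chains_on[of "insert k S"] by (auto simp: add_subgroup_def lookup_minus)
  have "sub_index (chains_on (insert k S)) ?L = sub_index (chains_on (insert k S)) ?M * sub_index ?M ?L"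
  proof (rule sub_index_tower[OF add_subgroup_chains_on M add_subgroup_lin_comb])
    show "?L \<subseteq> ?M"
      using b bS 0 by (auto simp: insert lookup_add chains_on_iff)
  qed auto
  also have "sub_index (chains_on (insert k S)) ?M = nat \<bar>?x\<bar>"
    using x by (intro sub_index_multiples) auto
  also have "sub_index ?M ?L = sub_index (chains_on S) (range (lin_comb S b))"
  proof (rule sub_index_eqI[where f = id, symmetric])
    fix c assume "c \<in> chains_on S"
    thus "id c \<in> ?M" using S by (auto simp: chains_on_iff)
  next
    fix c assume c: "c \<in> ?M"
    then obtain q where q: "coord c k = ?x * q" by auto
    let ?a = "c - frag_cmul q (b k)"
    have "?a \<in> chains_on S" unfolding chains_on_iff
    proof (intro allI impI)
      fix i assume "i \<notin> S"
      thus "coord ?a i = 0" using c b(2) q by (cases "i = k") (auto simp: chains_on_iff lookup_minus)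
    qed
    moreover have "id ?a - c = lin_comb (insert k S) b (\<lambda>t. if t = k then - q else 0)"
      using S unfolding insert
      by (intro poly_mapping_eqI) (auto simp: lookup_minus lookup_add lookup_lin_comb intro!: sum.neutral)
    ultimately show "\<exists>a\<in>chains_on S. id a - c \<in> ?L" by blast
  next
    fix c d assume "c \<in> chains_on S" "d \<in> chains_on S"
    hence cd: "c - d \<in> chains_on S" by (rule add_subgroupD(2)[OF add_subgroup_chains_on])
    show "id c - id d \<in> ?L \<longleftrightarrow> c - d \<in> range (lin_comb S b)"
    proof
      assume "id c - id d \<in> ?L"
      then obtain l where l: "c - d = frag_cmul (l k) (b k) + lin_comb S b l" by (auto simp: insert)
      have "coord (c - d) k = 0" using cd S by (auto simp: chains_on_iff)
      hence "l k = 0" using x 0 unfolding l by (simp add: lookup_add)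
      thus "c - d \<in> range (lin_comb S b)" using l by simp
    next
      assume "c - d \<in> range (lin_comb S b)"
      then obtain l where l: "c - d = lin_comb S b l" by blast
      have "lin_comb S b l = lin_comb S b (l(k := 0))"
        unfolding lin_comb_def using S by (intro sum.cong) auto
      hence "c - d = lin_comb (insert k S) b (l(k := 0))" by (simp add: l insert)
      thus "id c - id d \<in> ?L" by simp
    qed
  qed (rule add_subgroup_lin_comb)+
  finally show ?thesis .
qed

text \<open>Row operations change neither the lattice nor the determinant. Euclid's algorithm on the coordinate
  \<open>k\<close> leaves a single vector with a nonzero coordinate there, and then index and determinant expand
  in the same way. The inner induction is on the sum of the absolute values of these coordinates.\<close>

theorem sub_index_eq_det:
  assumes "finite S" "\<And>t. t \<in> S \<Longrightarrow> b t \<in> chains_on S" "det_on S (\<lambda>t s. coord (b t) s) \<noteq> 0"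
  shows "int (sub_index (chains_on S) (range (lin_comb S b))) = \<bar>det_on S (\<lambda>t s. coord (b t) s)\<bar>"
  using assms
proof (induction S arbitrary: b rule: finite_induct)
  case empty
  have c0: "c = 0" if "c \<in> chains_on {}" for c :: "'a \<Rightarrow>\<^sub>0 int"
    using that by (auto simp: chains_on_def)
  have "chains_on {} = {0 :: 'a \<Rightarrow>\<^sub>0 int}" using c0 by (auto simp: chains_on_def)
  thus ?case by (simp add: sub_index_def det_on_def)
next
  case (insert k S)
  let ?S = "insert k S"
  let ?m = "\<lambda>b. \<Sum>t\<in>?S. nat \<bar>coord (b t) k\<bar>"
  show ?case using insert.prems
  proof (induction "?m b" arbitrary: b rule: less_induct)
    case less
    have finS: "finite ?S" using insert.hyps by simp
    have cl: "b t + frag_cmul c (b u) \<in> chains_on ?S"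
      if "b t \<in> chains_on ?S" "b u \<in> chains_on ?S" for b :: "'a \<Rightarrow> 'a \<Rightarrow>\<^sub>0 int" and t u c
      using that by (auto simp: chains_on_iff lookup_add)
    have op: "range (lin_comb ?S (b(t := b t + frag_cmul c (b u)))) = range (lin_comb ?S b)"
      "det_on ?S (\<lambda>s. coord ((b(t := b t + frag_cmul c (b u))) s)) = det_on ?S (\<lambda>s. coord (b s))"
      if "t \<in> ?S" "u \<in> ?S" "t \<noteq> u" for b :: "'a \<Rightarrow> 'a \<Rightarrow>\<^sub>0 int" and t u c
      by (rule lin_comb_row_operation[OF finS that]) (rule det_row_operation[OF finS that])
    show ?case
    proof (cases "\<exists>t\<in>?S. \<exists>u\<in>?S. t \<noteq> u \<and> coord (b t) k \<noteq> 0 \<and> coord (b u) k \<noteq> 0")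
      case True
      then obtain t u where tu: "t \<in> ?S" "u \<in> ?S" "t \<noteq> u" "coord (b u) k \<noteq> 0" "\<bar>coord (b u) k\<bar> \<le> \<bar>coord (b t) k\<bar>"
      proof -
        from True obtain t u where tu: "t \<in> ?S" "u \<in> ?S" "t \<noteq> u" "coord (b t) k \<noteq> 0" "coord (b u) k \<noteq> 0"
          by blast
        show thesis
        proof (cases "\<bar>coord (b u) k\<bar> \<le> \<bar>coord (b t) k\<bar>")
          case True
          thus ?thesis using that[of t u] tu by blast
        next
          case False
          hence "\<bar>coord (b t) k\<bar> \<le> \<bar>coord (b u) k\<bar>" by linarith
          thus ?thesis using that[of u t] tu by blast
        qed
      qed
      \<comment> \<open>the sign that makes the larger of the two coordinates smaller\<close>
      define c where "c = - (sgn (coord (b t) k) * sgn (coord (b u) k))"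
      let ?b = "b(t := b t + frag_cmul c (b u))"
      have "\<bar>coord (b t) k + c * coord (b u) k\<bar> < \<bar>coord (b t) k\<bar>"
        using tu by (auto simp: c_def sgn_if)
      hence "nat \<bar>coord (?b t) k\<bar> < nat \<bar>coord (b t) k\<bar>" by (simp add: lookup_add)
      moreover have "(\<Sum>s\<in>?S - {t}. nat \<bar>coord (?b s) k\<bar>) = (\<Sum>s\<in>?S - {t}. nat \<bar>coord (b s) k\<bar>)"
        by (rule sum.cong) auto
      ultimately have "?m ?b < ?m b"
        using sum.remove[OF finS tu(1), of "\<lambda>s. nat \<bar>coord (?b s) k\<bar>"]
          sum.remove[OF finS tu(1), of "\<lambda>s. nat \<bar>coord (b s) k\<bar>"] by linarith
      hence "int (sub_index (chains_on ?S) (range (lin_comb ?S ?b))) = \<bar>det_on ?S (\<lambda>s. coord (?b s))\<bar>"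
      proof (rule less.hyps)
        fix s assume "s \<in> ?S"
        thus "?b s \<in> chains_on ?S" using less.prems(1) cl[of b t u c] tu by (cases "s = t") simp_all
      next
        show "det_on ?S (\<lambda>s. coord (?b s)) \<noteq> 0"
          unfolding op(2)[OF tu(1-3), of b c] by (rule less.prems(2))
      qed
      thus ?thesis unfolding op[OF tu(1-3), of b c] .
    next
      case one: False
      \<comment> \<open>only one vector \<open>b t\<close> has a nonzero coordinate at \<open>k\<close>\<close>
      have direct: "int (sub_index (chains_on ?S) (range (lin_comb ?S b))) = \<bar>det_on ?S (\<lambda>t s. coord (b t) s)\<bar>"
        if b: "\<And>t. t \<in> ?S \<Longrightarrow> b t \<in> chains_on ?S" and z: "\<And>t. t \<in> S \<Longrightarrow> coord (b t) k = 0"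
          and nz: "det_on ?S (\<lambda>t s. coord (b t) s) \<noteq> 0" for b
      proof -
        have d: "det_on ?S (\<lambda>t s. coord (b t) s) = coord (b k) k * det_on S (\<lambda>t s. coord (b t) s)"
          using det_on_expand_column[OF finS, of k "\<lambda>t s. coord (b t) s"] z insert.hyps by auto
        have bS: "b t \<in> chains_on S" if "t \<in> S" for t
          using b[of t] z[OF that] that by (auto simp: chains_on_iff)
        have "int (sub_index (chains_on S) (range (lin_comb S b))) = \<bar>det_on S (\<lambda>t s. coord (b t) s)\<bar>"
          using nz d by (intro insert.IH bS) auto
        moreover have "sub_index (chains_on ?S) (range (lin_comb ?S b))
             = nat \<bar>coord (b k) k\<bar> * sub_index (chains_on S) (range (lin_comb S b))"
          using nz d b insert.hyps by (intro sub_index_lin_comb_insert bS) auto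
        ultimately show ?thesis by (simp add: d abs_mult)
      qed
      show ?thesis
      proof (cases "\<exists>t\<in>S. coord (b t) k \<noteq> 0")
        case False
        thus ?thesis using less.prems by (intro direct) auto
      next
        case True
        then obtain t where t: "t \<in> S" "coord (b t) k \<noteq> 0" by blast
        hence tk: "t \<noteq> k" using insert.hyps by auto
        have z: "coord (b u) k = 0" if "u \<in> ?S" "u \<noteq> t" for u using one t that by auto
        \<comment> \<open>two row operations move the nonzero coordinate from \<open>b t\<close> to \<open>b k\<close>\<close>
        define b1 where "b1 = b(k := b k + frag_cmul 1 (b t))"
        define b2 where "b2 = b1(t := b1 t + frag_cmul (-1) (b1 k))"
        have r1: "range (lin_comb ?S b1) = range (lin_comb ?S b)"
           "det_on ?S (\<lambda>s. coord (b1 s)) = det_on ?S (\<lambda>s. coord (b s))"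
          unfolding b1_def using op[of k t b 1] t tk by blast+
        have r2: "range (lin_comb ?S b2) = range (lin_comb ?S b1)"
           "det_on ?S (\<lambda>s. coord (b2 s)) = det_on ?S (\<lambda>s. coord (b1 s))"
          unfolding b2_def using op[of t k b1 "-1"] t tk by blast+
        have c1: "b1 s \<in> chains_on ?S" if "s \<in> ?S" for s
          using that less.prems(1) cl[of b k t 1] t unfolding b1_def by (cases "s = k") simp_all
        have c2: "b2 s \<in> chains_on ?S" if "s \<in> ?S" for s
          using that c1 cl[of b1 t k "-1"] t unfolding b2_def by (cases "s = t") simp_all
        have z2: "coord (b2 s) k = 0" if "s \<in> S" for s
        proof (cases "s = t")
          case True
          thus ?thesis using tk z[of k] by (simp add: b2_def b1_def lookup_add)
        next
          case False
          thus ?thesis using that z[of s] insert.hyps by (auto simp: b2_def b1_def)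
        qed
        have "det_on ?S (\<lambda>s. coord (b2 s)) \<noteq> 0" unfolding r2 r1 by (rule less.prems(2))
        from direct[OF c2 z2 this] show ?thesis unfolding r2 r1 .
      qed
    qed
  qed
qed

section \<open>Cycles, boundaries and bases\<close>

text \<open>Padding the matrix of coordinates with zero rows makes it square and singular.\<close>

lemma vectors_dependent:
  assumes "finite S" "finite T" "card S < card T" "\<And>t. t \<in> T \<Longrightarrow> v t \<in> chains_on S"
  shows "\<exists>k. (\<exists>t\<in>T. k t \<noteq> 0) \<and> lin_comb T v k = 0"
proof -
  obtain \<sigma> where \<sigma>: "inj_on \<sigma> S" "\<sigma> ` S \<subseteq> T"
    using assms card_le_inj[OF assms(1,2)] by auto
  have "card (\<sigma> ` S) < card T" using \<sigma> assms by (simp add: card_image)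
  hence "\<sigma> ` S \<noteq> T" by auto
  then obtain i where i: "i \<in> T" "i \<notin> \<sigma> ` S" using \<sigma> by auto
  let ?A = "\<lambda>i t. if i \<in> \<sigma> ` S then coord (v t) (inv_into S \<sigma> i) else 0"
  have "det_on T ?A = 0"
    unfolding det_on_def
    by (rule sum.neutral) (use i assms(2) in \<open>auto intro!: prod_zero\<close>)
  then obtain k where k: "\<exists>t\<in>T. k t \<noteq> 0" "\<And>s. s \<in> T \<Longrightarrow> (\<Sum>t\<in>T. ?A s t * k t) = 0"
    using det_on_eq_0_iff[OF assms(2), of ?A] by auto
  have "lin_comb T v k = 0"
  proof (rule poly_mapping_eqI)
    fix s
    show "coord (lin_comb T v k) s = coord 0 s"
    proof (cases "s \<in> S")
      case True
      hence "(\<Sum>t\<in>T. coord (v t) s * k t) = 0"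
        using k(2)[of "\<sigma> s"] \<sigma> by auto
      thus ?thesis by (simp add: lookup_lin_comb mult.commute)
    next
      case False
      hence "coord (v t) s = 0" if "t \<in> T" for t
        using assms(4)[OF that] by (auto simp: chains_on_iff)
      thus ?thesis by (simp add: lookup_lin_comb)
    qed
  qed
  thus ?thesis using k(1) by blast
qed

definition restrict_chain :: "'i set \<Rightarrow> ('i \<Rightarrow>\<^sub>0 int) \<Rightarrow> ('i \<Rightarrow>\<^sub>0 int)" where
  "restrict_chain S c = frag_extend (\<lambda>i. if i \<in> S then frag_of i else 0) c"

lemma lookup_restrict_chain:
  "coord (restrict_chain S c) i = (if i \<in> S then coord c i else 0)"
proof -
  have "coord (restrict_chain S c) i
      = (\<Sum>x\<in>Poly_Mapping.keys c. if x = i then (if i \<in> S then coord c i else 0) else 0)"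
    unfolding restrict_chain_def frag_extend_def lookup_sum by (rule sum.cong) auto
  thus ?thesis by (auto simp: sum.delta in_keys_iff)
qed

lemma restrict_chain_in: "restrict_chain S c \<in> chains_on S"
  by (simp add: chains_on_iff lookup_restrict_chain)

lemma restrict_chain_id: "c \<in> chains_on S \<Longrightarrow> restrict_chain S c = c"
  by (rule poly_mapping_eqI) (auto simp: chains_on_iff lookup_restrict_chain)

lemma restrict_chain_diff: "restrict_chain S (c - d) = restrict_chain S c - restrict_chain S d"
  by (rule poly_mapping_eqI) (simp add: lookup_restrict_chain lookup_minus)

lemma restrict_chain_0: "restrict_chain S 0 = 0"
  by (rule poly_mapping_eqI) (simp add: lookup_restrict_chain)

lemma chains_on_mono: "S \<subseteq> T \<Longrightarrow> chains_on S \<subseteq> chains_on T"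
  by (auto simp: chains_on_def)

lemma minus_restrict_chain: "c \<in> chains_on C \<Longrightarrow> c - restrict_chain S c \<in> chains_on (C - S)"
  by (auto simp: chains_on_iff lookup_minus lookup_restrict_chain)

lemma chain_as_lin_comb:
  assumes "finite F" "c \<in> chains_on F" shows "c = lin_comb F frag_of (coord c)"
proof (rule poly_mapping_eqI)
  fix i
  have "(\<Sum>t\<in>F. coord c t * coord (frag_of t) i)
      = (\<Sum>t\<in>F. if t = i then coord c i else 0)"
    by (rule sum.cong) auto
  thus "coord c i = coord (lin_comb F frag_of (coord c)) i"
    using assms by (simp add: lookup_lin_comb sum.delta chains_on_iff)
qed

lemma chains_on_closed:
  "0 \<in> chains_on S" "c \<in> chains_on S \<Longrightarrow> d \<in> chains_on S \<Longrightarrow> c - d \<in> chains_on S"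
  "c \<in> chains_on S \<Longrightarrow> d \<in> chains_on S \<Longrightarrow> c + d \<in> chains_on S"
  "c \<in> chains_on S \<Longrightarrow> frag_cmul n c \<in> chains_on S"
  "i \<in> S \<Longrightarrow> frag_of i \<in> chains_on S"
  "(\<And>t. t \<in> T \<Longrightarrow> b t \<in> chains_on S) \<Longrightarrow> lin_comb T b k \<in> chains_on S"
  by (auto simp: chains_on_iff lookup_minus lookup_add lookup_lin_comb)

text \<open>Linear independence over the integers in the quotient by \<open>B\<close>, expressed by representatives.\<close>

definition independent_mod :: "('i \<Rightarrow>\<^sub>0 int) set \<Rightarrow> ('i \<Rightarrow>\<^sub>0 int) set \<Rightarrow> bool" where
  "independent_mod B T \<longleftrightarrow> finite T \<and> (\<forall>k. lin_comb T (\<lambda>x. x) k \<in> B \<longrightarrow> (\<forall>t\<in>T. k t = 0))"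

lemma card_independent_chains:
  assumes "finite C" "T \<subseteq> chains_on C" "independent_mod B T" "0 \<in> B"
  shows "card T \<le> card C"
proof (rule ccontr)
  assume "\<not> card T \<le> card C"
  hence "\<exists>k. (\<exists>t\<in>T. k t \<noteq> 0) \<and> lin_comb T (\<lambda>x. x) k = 0"
    using assms by (intro vectors_dependent[of C]) (auto simp: independent_mod_def)
  thus False using assms by (auto simp: independent_mod_def)
qed

text \<open>An endomorphism of the lattice of all chains. Taking chains of all dimensions together replaces a
  family of maps by one map, restricted to coordinate sublattices.\<close>

locale boundary_map =
  fixes \<delta> :: "('i \<Rightarrow>\<^sub>0 int) \<Rightarrow> ('i \<Rightarrow>\<^sub>0 int)"
  assumes diff: "\<delta> (c - d) = \<delta> c - \<delta> d" and cmul: "\<delta> (frag_cmul n c) = frag_cmul n (\<delta> c)"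
begin

lemma zero: "\<delta> 0 = 0"
  using diff[of 0 0] by simp

lemma add: "\<delta> (c + d) = \<delta> c + \<delta> d"
proof -
  have "\<delta> (c - (0 - d)) = \<delta> c - (\<delta> 0 - \<delta> d)" by (simp only: diff)
  thus ?thesis by (simp add: zero)
qed

lemma lin_comb: "finite S \<Longrightarrow> \<delta> (lin_comb S b k) = lin_comb S (\<lambda>t. \<delta> (b t)) k"
  unfolding lin_comb_def by (induction S rule: finite_induct) (simp_all add: zero add cmul)

definition cycles_on :: "'i set \<Rightarrow> ('i \<Rightarrow>\<^sub>0 int) set" where
  "cycles_on F = {z \<in> chains_on F. \<delta> z = 0}"

definition boundaries_on :: "'i set \<Rightarrow> ('i \<Rightarrow>\<^sub>0 int) set" where
  "boundaries_on F = \<delta> ` chains_on F"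

definition acyclic_on :: "'i set \<Rightarrow> bool" where
  "acyclic_on F \<longleftrightarrow> cycles_on F = {0}"

text \<open>The bases of the matroid on \<open>C\<close> represented by the columns of \<open>\<delta>\<close>.\<close>

definition basis_of :: "'i set \<Rightarrow> 'i set \<Rightarrow> bool" where
  "basis_of C F \<longleftrightarrow> F \<subseteq> C \<and> acyclic_on F \<and> (\<forall>c\<in>C - F. \<not> acyclic_on (insert c F))"

lemma zero_in_cycles: "0 \<in> cycles_on F"
  by (simp add: cycles_on_def zero chains_on_closed)

lemma acyclic_onD: "acyclic_on F \<Longrightarrow> z \<in> chains_on F \<Longrightarrow> \<delta> z = 0 \<Longrightarrow> z = 0"
  unfolding acyclic_on_def cycles_on_def by blast

lemma acyclic_onI: "(\<And>z. z \<in> chains_on F \<Longrightarrow> \<delta> z = 0 \<Longrightarrow> z = 0) \<Longrightarrow> acyclic_on F"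
  using zero_in_cycles[of F] unfolding acyclic_on_def cycles_on_def by blast

lemma acyclic_on_empty: "acyclic_on {}"
  by (rule acyclic_onI) (auto simp: chains_on_def)

lemma add_subgroup_cycles: "add_subgroup (cycles_on F)"
  by (auto simp: add_subgroup_def cycles_on_def zero diff chains_on_closed)

lemma add_subgroup_boundaries: "add_subgroup (boundaries_on F)"
  unfolding add_subgroup_def boundaries_on_def
proof (intro conjI ballI)
  show "0 \<in> \<delta> ` chains_on F" by (rule image_eqI[of _ _ 0]) (simp_all add: zero chains_on_closed)
  fix x y assume "x \<in> \<delta> ` chains_on F" "y \<in> \<delta> ` chains_on F"
  then obtain c d where "c \<in> chains_on F" "d \<in> chains_on F" "x - y = \<delta> (c - d)" by (auto simp: diff)
  thus "x - y \<in> \<delta> ` chains_on F" using chains_on_closed(2) by blast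
qed

lemma cmul_boundary: "x \<in> boundaries_on F \<Longrightarrow> frag_cmul n x \<in> boundaries_on F"
proof -
  assume "x \<in> boundaries_on F"
  then obtain c where c: "c \<in> chains_on F" "x = \<delta> c" unfolding boundaries_on_def by blast
  hence "frag_cmul n x = \<delta> (frag_cmul n c)" by (simp only: cmul)
  thus ?thesis unfolding boundaries_on_def using chains_on_closed(4)[OF c(1)] by blast
qed

lemma basis_exists:
  assumes "finite C" "F \<subseteq> C" "acyclic_on F"
  obtains G where "basis_of C G" "F \<subseteq> G"
proof -
  define A where "A = {G. F \<subseteq> G \<and> G \<subseteq> C \<and> acyclic_on G}"
  have "A \<subseteq> Pow C" by (auto simp: A_def)
  hence "finite A" using assms(1) by (meson finite_Pow_iff finite_subset)
  moreover have "F \<in> A" using assms by (auto simp: A_def)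
  ultimately obtain G where G: "G \<in> A" "\<And>H. H \<in> A \<Longrightarrow> G \<subseteq> H \<Longrightarrow> G = H"
    using finite_has_maximal2[of A F] by auto
  have "\<not> acyclic_on (insert c G)" if "c \<in> C - G" for c
  proof
    assume "acyclic_on (insert c G)"
    hence "insert c G \<in> A" using G(1) that by (auto simp: A_def)
    hence "G = insert c G" by (rule G(2)) auto
    thus False using that by blast
  qed
  hence "basis_of C G" using G(1) by (auto simp: basis_of_def A_def)
  moreover have "F \<subseteq> G" using G(1) by (simp add: A_def)
  ultimately show thesis by (rule that)
qed

text \<open>The fundamental circuit of \<open>s\<close> with respect to \<open>U\<close>.\<close>

lemma basis_circuit:
  assumes "basis_of C U" "s \<in> C - U"
  obtains z where "z \<in> cycles_on C" "z \<in> chains_on (insert s U)" "coord z s \<noteq> 0"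
proof -
  have "\<not> acyclic_on (insert s U)" using assms by (simp add: basis_of_def)
  then obtain z where z: "z \<in> chains_on (insert s U)" "\<delta> z = 0" "z \<noteq> 0"
    using acyclic_onI[of "insert s U"] by auto
  have "coord z s \<noteq> 0"
  proof
    assume "coord z s = 0"
    hence "z \<in> chains_on U" using z(1) by (auto simp: chains_on_iff)
    moreover have "acyclic_on U" using assms(1) by (simp add: basis_of_def)
    ultimately show False using acyclic_onD[of U z] z(2,3) by blast
  qed
  moreover have "insert s U \<subseteq> C" using assms by (auto simp: basis_of_def)
  hence "z \<in> chains_on C" using z(1) chains_on_mono by blast
  ultimately show thesis using z by (intro that[of z]) (simp_all add: cycles_on_def)
qed

lemma cycle_determined_outside:
  assumes "acyclic_on U" "z \<in> cycles_on C" "restrict_chain (C - U) z = 0" shows "z = 0"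
proof -
  have "z \<in> chains_on U"
    unfolding chains_on_iff
  proof (intro allI impI)
    fix i assume "i \<notin> U"
    thus "coord z i = 0"
      using assms(2) arg_cong[OF assms(3), of "\<lambda>c. coord c i"]
      by (cases "i \<in> C") (auto simp: cycles_on_def chains_on_iff lookup_restrict_chain)
  qed
  thus ?thesis using acyclic_onD[OF assms(1)] assms(2) by (simp add: cycles_on_def)
qed

text \<open>A cycle is determined by its coordinates outside a basis, so the number of these coordinates bounds the
  rank of the lattice of cycles. The fundamental circuits show that the bound is attained.\<close>

lemma card_independent_cycles:
  assumes "finite C" "basis_of C U" "T \<subseteq> cycles_on C" "independent_mod {0} T"
  shows "card T \<le> card (C - U)"
proof (rule ccontr)
  assume "\<not> card T \<le> card (C - U)"
  hence "\<exists>k. (\<exists>t\<in>T. k t \<noteq> 0) \<and> lin_comb T (restrict_chain (C - U)) k = 0"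
    using assms by (intro vectors_dependent[of "C - U"] restrict_chain_in) (auto simp: independent_mod_def)
  then obtain k where k: "\<exists>t\<in>T. k t \<noteq> 0" "lin_comb T (restrict_chain (C - U)) k = 0"
    by blast
  have fin: "finite T" using assms by (simp add: independent_mod_def)
  have "acyclic_on U" using assms(2) by (simp add: basis_of_def)
  moreover have "restrict_chain (C - U) (lin_comb T (\<lambda>x. x) k) = lin_comb T (restrict_chain (C - U)) k"
    by (rule poly_mapping_eqI) (auto simp: lookup_restrict_chain lookup_lin_comb intro: sum.neutral)
  moreover have "lin_comb T (\<lambda>x. x) k \<in> cycles_on C"
  proof -
    have "\<delta> (lin_comb T (\<lambda>x. x) k) = lin_comb T \<delta> k" using lin_comb[OF fin, of "\<lambda>x. x" k] by simp
    also have "\<dots> = 0" using assms(3) by (auto simp: lin_comb_def cycles_on_def intro!: sum.neutral)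
    finally have "\<delta> (lin_comb T (\<lambda>x. x) k) = 0" .
    moreover have "lin_comb T (\<lambda>x. x) k \<in> chains_on C"
      by (rule chains_on_closed(6)) (use assms(3) in \<open>auto simp: cycles_on_def\<close>)
    ultimately show ?thesis by (simp add: cycles_on_def)
  qed
  ultimately have "lin_comb T (\<lambda>x. x) k = 0"
    using cycle_determined_outside[of U "lin_comb T (\<lambda>x. x) k" C] k(2) by simp
  thus False using k(1) assms(4) by (auto simp: independent_mod_def)
qed

lemma independent_circuits:
  assumes "finite C" "basis_of C U"
  obtains T where "T \<subseteq> cycles_on C" "independent_mod {0} T" "card T = card (C - U)"
proof -
  have "\<forall>s\<in>C - U. \<exists>z. z \<in> cycles_on C \<and> z \<in> chains_on (insert s U) \<and> coord z s \<noteq> 0"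
  proof
    fix s assume "s \<in> C - U"
    from basis_circuit[OF assms(2) this]
    show "\<exists>z. z \<in> cycles_on C \<and> z \<in> chains_on (insert s U) \<and> coord z s \<noteq> 0"
      by blast
  qed
  from bchoice[OF this] obtain z where "\<forall>s\<in>C - U. z s \<in> cycles_on C \<and> z s \<in> chains_on (insert s U)
      \<and> coord (z s) s \<noteq> 0" by blast
  hence z: "\<And>s. s \<in> C - U \<Longrightarrow> z s \<in> cycles_on C"
    "\<And>s. s \<in> C - U \<Longrightarrow> z s \<in> chains_on (insert s U)" "\<And>s. s \<in> C - U \<Longrightarrow> coord (z s) s \<noteq> 0"
    by blast+
  have z0: "coord (z s) t = 0" if "s \<in> C - U" "t \<in> C - U" "s \<noteq> t" for s t
    using z(2)[OF that(1)] that by (auto simp: chains_on_iff)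
  have inj: "inj_on z (C - U)"
  proof (rule inj_onI, rule ccontr)
    fix s t assume st: "s \<in> C - U" "t \<in> C - U" "z s = z t" "s \<noteq> t"
    have "coord (z s) t = 0" using st by (intro z0)
    thus False using z(3)[OF st(2)] st(3) by simp
  qed
  have "independent_mod {0} (z ` (C - U))"
    unfolding independent_mod_def
  proof (intro conjI allI impI ballI)
    show "finite (z ` (C - U))" using assms by simp
    fix k y assume k: "lin_comb (z ` (C - U)) (\<lambda>x. x) k \<in> {0}" and "y \<in> z ` (C - U)"
    then obtain s where s: "s \<in> C - U" "y = z s" by blast
    have "0 = coord (lin_comb (z ` (C - U)) (\<lambda>x. x) k) s" using k by simp
    also have "\<dots> = (\<Sum>t\<in>C - U. k (z t) * coord (z t) s)"
      by (simp add: lookup_lin_comb sum.reindex[OF inj])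
    also have "\<dots> = (\<Sum>t\<in>C - U. if t = s then k (z s) * coord (z s) s else 0)"
      by (rule sum.cong) (use z0 s in auto)
    also have "\<dots> = k (z s) * coord (z s) s" using s assms by (simp add: sum.delta)
    finally show "k y = 0" using z(3)[OF s(1)] s by simp
  qed
  moreover have "card (z ` (C - U)) = card (C - U)" using inj by (rule card_image)
  ultimately show thesis using z(1) by (intro that[of "z ` (C - U)"]) auto
qed

lemma card_basis_eq:
  assumes "finite C" "basis_of C U" "basis_of C V" shows "card U = card V"
proof -
  have "card (C - U) \<le> card (C - V)" if UV: "basis_of C U" "basis_of C V" for U V
  proof -
    obtain T where T: "T \<subseteq> cycles_on C" "independent_mod {0} T" "card T = card (C - U)"
      by (rule independent_circuits[OF assms(1) UV(1)])
    show ?thesis using card_independent_cycles[OF assms(1) UV(2) T(1,2)] T(3) by simp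
  qed
  from this[OF assms(2,3)] this[OF assms(3,2)] have "card (C - U) = card (C - V)" by simp
  moreover have "U \<subseteq> C" "V \<subseteq> C" using assms by (auto simp: basis_of_def)
  moreover from this have "card (C - U) = card C - card U" "card U \<le> card C"
      "card (C - V) = card C - card V" "card V \<le> card C"
    using assms(1) by (auto intro: card_Diff_subset card_mono finite_subset)
  ultimately show ?thesis by linarith
qed

lemma basis_of_iff_card:
  assumes "finite C" "basis_of C V"
  shows "basis_of C U \<longleftrightarrow> U \<subseteq> C \<and> acyclic_on U \<and> card U = card V"
proof
  assume "basis_of C U"
  thus "U \<subseteq> C \<and> acyclic_on U \<and> card U = card V"
    using card_basis_eq[OF assms(1) _ assms(2)] by (auto simp: basis_of_def)
next
  assume "U \<subseteq> C \<and> acyclic_on U \<and> card U = card V"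
  hence U: "U \<subseteq> C" "acyclic_on U" "card U = card V" by auto
  obtain G where G: "basis_of C G" "U \<subseteq> G" by (rule basis_exists[OF assms(1) U(1,2)])
  have "card U = card G" using card_basis_eq[OF assms(1) G(1) assms(2)] U(3) by simp
  moreover have "finite G" using G(1) assms(1) finite_subset by (auto simp: basis_of_def)
  ultimately have "U = G" using card_subset_eq G(2) by blast
  thus "basis_of C U" using G(1) by simp
qed

end

section \<open>Minors of a boundary matrix as indices\<close>

context boundary_map begin

text \<open>The minor of \<open>\<delta>\<close> with rows \<open>S\<close> and columns \<open>\<gamma> ` S\<close>.\<close>

definition incidence_det :: "'i set \<Rightarrow> ('i \<Rightarrow> 'i) \<Rightarrow> int" where
  "incidence_det S \<gamma> = det_on S (\<lambda>s t. coord (\<delta> (frag_of (\<gamma> t))) s)"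

lemma lookup_boundary:
  assumes "finite S" "bij_betw \<gamma> S F" "w \<in> chains_on F"
  shows "coord (\<delta> w) s
    = (\<Sum>t\<in>S. coord (\<delta> (frag_of (\<gamma> t))) s * coord w (\<gamma> t))"
proof -
  have F: "finite F" using assms bij_betw_finite by blast
  have "\<delta> w = lin_comb F (\<lambda>t. \<delta> (frag_of t)) (coord w)"
    using lin_comb[OF F, of frag_of "coord w"] chain_as_lin_comb[OF F assms(3)] by simp
  hence "coord (\<delta> w) s
      = (\<Sum>f\<in>F. coord w f * coord (\<delta> (frag_of f)) s)"
    by (simp add: lookup_lin_comb)
  also have "\<dots> = (\<Sum>t\<in>S. coord w (\<gamma> t) * coord (\<delta> (frag_of (\<gamma> t))) s)"
    by (rule sum.reindex_bij_betw[OF assms(2), symmetric])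
  finally show ?thesis by (simp add: mult.commute)
qed

lemma incidence_det_nonzero_iff:
  assumes "finite S" "bij_betw \<gamma> S F"
  shows "incidence_det S \<gamma> \<noteq> 0 \<longleftrightarrow> (\<forall>w\<in>chains_on F. restrict_chain S (\<delta> w) = 0 \<longrightarrow> w = 0)"
proof
  assume nz: "incidence_det S \<gamma> \<noteq> 0"
  show "\<forall>w\<in>chains_on F. restrict_chain S (\<delta> w) = 0 \<longrightarrow> w = 0"
  proof (intro ballI impI)
    fix w assume w: "w \<in> chains_on F" "restrict_chain S (\<delta> w) = 0"
    have "(\<Sum>t\<in>S. coord (\<delta> (frag_of (\<gamma> t))) s * coord w (\<gamma> t)) = 0"
      if "s \<in> S" for s
      using arg_cong[OF w(2), of "\<lambda>c. coord c s"] that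
      by (simp add: lookup_restrict_chain lookup_boundary[OF assms w(1), symmetric])
    hence "\<not> (\<exists>t\<in>S. coord w (\<gamma> t) \<noteq> 0)"
      using nz det_on_eq_0_iff[OF assms(1), of "\<lambda>s t. coord (\<delta> (frag_of (\<gamma> t))) s"]
      unfolding incidence_det_def by (auto dest!: spec[of _ "\<lambda>t. coord w (\<gamma> t)"])
    hence 0: "coord w (\<gamma> t) = 0" if "t \<in> S" for t using that by blast
    show "w = 0"
    proof (rule poly_mapping_eqI)
      fix i show "coord w i = coord 0 i"
      proof (cases "i \<in> F")
        case True
        hence "i \<in> \<gamma> ` S" using assms(2) by (simp add: bij_betw_def)
        thus ?thesis using 0 by auto
      qed (use w(1) in \<open>simp add: chains_on_iff\<close>)
    qed
  qed
next
  assume inj: "\<forall>w\<in>chains_on F. restrict_chain S (\<delta> w) = 0 \<longrightarrow> w = 0"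
  show "incidence_det S \<gamma> \<noteq> 0"
  proof
    assume "incidence_det S \<gamma> = 0"
    then obtain v t where v: "t \<in> S" "v t \<noteq> 0"
      "\<And>s. s \<in> S \<Longrightarrow> (\<Sum>t\<in>S. coord (\<delta> (frag_of (\<gamma> t))) s * v t) = 0"
      unfolding incidence_det_def det_on_eq_0_iff[OF assms(1)] by blast
    have inj_\<gamma>: "inj_on \<gamma> S" "\<gamma> ` S = F" using assms(2) by (auto simp: bij_betw_def)
    have F: "finite F" using assms bij_betw_finite by blast
    define w where "w = lin_comb F frag_of (\<lambda>f. v (inv_into S \<gamma> f))"
    have w: "w \<in> chains_on F" unfolding w_def by (rule chains_on_closed(6)) (rule chains_on_closed(5))
    have lw: "coord w (\<gamma> u) = v u" if "u \<in> S" for u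
    proof -
      have "coord w (\<gamma> u) = (\<Sum>f\<in>F. if f = \<gamma> u then v u else 0)"
        unfolding w_def lookup_lin_comb using inj_\<gamma> that by (intro sum.cong) auto
      thus ?thesis using F inj_\<gamma> that by (auto simp: sum.delta)
    qed
    have "restrict_chain S (\<delta> w) = 0"
    proof (rule poly_mapping_eqI)
      fix s
      have "(\<Sum>t\<in>S. coord (\<delta> (frag_of (\<gamma> t))) s * coord w (\<gamma> t))
          = (\<Sum>t\<in>S. coord (\<delta> (frag_of (\<gamma> t))) s * v t)"
        by (intro sum.cong refl) (simp add: lw)
      thus "coord (restrict_chain S (\<delta> w)) s = coord 0 s"
        using v(3)[of s] by (simp add: lookup_restrict_chain lookup_boundary[OF assms w])
    qed
    hence "w = 0" using inj w by blast
    thus False using lw[OF v(1)] v(2) by simp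
  qed
qed

lemma add_subgroup_image_restrict:
  "add_subgroup A \<Longrightarrow> add_subgroup (restrict_chain S ` A)"
  unfolding add_subgroup_def
proof (intro conjI ballI)
  assume A: "0 \<in> A \<and> (\<forall>x\<in>A. \<forall>y\<in>A. x - y \<in> A)"
  show "0 \<in> restrict_chain S ` A" using A by (intro image_eqI[of _ _ 0]) (simp_all add: restrict_chain_0)
  fix x y assume "x \<in> restrict_chain S ` A" "y \<in> restrict_chain S ` A"
  then obtain a b where "a \<in> A" "b \<in> A" "x - y = restrict_chain S (a - b)" by (auto simp: restrict_chain_diff)
  thus "x - y \<in> restrict_chain S ` A" using A by blast
qed

text \<open>The columns of the minor span the restrictions to \<open>S\<close> of the boundaries on \<open>F\<close>.\<close>

lemma incidence_det_index:
  assumes "finite S" "bij_betw \<gamma> S F" "incidence_det S \<gamma> \<noteq> 0"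
  shows "int (sub_index (chains_on S) (restrict_chain S ` boundaries_on F)) = \<bar>incidence_det S \<gamma>\<bar>"
proof -
  let ?b = "\<lambda>t. restrict_chain S (\<delta> (frag_of (\<gamma> t)))"
  have F: "finite F" using assms bij_betw_finite by blast
  have d: "det_on S (\<lambda>t s. coord (?b t) s) = incidence_det S \<gamma>"
  proof -
    have "det_on S (\<lambda>t s. coord (?b t) s)
        = det_on S (\<lambda>t s. coord (\<delta> (frag_of (\<gamma> t))) s)"
      by (rule det_on_cong) (simp add: lookup_restrict_chain)
    also have "\<dots> = incidence_det S \<gamma>" unfolding incidence_det_def
      using det_on_transpose[OF assms(1), of "\<lambda>s t. coord (\<delta> (frag_of (\<gamma> t))) s"] .
    finally show ?thesis .
  qed
  have comb: "restrict_chain S (\<delta> w) = lin_comb S ?b (\<lambda>t. coord w (\<gamma> t))"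
    if "w \<in> chains_on F" for w
    by (rule poly_mapping_eqI)
      (simp add: lookup_restrict_chain lookup_lin_comb lookup_boundary[OF assms(1,2) that] mult.commute)
  have "range (lin_comb S ?b) = restrict_chain S ` boundaries_on F"
  proof
    show "restrict_chain S ` boundaries_on F \<subseteq> range (lin_comb S ?b)"
      using comb by (auto simp: boundaries_on_def)
    show "range (lin_comb S ?b) \<subseteq> restrict_chain S ` boundaries_on F"
    proof
      fix x assume "x \<in> range (lin_comb S ?b)"
      then obtain k where k: "x = lin_comb S ?b k" by blast
      define w where "w = lin_comb F frag_of (\<lambda>f. k (inv_into S \<gamma> f))"
      have w: "w \<in> chains_on F" unfolding w_def by (rule chains_on_closed(6)) (rule chains_on_closed(5))
      have inj_\<gamma>: "inj_on \<gamma> S" "\<gamma> ` S = F" using assms(2) by (auto simp: bij_betw_def)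
      have "coord w (\<gamma> u) = k u" if "u \<in> S" for u
      proof -
        have "coord w (\<gamma> u) = (\<Sum>f\<in>F. if f = \<gamma> u then k u else 0)"
          unfolding w_def lookup_lin_comb using inj_\<gamma> that by (intro sum.cong) auto
        thus ?thesis using F inj_\<gamma> that by (auto simp: sum.delta)
      qed
      hence "lin_comb S ?b (\<lambda>t. coord w (\<gamma> t)) = x"
        unfolding k lin_comb_def by (intro sum.cong) auto
      hence "x = restrict_chain S (\<delta> w)" using comb[OF w] by simp
      thus "x \<in> restrict_chain S ` boundaries_on F" using w unfolding boundaries_on_def by blast
    qed
  qed
  moreover have "int (sub_index (chains_on S) (range (lin_comb S ?b))) = \<bar>incidence_det S \<gamma>\<bar>"
    unfolding d[symmetric]
    by (rule sub_index_eq_det[OF assms(1) restrict_chain_in]) (use assms(3) d in simp)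
  ultimately show ?thesis by simp
qed

text \<open>Both sides are the index of \<open>cycles_on C + chains_on U\<close> in \<open>chains_on C\<close>: dividing out
  \<open>chains_on U\<close> first gives the left side, dividing out the cycles, that is applying \<open>\<delta>\<close>, gives the
  right side.\<close>

lemma sub_index_restricted_cycles:
  assumes "U \<subseteq> C"
  shows "sub_index (chains_on (C - U)) (restrict_chain (C - U) ` cycles_on C)
       = sub_index (boundaries_on C) (boundaries_on U)"
proof (rule sub_index_eqI[where f = \<delta>])
  let ?S = "C - U"
  have CU: "C - ?S = U" using assms by auto
  show "add_subgroup (restrict_chain ?S ` cycles_on C)"
    by (rule add_subgroup_image_restrict[OF add_subgroup_cycles])
  show "add_subgroup (boundaries_on U)" by (rule add_subgroup_boundaries)
  have SC: "c \<in> chains_on C" if "c \<in> chains_on ?S" for c using that chains_on_mono[of ?S C] by blast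
  have UC: "c \<in> chains_on C" if "c \<in> chains_on U" for c using that chains_on_mono[OF assms] by blast
  show "\<delta> c \<in> boundaries_on C" if "c \<in> chains_on ?S" for c
    using SC[OF that] by (simp add: boundaries_on_def)
  show "\<exists>a\<in>chains_on ?S. \<delta> a - x \<in> boundaries_on U" if "x \<in> boundaries_on C" for x
  proof -
    from that obtain c where c: "c \<in> chains_on C" "x = \<delta> c" by (auto simp: boundaries_on_def)
    have "c - restrict_chain ?S c \<in> chains_on U" using minus_restrict_chain[OF c(1), of ?S] unfolding CU .
    hence "0 - (c - restrict_chain ?S c) \<in> chains_on U" by (rule chains_on_closed(2)[OF chains_on_closed(1)])
    moreover have "\<delta> (restrict_chain ?S c) - x = \<delta> (0 - (c - restrict_chain ?S c))"
      unfolding diff zero c(2) by simp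
    ultimately have "\<delta> (restrict_chain ?S c) - x \<in> boundaries_on U" by (simp add: boundaries_on_def)
    thus ?thesis using restrict_chain_in by blast
  qed
  show "\<delta> a - \<delta> b \<in> boundaries_on U \<longleftrightarrow> a - b \<in> restrict_chain ?S ` cycles_on C"
    if "a \<in> chains_on ?S" "b \<in> chains_on ?S" for a b
  proof
    have ab: "a - b \<in> chains_on ?S" using that by (rule chains_on_closed)
    {
      assume "\<delta> a - \<delta> b \<in> boundaries_on U"
      then obtain u where u: "u \<in> chains_on U" "\<delta> (a - b) = \<delta> u" by (auto simp: boundaries_on_def diff)
      have "(a - b) - u \<in> cycles_on C"
        using chains_on_closed(2)[OF SC[OF ab] UC[OF u(1)]] u(2) by (simp add: cycles_on_def diff[of "a - b"])
      moreover have "restrict_chain ?S u = 0"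
        using u(1) by (intro poly_mapping_eqI) (auto simp: lookup_restrict_chain chains_on_iff)
      hence "a - b = restrict_chain ?S ((a - b) - u)"
        unfolding restrict_chain_diff[of _ "a - b"] by (simp add: restrict_chain_id[OF ab])
      ultimately show "a - b \<in> restrict_chain ?S ` cycles_on C" by blast
    }
    assume "a - b \<in> restrict_chain ?S ` cycles_on C"
    then obtain z where z: "z \<in> cycles_on C" "a - b = restrict_chain ?S z" by blast
    hence zC: "z \<in> chains_on C" "\<delta> z = 0" by (auto simp: cycles_on_def)
    have "z - restrict_chain ?S z \<in> chains_on U" using minus_restrict_chain[OF zC(1), of ?S] unfolding CU .
    hence "0 - (z - restrict_chain ?S z) \<in> chains_on U" by (rule chains_on_closed(2)[OF chains_on_closed(1)])
    moreover have "\<delta> a - \<delta> b = \<delta> (0 - (z - restrict_chain ?S z))"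
      unfolding diff zero z(2)[symmetric] zC(2) by simp
    ultimately show "\<delta> a - \<delta> b \<in> boundaries_on U" by (simp add: boundaries_on_def)
  qed
qed

end

text \<open>Two consecutive chain groups whose homology in the middle is torsion. For a cell complex this
  expresses the vanishing of a reduced Betti number.\<close>

locale torsion_step = boundary_map +
  fixes C2 C1 :: "'a set"
  assumes fin2: "finite C2" and fin1: "finite C1"
    and bd_cycles: "boundaries_on C2 \<subseteq> cycles_on C1"
    and torsion: "z \<in> cycles_on C1 \<Longrightarrow> \<exists>n. n \<noteq> 0 \<and> frag_cmul n z \<in> boundaries_on C2"
begin

lemma boundary_cycle: "w \<in> chains_on F \<Longrightarrow> F \<subseteq> C2 \<Longrightarrow> \<delta> w \<in> cycles_on C1"
  using bd_cycles chains_on_mono[of F C2] by (auto simp: boundaries_on_def)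

lemma restricted_boundary_injective:
  assumes "F \<subseteq> C2" "acyclic_on F" "acyclic_on U" "w \<in> chains_on F"
    and "restrict_chain (C1 - U) (\<delta> w) = 0"
  shows "w = 0"
proof -
  have "\<delta> w = 0"
    using cycle_determined_outside[OF assms(3) boundary_cycle[OF assms(4,1)] assms(5)] .
  thus ?thesis using acyclic_onD[OF assms(2,4)] by simp
qed

lemma card_acyclic_le:
  assumes F: "F \<subseteq> C2" "acyclic_on F" and U: "acyclic_on U"
  shows "card F \<le> card (C1 - U)"
proof (rule ccontr)
  assume "\<not> ?thesis"
  moreover have finF: "finite F" using F fin2 finite_subset by blast
  ultimately have "\<exists>k. (\<exists>t\<in>F. k t \<noteq> 0) \<and> lin_comb F (\<lambda>t. restrict_chain (C1 - U) (\<delta> (frag_of t))) k = 0"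
    using fin1 by (intro vectors_dependent[of "C1 - U"] restrict_chain_in) auto
  then obtain k t where k: "t \<in> F" "k t \<noteq> 0"
    "lin_comb F (\<lambda>t. restrict_chain (C1 - U) (\<delta> (frag_of t))) k = 0" by blast
  define w where "w = lin_comb F frag_of k"
  have w: "w \<in> chains_on F" unfolding w_def by (rule chains_on_closed(6)) (rule chains_on_closed(5))
  have "restrict_chain (C1 - U) (\<delta> w) = lin_comb F (\<lambda>t. restrict_chain (C1 - U) (\<delta> (frag_of t))) k"
    unfolding w_def lin_comb[OF finF]
    by (rule poly_mapping_eqI) (auto simp: lookup_restrict_chain lookup_lin_comb intro: sum.neutral)
  hence "w = 0" using k(3) restricted_boundary_injective[OF F U w] by simp
  have "coord w t = (\<Sum>f\<in>F. if f = t then k t else 0)"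
    unfolding w_def lookup_lin_comb by (rule sum.cong) auto
  also have "\<dots> = k t" using k(1) finF by (simp add: sum.delta)
  finally show False using k(2) \<open>w = 0\<close> by simp
qed

text \<open>By maximality of \<open>F\<close> every generator has a multiple that is homologous into \<open>F\<close>; the multiples for
  finitely many generators combine.\<close>

lemma multiple_in_basis_boundaries:
  assumes F: "basis_of C2 F" and w: "w \<in> chains_on C2"
  shows "\<exists>m. m \<noteq> 0 \<and> frag_cmul m (\<delta> w) \<in> boundaries_on F"
proof -
  have finF: "finite F" using F fin2 finite_subset by (auto simp: basis_of_def)
  have basic: "\<exists>m. m \<noteq> 0 \<and> frag_cmul m (\<delta> (frag_of f)) \<in> boundaries_on F" if f: "f \<in> C2" for f
  proof (cases "f \<in> F")
    case True
    hence "frag_cmul 1 (\<delta> (frag_of f)) \<in> boundaries_on F"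
      by (simp add: boundaries_on_def chains_on_closed)
    thus ?thesis by (intro exI[of _ 1]) simp
  next
    case False
    obtain z where z: "z \<in> cycles_on C2" "z \<in> chains_on (insert f F)" "coord z f \<noteq> 0"
      by (rule basis_circuit[OF F, of f]) (use f False in auto)
    let ?m = "coord z f"
    have "frag_cmul ?m (frag_of f) - z \<in> chains_on F"
      using z(2) by (auto simp: chains_on_iff lookup_minus)
    moreover have "\<delta> (frag_cmul ?m (frag_of f) - z) = frag_cmul ?m (\<delta> (frag_of f))"
      using z(1) by (simp add: diff cmul cycles_on_def)
    ultimately have "frag_cmul ?m (\<delta> (frag_of f)) \<in> boundaries_on F"
      unfolding boundaries_on_def by (metis image_eqI)
    thus ?thesis using z(3) by blast
  qed
  have "Poly_Mapping.keys w \<subseteq> C2" using w by (simp add: chains_on_def)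
  thus ?thesis
  proof (rule frag_induction)
    show "\<exists>m. m \<noteq> 0 \<and> frag_cmul m (\<delta> 0) \<in> boundaries_on F"
      using add_subgroupD(1)[OF add_subgroup_boundaries, of F] by (intro exI[of _ 1]) (simp add: zero)
    fix a b
    assume "\<exists>m. m \<noteq> 0 \<and> frag_cmul m (\<delta> a) \<in> boundaries_on F" "\<exists>m. m \<noteq> 0 \<and> frag_cmul m (\<delta> b) \<in> boundaries_on F"
    then obtain m n where mn: "m \<noteq> 0" "frag_cmul m (\<delta> a) \<in> boundaries_on F"
      "n \<noteq> 0" "frag_cmul n (\<delta> b) \<in> boundaries_on F" by blast
    have "frag_cmul (m * n) (\<delta> (a - b)) = frag_cmul n (frag_cmul m (\<delta> a)) - frag_cmul m (frag_cmul n (\<delta> b))"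
      by (rule poly_mapping_eqI) (simp add: diff lookup_minus algebra_simps)
    also have "\<dots> \<in> boundaries_on F"
      by (rule add_subgroupD(2)[OF add_subgroup_boundaries cmul_boundary[OF mn(2)] cmul_boundary[OF mn(4)]])
    finally show "\<exists>m. m \<noteq> 0 \<and> frag_cmul m (\<delta> (a - b)) \<in> boundaries_on F"
      using mn by (intro exI[of _ "m * n"]) simp
  qed (use basic in auto)
qed

lemma multiple_of_cycle:
  assumes F: "basis_of C2 F" and z: "z \<in> cycles_on C1"
  obtains n w where "n \<noteq> 0" "w \<in> chains_on F" "\<delta> w = frag_cmul n z"
proof -
  obtain m where m: "m \<noteq> 0" "frag_cmul m z \<in> boundaries_on C2" using torsion[OF z] by blast
  then obtain v where v: "v \<in> chains_on C2" "frag_cmul m z = \<delta> v" by (auto simp: boundaries_on_def)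
  obtain k where k: "k \<noteq> 0" "frag_cmul k (\<delta> v) \<in> boundaries_on F"
    using multiple_in_basis_boundaries[OF F v(1)] by blast
  then obtain w where "w \<in> chains_on F" "frag_cmul k (\<delta> v) = \<delta> w" by (auto simp: boundaries_on_def)
  thus thesis using m(1) k(1) v(2) by (intro that[of "k * m" w]) (auto simp flip: frag_cmul_cmul)
qed

text \<open>Restriction to the complement of \<open>U\<close> is injective on boundaries of chains on \<open>F\<close>, which bounds the size of \<open>F\<close>. Conversely
  each fundamental circuit of \<open>U\<close> has a multiple that bounds a chain on \<open>F\<close>, and these chains are
  independent.\<close>

lemma card_basis_complement:
  assumes F: "basis_of C2 F" and U: "basis_of C1 U"
  shows "card F = card (C1 - U)"
proof (rule antisym)
  show "card F \<le> card (C1 - U)" using F U by (intro card_acyclic_le) (auto simp: basis_of_def)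
  show "card (C1 - U) \<le> card F"
  proof (rule ccontr)
    let ?S = "C1 - U"
    assume less: "\<not> card ?S \<le> card F"
    have finF: "finite F" using F fin2 finite_subset by (auto simp: basis_of_def)
    have finS: "finite ?S" using fin1 by simp
    have "\<forall>s\<in>?S. \<exists>w. w \<in> chains_on F \<and> \<delta> w \<in> chains_on (insert s U) \<and> coord (\<delta> w) s \<noteq> 0"
    proof
      fix s assume s: "s \<in> ?S"
      obtain z where z: "z \<in> cycles_on C1" "z \<in> chains_on (insert s U)" "coord z s \<noteq> 0"
        by (rule basis_circuit[OF U s])
      obtain n w where w: "n \<noteq> 0" "w \<in> chains_on F" "\<delta> w = frag_cmul n z"
        by (rule multiple_of_cycle[OF F z(1)])
      show "\<exists>w. w \<in> chains_on F \<and> \<delta> w \<in> chains_on (insert s U) \<and> coord (\<delta> w) s \<noteq> 0"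
        using w z by (intro exI[of _ w]) (simp add: chains_on_closed)
    qed
    from bchoice[OF this] obtain w where "\<forall>s\<in>?S. w s \<in> chains_on F \<and> \<delta> (w s) \<in> chains_on (insert s U)
       \<and> coord (\<delta> (w s)) s \<noteq> 0" by blast
    hence w: "w s \<in> chains_on F" "\<delta> (w s) \<in> chains_on (insert s U)" "coord (\<delta> (w s)) s \<noteq> 0"
      if "s \<in> ?S" for s using that by auto
    have "\<exists>k. (\<exists>t\<in>?S. k t \<noteq> 0) \<and> lin_comb ?S w k = 0"
      using less finF finS w(1) by (intro vectors_dependent[of F]) auto
    then obtain k s where k: "s \<in> ?S" "k s \<noteq> 0" "lin_comb ?S w k = 0" by blast
    have "0 = coord (\<delta> (lin_comb ?S w k)) s" using k(3) by (simp add: zero)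
    also have "\<dots> = (\<Sum>t\<in>?S. k t * coord (\<delta> (w t)) s)"
      by (simp only: lin_comb[OF finS] lookup_lin_comb)
    also have "\<dots> = (\<Sum>t\<in>?S. if t = s then k s * coord (\<delta> (w s)) s else 0)"
    proof (rule sum.cong[OF refl])
      fix t assume t: "t \<in> ?S"
      show "k t * coord (\<delta> (w t)) s = (if t = s then k s * coord (\<delta> (w s)) s else 0)"
        using w(2)[OF t] k(1) by (auto simp: chains_on_iff)
    qed
    also have "\<dots> = k s * coord (\<delta> (w s)) s" using k(1) finS by (simp add: sum.delta)
    finally show False using k(2) w(3)[OF k(1)] by simp
  qed
qed

text \<open>The minor is the index of the restricted boundaries in \<open>chains_on (C1 - U)\<close>. Restriction is injective
  on cycles, because \<open>U\<close> is acyclic, and the index is computed in two stages through the restricted cycles.\<close>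

lemma incidence_det_bases:
  assumes F: "basis_of C2 F" and U: "basis_of C1 U" and \<gamma>: "bij_betw \<gamma> (C1 - U) F"
  shows "incidence_det (C1 - U) \<gamma> \<noteq> 0"
    and "\<bar>incidence_det (C1 - U) \<gamma>\<bar> =
      int (sub_index (boundaries_on C1) (boundaries_on U) * sub_index (cycles_on C1) (boundaries_on F))"
proof -
  let ?S = "C1 - U"
  have S: "finite ?S" using fin1 by simp
  have F': "F \<subseteq> C2" "acyclic_on F" and U': "U \<subseteq> C1" "acyclic_on U" using F U by (auto simp: basis_of_def)
  have bdF: "boundaries_on F \<subseteq> cycles_on C1" using boundary_cycle F' by (auto simp: boundaries_on_def)
  show nz: "incidence_det ?S \<gamma> \<noteq> 0"
    unfolding incidence_det_nonzero_iff[OF S \<gamma>]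
    using restricted_boundary_injective[OF F' U'(2)] by blast
  have "\<bar>incidence_det ?S \<gamma>\<bar> = int (sub_index (chains_on ?S) (restrict_chain ?S ` boundaries_on F))"
    using incidence_det_index[OF S \<gamma> nz] by simp
  also have "sub_index (chains_on ?S) (restrict_chain ?S ` boundaries_on F)
      = sub_index (chains_on ?S) (restrict_chain ?S ` cycles_on C1)
        * sub_index (restrict_chain ?S ` cycles_on C1) (restrict_chain ?S ` boundaries_on F)"
    by (intro sub_index_tower add_subgroup_chains_on add_subgroup_image_restrict add_subgroup_cycles
        add_subgroup_boundaries image_mono bdF) (auto simp: restrict_chain_in)
  also have "sub_index (restrict_chain ?S ` cycles_on C1) (restrict_chain ?S ` boundaries_on F)
      = sub_index (cycles_on C1) (boundaries_on F)"
  proof (rule sub_index_eqI[where f = "restrict_chain ?S", symmetric])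
    show "\<exists>a\<in>cycles_on C1. restrict_chain ?S a - a' \<in> restrict_chain ?S ` boundaries_on F"
      if "a' \<in> restrict_chain ?S ` cycles_on C1" for a'
    proof -
      from that obtain a where "a \<in> cycles_on C1" "a' = restrict_chain ?S a" by blast
      moreover have "0 \<in> restrict_chain ?S ` boundaries_on F"
        by (rule add_subgroupD(1)[OF add_subgroup_image_restrict[OF add_subgroup_boundaries]])
      ultimately show ?thesis by (intro bexI[of _ a]) simp_all
    qed
    show "restrict_chain ?S a - restrict_chain ?S b \<in> restrict_chain ?S ` boundaries_on F \<longleftrightarrow> a - b \<in> boundaries_on F"
      if ab: "a \<in> cycles_on C1" "b \<in> cycles_on C1" for a b
    proof
      assume "restrict_chain ?S a - restrict_chain ?S b \<in> restrict_chain ?S ` boundaries_on F"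
      then obtain y where y: "y \<in> boundaries_on F" "restrict_chain ?S (a - b) = restrict_chain ?S y"
        by (auto simp: restrict_chain_diff)
      have "a - b \<in> cycles_on C1" using ab by (rule add_subgroupD(2)[OF add_subgroup_cycles])
      hence "a - b - y \<in> cycles_on C1"
        by (rule add_subgroupD(2)[OF add_subgroup_cycles _ subsetD[OF bdF y(1)]])
      moreover have "restrict_chain ?S (a - b - y) = 0" using y(2) by (simp add: restrict_chain_diff)
      ultimately have "a - b - y = 0" by (rule cycle_determined_outside[OF U'(2)])
      thus "a - b \<in> boundaries_on F" using y(1) by simp
    next
      assume "a - b \<in> boundaries_on F"
      thus "restrict_chain ?S a - restrict_chain ?S b \<in> restrict_chain ?S ` boundaries_on F"
        by (simp flip: restrict_chain_diff)
    qed
  qed (auto intro: add_subgroup_image_restrict add_subgroup_boundaries)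
  also have "sub_index (chains_on ?S) (restrict_chain ?S ` cycles_on C1)
      = sub_index (boundaries_on C1) (boundaries_on U)"
    by (rule sub_index_restricted_cycles[OF U'(1)])
  finally show "\<bar>incidence_det ?S \<gamma>\<bar> =
      int (sub_index (boundaries_on C1) (boundaries_on U) * sub_index (cycles_on C1) (boundaries_on F))" .
qed

text \<open>A nonzero minor makes the columns independent, so \<open>F\<close> is a basis by its size. If \<open>z\<close> is a cycle on
  the deleted rows, a multiple of it bounds a chain on \<open>F\<close> whose boundary vanishes on \<open>S\<close>; that chain is
  zero, and hence so is \<open>z\<close>.\<close>

lemma incidence_det_nonzero_imp_bases:
  assumes F0: "basis_of C2 F0" and S: "S \<subseteq> C1" "card S = card F0" and F: "F \<subseteq> C2" "bij_betw \<gamma> S F"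
    and nz: "incidence_det S \<gamma> \<noteq> 0"
  shows "basis_of C2 F" "basis_of C1 (C1 - S)"
proof -
  have finS: "finite S" using S fin1 finite_subset by blast
  have inj: "w = 0" if "w \<in> chains_on F" "restrict_chain S (\<delta> w) = 0" for w
    using nz that unfolding incidence_det_nonzero_iff[OF finS F(2)] by blast
  have "acyclic_on F"
    by (rule acyclic_onI) (use inj in \<open>simp add: restrict_chain_0\<close>)
  moreover have "card F = card F0" using S F(2) bij_betw_same_card by metis
  ultimately show bF: "basis_of C2 F"
    using F(1) basis_of_iff_card[OF fin2 F0, of F] by blast
  have acU: "acyclic_on (C1 - S)"
  proof (rule acyclic_onI)
    fix z assume z: "z \<in> chains_on (C1 - S)" "\<delta> z = 0"
    hence "z \<in> cycles_on C1" using chains_on_mono[of "C1 - S" C1] by (auto simp: cycles_on_def)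
    then obtain n w where w: "n \<noteq> 0" "w \<in> chains_on F" "\<delta> w = frag_cmul n z"
      by (rule multiple_of_cycle[OF bF])
    have "restrict_chain S (\<delta> w) = 0"
      unfolding w(3) using z(1) by (intro poly_mapping_eqI) (auto simp: lookup_restrict_chain chains_on_iff)
    hence "frag_cmul n z = 0" using inj[OF w(2)] w(3) by (simp add: zero)
    thus "z = 0" using w(1) by simp
  qed
  obtain U0 where U0: "basis_of C1 U0" "{} \<subseteq> U0"
    by (rule basis_exists[OF fin1 _ acyclic_on_empty]) auto
  have "card F0 = card (C1 - U0)" by (rule card_basis_complement[OF F0 U0(1)])
  moreover have "card (C1 - U0) = card C1 - card U0" "card U0 \<le> card C1"
    using U0(1) fin1 by (auto simp: basis_of_def intro: card_Diff_subset finite_subset card_mono)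
  moreover have "card (C1 - S) = card C1 - card S" "card S \<le> card C1"
    using S(1) fin1 finS by (auto intro: card_Diff_subset card_mono)
  ultimately have "card (C1 - S) = card U0" using S(2) by linarith
  thus "basis_of C1 (C1 - S)"
    using basis_of_iff_card[OF fin1 U0(1), of "C1 - S"] acU by blast
qed

text \<open>The homology of a spanning tree is finite, because its order divides a minor that is nonzero.\<close>

lemma sub_index_cycles_boundaries_nonzero:
  assumes F: "basis_of C2 F" shows "sub_index (cycles_on C1) (boundaries_on F) \<noteq> 0"
proof -
  obtain U where U: "basis_of C1 U" "{} \<subseteq> U"
    by (rule basis_exists[OF fin1 _ acyclic_on_empty]) auto
  have "finite (C1 - U)" "finite F" using fin1 F fin2 finite_subset by (auto simp: basis_of_def)
  then obtain \<gamma> where "bij_betw \<gamma> (C1 - U) F"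
    using card_basis_complement[OF F U(1)] finite_same_card_bij[of "C1 - U" F] by metis
  note det = incidence_det_bases[OF F U(1) this]
  show ?thesis
  proof
    assume "sub_index (cycles_on C1) (boundaries_on F) = 0"
    thus False using det by simp
  qed
qed

end

section \<open>Homology groups as quotients of lattices\<close>

text \<open>The quotient \<open>Z / B\<close>, formed in the same way as a homology group, inside the free abelian group
  on \<open>S\<close>.\<close>

locale lattice_quotient =
  fixes S :: "'i set" and Z B :: "('i \<Rightarrow>\<^sub>0 int) set"
  assumes Z: "add_subgroup Z" and B: "add_subgroup B" and BZ: "B \<subseteq> Z" and ZS: "Z \<subseteq> chains_on S"
begin

abbreviation H where "H \<equiv> subgroup_generated (free_Abelian_group S) Z"
abbreviation G where "G \<equiv> H Mod B"
abbreviation cls where "cls a \<equiv> (+) a ` B"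

lemma subgroup_Z: "subgroup Z (free_Abelian_group S)"
proof
  show "Z \<subseteq> carrier (free_Abelian_group S)" using ZS by (auto simp: chains_on_def)
  fix x assume x: "x \<in> Z"
  hence "Poly_Mapping.keys x \<subseteq> S" using ZS by (auto simp: chains_on_def)
  thus "inv\<^bsub>free_Abelian_group S\<^esub> x \<in> Z" using add_subgroupD(3)[OF Z x] by simp
qed (use add_subgroupD[OF Z] in auto)

lemma carrier_H: "carrier H = Z"
  by (rule subgroup.carrier_subgroup_generated_subgroup[OF subgroup_Z])

lemma comm_group_H: "comm_group H"
  by (rule group.abelian_subgroup_generated[OF group_free_Abelian_group abelian_free_Abelian_group])

lemma group_H: "group H"
  using comm_group_H by (simp add: comm_group_def)

lemma int_pow_H: "x \<in> Z \<Longrightarrow> x [^]\<^bsub>H\<^esub> (n::int) = frag_cmul n x"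
  using group.int_pow_subgroup_generated[OF group_free_Abelian_group, of x S Z n] carrier_H ZS
  by (auto simp: chains_on_def int_pow_free_Abelian_group)

lemma inv_H: "x \<in> Z \<Longrightarrow> inv\<^bsub>H\<^esub> x = - x"
  by (rule group.inv_equality[OF group_H]) (use add_subgroupD(3)[OF Z] carrier_H in auto)

lemma subgroup_B: "subgroup B H"
  by standard (use BZ carrier_H add_subgroupD[OF B] inv_H in auto)

lemma r_coset_eq: "B #>\<^bsub>H\<^esub> a = cls a"
  by (auto simp: r_coset_def add.commute image_iff)

lemma comm_group_G: "comm_group G"
  by (rule comm_group.abelian_FactGroup[OF comm_group_H subgroup_B])

lemma group_G: "group G"
  using comm_group_G by (simp add: comm_group_def)

lemma cls_group_hom: "group_hom H G cls"
proof -
  have "B \<lhd> H" using comm_group.subgroup_imp_normal[OF comm_group_H subgroup_B] .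
  hence "(#>\<^bsub>H\<^esub>) B \<in> hom H G" by (rule normal.r_coset_hom_Mod)
  moreover have "(#>\<^bsub>H\<^esub>) B = cls" using r_coset_eq by (intro ext)
  ultimately show ?thesis
    unfolding group_hom_def group_hom_axioms_def using group_H comm_group_G by (simp add: comm_group_def)
qed

lemma carrier_G: "carrier G = cls ` Z"
  by (auto simp: FactGroup_def RCOSETS_def r_coset_eq carrier_H)

lemma one_G: "\<one>\<^bsub>G\<^esub> = B"
  by (simp add: FactGroup_def)

lemma order_G: "Coset.order G = sub_index Z B"
  by (simp add: Coset.order_def carrier_G sub_index_def)

lemma finite_G: "sub_index Z B \<noteq> 0 \<Longrightarrow> finite (carrier G)"
  unfolding carrier_G sub_index_def by (meson card.infinite)

lemma cls_eq_one: "cls a = \<one>\<^bsub>G\<^esub> \<longleftrightarrow> a \<in> B"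
  using translate_eq_iff[OF B, of a 0] by (simp add: one_G image_def)

lemma trivial_G: "trivial_group G \<longleftrightarrow> Z \<subseteq> B"
proof -
  have "0 \<in> Z" by (rule add_subgroupD(1)[OF Z])
  have "(f ` Z = {y}) = (\<forall>z\<in>Z. f z = y)" for f :: "_ \<Rightarrow> ('i \<Rightarrow>\<^sub>0 int) set" and y
    using \<open>0 \<in> Z\<close> by (auto simp: image_iff intro: bexI[of _ 0])
  hence "cls ` Z = {\<one>\<^bsub>G\<^esub>} \<longleftrightarrow> (\<forall>z\<in>Z. cls z = \<one>\<^bsub>G\<^esub>)" .
  also have "\<dots> \<longleftrightarrow> Z \<subseteq> B" unfolding cls_eq_one by (simp only: subset_iff Ball_def)
  finally show ?thesis
    using comm_group_G by (simp add: trivial_group_def comm_group_def carrier_G)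
qed

lemma lin_comb_in_Z: "finite T \<Longrightarrow> T \<subseteq> Z \<Longrightarrow> lin_comb T (\<lambda>x. x) k \<in> Z"
proof (induction T rule: finite_induct)
  case (insert t T)
  have t: "t \<in> Z" using insert by simp
  have "frag_cmul (k t) t = t [^]\<^bsub>H\<^esub> (k t)" using int_pow_H[OF t] by simp
  also have "\<dots> \<in> Z" using group.int_pow_closed[OF group_H, of t] t carrier_H by simp
  finally have "frag_cmul (k t) t \<in> Z" .
  moreover have "lin_comb T (\<lambda>x. x) k \<in> Z" using insert by simp
  ultimately show ?case using insert.hyps add_subgroupD(4)[OF Z] by (simp add: lin_comb_def)
qed (simp add: lin_comb_def add_subgroupD[OF Z])

text \<open>Products of powers in the quotient are classes of linear combinations; this translates independence in
  the group into independence modulo \<open>B\<close>.\<close>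

lemma finprod_cls:
  assumes "finite T" "T \<subseteq> Z"
  shows "finprod G (\<lambda>t. cls t [^]\<^bsub>G\<^esub> (k t :: int)) T = cls (lin_comb T (\<lambda>x. x) k)"
  using assms
proof (induction T rule: finite_induct)
  case empty
  have "cls 0 = \<one>\<^bsub>G\<^esub>" using cls_eq_one[of 0] add_subgroupD(1)[OF B] by simp
  thus ?case using comm_monoid.finprod_empty[of G] comm_group_G by (simp add: comm_group_def lin_comb_def)
next
  case (insert t T)
  interpret cls: group_hom H G cls by (rule cls_group_hom)
  interpret G: comm_group G by (rule comm_group_G)
  have t: "t \<in> Z" and T: "T \<subseteq> Z" using insert by auto
  have mem: "cls u [^]\<^bsub>G\<^esub> (n::int) \<in> carrier G" if "u \<in> Z" for u n
    by (rule group.int_pow_closed[OF group_G]) (use that carrier_G in auto)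
  have "finprod G (\<lambda>t. cls t [^]\<^bsub>G\<^esub> k t) (insert t T)
      = cls t [^]\<^bsub>G\<^esub> k t \<otimes>\<^bsub>G\<^esub> finprod G (\<lambda>t. cls t [^]\<^bsub>G\<^esub> k t) T"
    by (rule G.finprod_insert) (use insert mem T in auto)
  also have "finprod G (\<lambda>t. cls t [^]\<^bsub>G\<^esub> k t) T = cls (lin_comb T (\<lambda>x. x) k)"
    using insert T by simp
  also have "cls t [^]\<^bsub>G\<^esub> k t = cls (frag_cmul (k t) t)"
    using cls.hom_int_pow[of t "k t"] t carrier_H int_pow_H[OF t] by simp
  also have "cls (frag_cmul (k t) t) \<otimes>\<^bsub>G\<^esub> cls (lin_comb T (\<lambda>x. x) k) = cls (frag_cmul (k t) t + lin_comb T (\<lambda>x. x) k)"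
  proof -
    have 1: "frag_cmul (k t) t \<in> carrier H"
      using group.int_pow_closed[OF group_H, of t "k t"] t carrier_H int_pow_H[OF t] by simp
    have 2: "lin_comb T (\<lambda>x. x) k \<in> carrier H" using lin_comb_in_Z[OF insert.hyps(1) T] carrier_H by simp
    show ?thesis using cls.hom_mult[OF 1 2] by simp
  qed
  also have "frag_cmul (k t) t + lin_comb T (\<lambda>x. x) k = lin_comb (insert t T) (\<lambda>x. x) k"
    using insert.hyps by (simp add: lin_comb_def)
  finally show ?case .
qed

lemma inj_on_cls: "independent_mod B T \<Longrightarrow> inj_on cls T"
proof (rule inj_onI, rule ccontr)
  fix t u assume T: "independent_mod B T" and tu: "t \<in> T" "u \<in> T" "cls t = cls u" "t \<noteq> u"
  have fin: "finite T" using T by (simp add: independent_mod_def)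
  have "lin_comb T (\<lambda>x. x) (\<lambda>x. if x = t then 1 else if x = u then -1 else 0)
      = (\<Sum>x\<in>T. (if x = t then t else 0) - (if x = u then u else 0))"
    unfolding lin_comb_def by (rule sum.cong) (use tu in auto)
  also have "\<dots> = t - u" using tu fin by (simp add: sum_subtractf sum.delta)
  also have "\<dots> \<in> B" using tu(3) translate_eq_iff[OF B] by simp
  finally have "(if t = t then 1 else if t = u then -1 else 0 :: int) = 0"
    using T tu(1) unfolding independent_mod_def by blast
  thus False by simp
qed

lemma int_independent_cls:
  assumes "T \<subseteq> Z" "inj_on cls T" "finite T"
  shows "int_independent G (cls ` T) \<longleftrightarrow> independent_mod B T"
proof -
  interpret G: comm_group G by (rule comm_group_G)
  have fp: "finprod G (\<lambda>s. s [^]\<^bsub>G\<^esub> (a s :: int)) (cls ` T) = cls (lin_comb T (\<lambda>x. x) (\<lambda>t. a (cls t)))" for a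
  proof -
    have "finprod G (\<lambda>s. s [^]\<^bsub>G\<^esub> a s) (cls ` T) = finprod G (\<lambda>t. cls t [^]\<^bsub>G\<^esub> a (cls t)) T"
    proof (rule G.finprod_reindex[OF _ assms(2)])
      show "(\<lambda>s. s [^]\<^bsub>G\<^esub> a s) \<in> cls ` T \<rightarrow> carrier G"
      proof
        fix s assume "s \<in> cls ` T"
        hence "s \<in> carrier G" using assms(1) carrier_G by blast
        thus "s [^]\<^bsub>G\<^esub> a s \<in> carrier G" by (rule group.int_pow_closed[OF group_G])
      qed
    qed
    thus ?thesis using finprod_cls[OF assms(3,1), of "\<lambda>t. a (cls t)"] by simp
  qed
  show ?thesis
  proof
    assume I: "int_independent G (cls ` T)"
    show "independent_mod B T" unfolding independent_mod_def
    proof (intro conjI allI impI ballI)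
      show "finite T" by fact
      fix k t assume k: "lin_comb T (\<lambda>x. x) k \<in> B" and t: "t \<in> T"
      define a where "a s = k (inv_into T cls s)" for s
      have a: "a (cls u) = k u" if "u \<in> T" for u
        unfolding a_def using inv_into_f_f[OF assms(2) that] by (rule arg_cong)
      have "lin_comb T (\<lambda>x. x) (\<lambda>t. a (cls t)) = lin_comb T (\<lambda>x. x) k"
        unfolding lin_comb_def by (rule sum.cong) (simp_all add: a)
      hence "finprod G (\<lambda>s. s [^]\<^bsub>G\<^esub> a s) (cls ` T) = \<one>\<^bsub>G\<^esub>"
        using fp[of a] k cls_eq_one by simp
      hence "a (cls t) = 0" using I t unfolding int_independent_def by blast
      thus "k t = 0" using a[OF t] by simp
    qed
  next
    assume I: "independent_mod B T"
    show "int_independent G (cls ` T)" unfolding int_independent_def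
    proof (intro conjI allI impI ballI)
      show "finite (cls ` T)" using assms by simp
      show "cls ` T \<subseteq> carrier G" using assms carrier_G by auto
      fix a s assume a: "finprod G (\<lambda>s. s [^]\<^bsub>G\<^esub> (a s :: int)) (cls ` T) = \<one>\<^bsub>G\<^esub>" and "s \<in> cls ` T"
      then obtain t where t: "t \<in> T" "s = cls t" by blast
      have "lin_comb T (\<lambda>x. x) (\<lambda>t. a (cls t)) \<in> B" using a fp[of a] cls_eq_one by simp
      thus "a s = 0" using I t unfolding independent_mod_def by blast
    qed
  qed
qed

lemma card_int_independent_sets:
  "{card S | S. int_independent G S} = {card T | T. T \<subseteq> Z \<and> independent_mod B T}"
proof
  show "{card T | T. T \<subseteq> Z \<and> independent_mod B T} \<subseteq> {card S | S. int_independent G S}"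
  proof
    fix n assume "n \<in> {card T | T. T \<subseteq> Z \<and> independent_mod B T}"
    then obtain T where T: "T \<subseteq> Z" "independent_mod B T" "n = card T" by blast
    have "int_independent G (cls ` T)"
      using int_independent_cls[OF T(1) inj_on_cls[OF T(2)]] T(2) by (simp add: independent_mod_def)
    moreover have "card (cls ` T) = n" using card_image[OF inj_on_cls[OF T(2)]] T(3) by simp
    ultimately show "n \<in> {card S | S. int_independent G S}" by blast
  qed
  show "{card S | S. int_independent G S} \<subseteq> {card T | T. T \<subseteq> Z \<and> independent_mod B T}"
  proof
    fix n assume "n \<in> {card S | S. int_independent G S}"
    then obtain A where A: "int_independent G A" "n = card A" by blast
    hence "A \<subseteq> cls ` Z" using carrier_G by (simp add: int_independent_def)
    then obtain T where T: "T \<subseteq> Z" "inj_on cls T" "A = cls ` T" by (meson subset_image_inj)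
    have "finite T" using A(1) T finite_imageD by (auto simp: int_independent_def)
    hence "independent_mod B T" using int_independent_cls[OF T(1,2)] A(1) T(3) by simp
    thus "n \<in> {card T | T. T \<subseteq> Z \<and> independent_mod B T}"
      using A(2) T card_image[OF T(2)] by auto
  qed
qed

text \<open>The rank is defined as a maximum, which is meaningful only because independent sets have bounded size.\<close>

lemma finite_card_independent:
  assumes "finite S" shows "finite {card T | T. T \<subseteq> Z \<and> independent_mod B T}"
proof (rule finite_subset)
  show "{card T | T. T \<subseteq> Z \<and> independent_mod B T} \<subseteq> {..card S}"
    using card_independent_chains[OF assms] ZS add_subgroupD(1)[OF B] by blast
qed simp

lemma abelian_rank_0_imp_torsion:
  assumes "finite S" "abelian_rank G = 0" "z \<in> Z"
  shows "\<exists>n. n \<noteq> 0 \<and> frag_cmul n z \<in> B"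
proof (rule ccontr)
  assume no: "\<not> ?thesis"
  have "independent_mod B {z}"
    unfolding independent_mod_def using no by (auto simp: lin_comb_def)
  hence "1 \<in> {card T | T. T \<subseteq> Z \<and> independent_mod B T}" using assms(3)
    by (intro CollectI exI[of _ "{z}"]) auto
  hence "1 \<le> abelian_rank G"
    unfolding abelian_rank_def card_int_independent_sets
    by (intro Max_ge finite_card_independent[OF assms(1)])
  thus False using assms(2) by simp
qed

end

text \<open>The group of cycles is the top homology of a complex, where no boundaries are divided out.\<close>

lemma (in boundary_map) abelian_rank_cycles:
  assumes "finite C" "basis_of C U"
  shows "abelian_rank (subgroup_generated (free_Abelian_group C) (cycles_on C) Mod {0}) = card C - card U"
proof -
  interpret lattice_quotient C "cycles_on C" "{0}"
    by standard (auto simp: add_subgroup_cycles zero_in_cycles, auto simp: add_subgroup_def cycles_on_def)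
  have card: "card (C - U) = card C - card U"
    using assms by (auto simp: basis_of_def intro: card_Diff_subset finite_subset)
  obtain T where T: "T \<subseteq> cycles_on C" "independent_mod {0} T" "card T = card (C - U)"
    by (rule independent_circuits[OF assms])
  have "abelian_rank G = card (C - U)"
    unfolding abelian_rank_def card_int_independent_sets
  proof (rule Max_eqI[OF finite_card_independent[OF assms(1)]])
    show "card (C - U) \<in> {card T | T. T \<subseteq> cycles_on C \<and> independent_mod {0} T}"
      using T by (intro CollectI exI[of _ T]) auto
    show "y \<le> card (C - U)" if "y \<in> {card T | T. T \<subseteq> cycles_on C \<and> independent_mod {0} T}" for y
      using that card_independent_cycles[OF assms] by blast
  qed
  thus ?thesis using card by simp
qed

section \<open>Cellular homology as a quotient of lattices\<close>

lemma boundary_map_cell_boundary: "boundary_map (cell_boundary K)"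
  by standard (simp_all add: cell_boundary_def frag_extend_diff frag_extend_cmul)

lemma carrier_chain_group: "carrier (chain_group K j) = chains_on (chain_basis K j)"
  by (auto simp: chain_group_def chains_on_def)

lemma cycles_eq: "cycles K j = boundary_map.cycles_on (cell_boundary K) (chain_basis K j)"
  by (auto simp: cycles_def boundary_map.cycles_on_def[OF boundary_map_cell_boundary] carrier_chain_group)

lemma boundaries_eq: "boundaries K j = boundary_map.boundaries_on (cell_boundary K) (chain_basis K (j + 1))"
  by (auto simp: boundaries_def boundary_map.boundaries_on_def[OF boundary_map_cell_boundary] carrier_chain_group)

lemma cells_on_cells [simp]: "cells (on_cells K Y) = Y" "cell_dim (on_cells K Y) = cell_dim K"
  "char_map (on_cells K Y) = char_map K"
  by (simp_all add: on_cells_def)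

text \<open>Incidence numbers refer only to the characteristic maps, so that a subcomplex inherits them.\<close>

lemma incidence_on_cells: "incidence (on_cells K Y) = incidence K"
  by (intro ext) (simp only: incidence_def collapse_onto_def[abs_def] open_cell_def cells_on_cells)

context finite_CW_complex begin

sublocale boundary_map "cell_boundary K"
  by (rule boundary_map_cell_boundary)

abbreviation C where "C \<equiv> chain_basis K"

lemma finite_k_cells: "finite (k_cells K j)"
  using finite_cells by (simp add: k_cells_def)

lemma finite_C: "finite (C j)"
  by (simp add: chain_basis_def finite_k_cells)

lemma C_nonneg: "j \<ge> 0 \<Longrightarrow> C j = Some ` k_cells K j"
  by (simp add: chain_basis_def)

lemma boundary_in_chains: "c \<in> chains_on (C j) \<Longrightarrow> cell_boundary K c \<in> chains_on (C (j - 1))"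
  using boundary_keys by (simp add: chains_on_def)

lemma boundaries_subset_cycles: "F \<subseteq> C j \<Longrightarrow> boundaries_on F \<subseteq> cycles_on (C (j - 1))"
proof
  fix x assume F: "F \<subseteq> C j" and "x \<in> boundaries_on F"
  then obtain c where c: "c \<in> chains_on F" "x = cell_boundary K c" by (auto simp: boundaries_on_def)
  hence "c \<in> chains_on (C j)" using chains_on_mono[OF F] by blast
  thus "x \<in> cycles_on (C (j - 1))"
    using c(2) boundary_in_chains boundary_boundary[of c j] by (simp add: cycles_on_def chains_on_def)
qed

lemma homology_quotient:
  assumes "F \<subseteq> C (j + 1)" shows "lattice_quotient (C j) (cycles_on (C j)) (boundaries_on F)"
  using boundaries_subset_cycles[OF assms]
  by (intro lattice_quotient.intro add_subgroup_cycles add_subgroup_boundaries) (auto simp: cycles_on_def)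

lemma red_homology_eq:
  "red_homology K j = subgroup_generated (free_Abelian_group (C j)) (cycles_on (C j)) Mod boundaries_on (C (j + 1))"
  by (simp add: red_homology_def chain_group_def cycles_eq boundaries_eq)

lemma hom_order_eq: "hom_order K j = sub_index (cycles_on (C j)) (boundaries_on (C (j + 1)))"
  unfolding red_homology_eq by (rule lattice_quotient.order_G[OF homology_quotient[OF order_refl]])

lemma torsion_step_level:
  assumes "red_betti K (j - 1) = 0"
  shows "torsion_step (cell_boundary K) (C j) (C (j - 1))"
proof
  interpret Q: lattice_quotient "C (j - 1)" "cycles_on (C (j - 1))" "boundaries_on (C j)"
    using homology_quotient[of "C j" "j - 1"] by simp
  show "\<exists>n. n \<noteq> 0 \<and> frag_cmul n z \<in> boundaries_on (C j)" if "z \<in> cycles_on (C (j - 1))" for z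
  proof (rule Q.abelian_rank_0_imp_torsion[OF finite_C _ that])
    show "abelian_rank Q.G = 0" using assms by (simp add: red_betti_def red_homology_eq)
  qed
qed (simp_all add: finite_C boundaries_subset_cycles)

section \<open>Subcomplexes between two consecutive skeleta\<close>

definition top_cells :: "'c set \<Rightarrow> int \<Rightarrow> 'c set" where
  "top_cells Y k = {c \<in> Y. int (dm c) = k}"

lemma k_cells_on_cells: "k_cells (on_cells K Y) k = top_cells Y k"
  by (simp add: k_cells_def top_cells_def)

context
  fixes Y :: "'c set" and k :: int
  assumes k: "k \<ge> 0" and lower: "skeleton_cells K (k - 1) \<subseteq> Y" and upper: "Y \<subseteq> skeleton_cells K k"
begin

lemma chain_basis_on_cells:
  "j < k \<Longrightarrow> chain_basis (on_cells K Y) j = C j"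
  "chain_basis (on_cells K Y) k = Some ` top_cells Y k"
  "chain_basis (on_cells K Y) (k + 1) = {}"
proof -
  show "chain_basis (on_cells K Y) k = Some ` top_cells Y k"
    using k by (simp add: chain_basis_def k_cells_on_cells)
  have "k_cells (on_cells K Y) j = k_cells K j" if "j < k"
    using that lower upper by (auto simp: k_cells_def skeleton_cells_def)
  thus "chain_basis (on_cells K Y) j = C j" if "j < k" using that by (simp add: chain_basis_def)
  have "k_cells (on_cells K Y) (k + 1) = {}"
    using upper by (auto simp: k_cells_def skeleton_cells_def)
  thus "chain_basis (on_cells K Y) (k + 1) = {}" using k by (simp add: chain_basis_def)
qed

lemma top_cells_subset: "top_cells Y k \<subseteq> k_cells K k"
  using upper by (auto simp: top_cells_def k_cells_def skeleton_cells_def)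

lemma top_basis_subset: "Some ` top_cells Y k \<subseteq> C k"
  using top_cells_subset k by (auto simp: C_nonneg)

text \<open>The boundary in the subcomplex sums over the cells of \<open>Y\<close> only, but these include all cells of
  dimension below \<open>k\<close>.\<close>

lemma cell_boundary_on_cells:
  assumes "j \<le> k" "c \<in> chains_on (chain_basis (on_cells K Y) j)"
  shows "cell_boundary (on_cells K Y) c = cell_boundary K c"
  unfolding cell_boundary_def
proof (rule frag_extend_eq)
  fix x assume "x \<in> Poly_Mapping.keys c"
  hence x: "x \<in> chain_basis (on_cells K Y) j" using assms by (auto simp: chains_on_def)
  show "basis_boundary (on_cells K Y) x = basis_boundary K x"
  proof (cases x)
    case (Some f)
    hence "int (dm f) = j" using x by (auto simp: chain_basis_def k_cells_def split: if_splits)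
    hence "k_cells (on_cells K Y) (int (dm f) - 1) = k_cells K (int (dm f) - 1)"
      using assms lower upper by (auto simp: k_cells_def skeleton_cells_def)
    thus ?thesis by (simp add: Some incidence_on_cells)
  qed simp
qed

lemma red_homology_on_cells_top:
  "red_homology (on_cells K Y) k = subgroup_generated (free_Abelian_group (Some ` top_cells Y k))
     (cycles_on (Some ` top_cells Y k)) Mod {0}"
proof -
  let ?B = "chain_basis (on_cells K Y)"
  have "cycles (on_cells K Y) k = cycles_on (Some ` top_cells Y k)"
    unfolding cycles_def carrier_chain_group cycles_on_def
    using cell_boundary_on_cells[of k] by (auto simp: chain_basis_on_cells)
  moreover have "boundaries (on_cells K Y) k = {0}"
    unfolding boundaries_def carrier_chain_group chain_basis_on_cells
    by (auto simp: chains_on_def cell_boundary_def)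
  ultimately show ?thesis by (simp add: red_homology_def chain_group_def chain_basis_on_cells)
qed

lemma red_homology_on_cells_below:
  "red_homology (on_cells K Y) (k - 1) = subgroup_generated (free_Abelian_group (C (k - 1)))
     (cycles_on (C (k - 1))) Mod boundaries_on (Some ` top_cells Y k)"
proof -
  have "cycles (on_cells K Y) (k - 1) = cycles_on (C (k - 1))"
    unfolding cycles_def carrier_chain_group cycles_on_def
    using cell_boundary_on_cells[of "k - 1"] by (auto simp: chain_basis_on_cells)
  moreover have "boundaries (on_cells K Y) (k - 1) = boundaries_on (Some ` top_cells Y k)"
    unfolding boundaries_def carrier_chain_group boundaries_on_def
    using cell_boundary_on_cells[of k] by (auto simp: chain_basis_on_cells)
  ultimately show ?thesis by (simp add: red_homology_def chain_group_def chain_basis_on_cells)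
qed

lemma hom_order_on_cells:
  "hom_order (on_cells K Y) (k - 1) = sub_index (cycles_on (C (k - 1))) (boundaries_on (Some ` top_cells Y k))"
  unfolding red_homology_on_cells_below
  by (rule lattice_quotient.order_G[OF homology_quotient]) (use top_basis_subset in simp)

lemma subcomplex_between: "subcomplex K Y"
  unfolding subcomplex_def
proof (intro conjI ballI)
  show "Y \<subseteq> cells K" using upper by (auto simp: skeleton_cells_def)
  fix c assume c: "c \<in> Y"
  hence cK: "c \<in> cells K" "int (dm c) \<le> k" using upper by (auto simp: skeleton_cells_def)
  have "cells_below (dm c) \<subseteq> Y" using cK lower by (auto simp: skeleton_cells_def)
  hence "\<Phi> c ` disc_sphere (dm c) \<subseteq> cell_union K Y" by (rule char_map_sphere_downward[OF cK(1)])
  thus "\<Phi> c ` closed_disc (dm c) \<subseteq> (\<Union>b\<in>Y. open_cell K b)"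
    using c by (auto simp: closed_disc_eq cell_union_def open_cell_def)
qed

end

section \<open>Spanning trees as bases of the cellular matroid\<close>

lemma skeleton_betti:
  assumes "k \<ge> 0" "basis_of (C k) V"
  shows "red_betti (on_cells K (skeleton_cells K k)) k = card (C k) - card V"
    and "red_betti (on_cells K (skeleton_cells K k)) (k - 1) = red_betti K (k - 1)"
proof -
  have low: "skeleton_cells K (k - 1) \<subseteq> skeleton_cells K k" by (auto simp: skeleton_cells_def)
  have "top_cells (skeleton_cells K k) k = k_cells K k" by (auto simp: top_cells_def skeleton_cells_def k_cells_def)
  hence top: "Some ` top_cells (skeleton_cells K k) k = C k" using assms(1) by (simp add: C_nonneg)
  show "red_betti (on_cells K (skeleton_cells K k)) k = card (C k) - card V"
    unfolding red_betti_def red_homology_on_cells_top[OF assms(1) low order_refl] top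
    by (rule abelian_rank_cycles[OF finite_C assms(2)])
  show "red_betti (on_cells K (skeleton_cells K k)) (k - 1) = red_betti K (k - 1)"
    unfolding red_betti_def red_homology_on_cells_below[OF assms(1) low order_refl] top red_homology_eq by simp
qed

text \<open>The conditions on homology and on the number of cells amount to a single one on the set of top cells.
  Vanishing of the top homology is acyclicity; the prescribed number of cells is the size of a basis,
  because the top Betti number of the skeleton is the corank; and finiteness of the homology below holds
  automatically for a basis.\<close>

lemma spanning_tree_iff:
  assumes betti: "red_betti K (int k - 1) = 0"
  shows "Y \<in> spanning_trees K k \<longleftrightarrow> skeleton_cells K (int k - 1) \<subseteq> Y \<and> Y \<subseteq> skeleton_cells K (int k) \<and>
     basis_of (C (int k)) (Some ` top_cells Y (int k))"
proof -
  let ?k = "int k"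
  interpret L: torsion_step "cell_boundary K" "C ?k" "C (?k - 1)"
    by (rule torsion_step_level[OF betti])
  obtain V where V: "basis_of (C ?k) V" "{} \<subseteq> V"
    by (rule basis_exists[OF finite_C _ acyclic_on_empty]) auto
  have cardV: "card V \<le> card (C ?k)" using V(1) finite_C by (auto simp: basis_of_def intro: card_mono)
  have cardC: "card (C ?k) = card (k_cells K ?k)" by (simp add: C_nonneg card_image)
  have skel: "skeleton_cells (on_cells K Y) (?k - 1) = skeleton_cells K (?k - 1) \<longleftrightarrow> skeleton_cells K (?k - 1) \<subseteq> Y"
    if "Y \<subseteq> skeleton_cells K ?k" using that by (auto simp: skeleton_cells_def)
  show ?thesis
  proof (cases "skeleton_cells K (?k - 1) \<subseteq> Y \<and> Y \<subseteq> skeleton_cells K ?k")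
    case False
    thus ?thesis using skel unfolding spanning_trees_def by blast
  next
    case True
    hence Y: "skeleton_cells K (?k - 1) \<subseteq> Y" "Y \<subseteq> skeleton_cells K ?k" by auto
    let ?F = "Some ` top_cells Y ?k"
    have FC: "?F \<subseteq> C ?k" by (rule top_basis_subset[OF _ Y]) simp
    have "lattice_quotient ?F (cycles_on ?F) {0}"
      by standard (auto simp: add_subgroup_cycles zero_in_cycles, auto simp: add_subgroup_def cycles_on_def)
    from lattice_quotient.trivial_G[OF this]
    have triv: "trivial_group (red_homology (on_cells K Y) ?k) \<longleftrightarrow> acyclic_on ?F"
      using red_homology_on_cells_top[OF _ Y] zero_in_cycles[of ?F] by (auto simp: acyclic_on_def)
    have fin: "finite (carrier (red_homology (on_cells K Y) (?k - 1)))" if "basis_of (C ?k) ?F"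
      using lattice_quotient.finite_G[OF homology_quotient[of ?F "?k - 1"]] FC
        L.sub_index_cycles_boundaries_nonzero[OF that] red_homology_on_cells_below[OF _ Y] by simp
    have cardF: "card ?F = card (k_cells (on_cells K Y) ?k)" by (simp add: card_image k_cells_on_cells)
    have card: "int (card (k_cells (on_cells K Y) ?k)) =
       int (card (k_cells K ?k)) - int (red_betti (on_cells K (skeleton_cells K ?k)) ?k)
         + int (red_betti (on_cells K (skeleton_cells K ?k)) (?k - 1)) \<longleftrightarrow> card ?F = card V"
      using cardV cardC cardF skeleton_betti[OF _ V(1)] betti by auto
    have "Y \<in> spanning_trees K k \<longleftrightarrow> acyclic_on ?F \<and> finite (carrier (red_homology (on_cells K Y) (?k - 1)))
        \<and> card ?F = card V"
      unfolding spanning_trees_def mem_Collect_eq triv card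
      using subcomplex_between[OF _ Y] Y skel[OF Y(2)] by simp
    also have "\<dots> \<longleftrightarrow> basis_of (C ?k) ?F"
      using basis_of_iff_card[OF finite_C V(1), of ?F] FC fin by blast
    finally show ?thesis using Y by simp
  qed
qed

text \<open>A spanning tree is determined by its top cells. The function \<open>g\<close> receives both, so that the sum also
  covers weights of the top cells.\<close>

lemma sum_spanning_trees:
  assumes betti: "red_betti K (int k - 1) = 0"
  shows "(\<Sum>Y\<in>spanning_trees K k. g Y (k_cells (on_cells K Y) (int k)))
     = (\<Sum>F | F \<subseteq> k_cells K (int k) \<and> basis_of (C (int k)) (Some ` F). g (skeleton_cells K (int k - 1) \<union> F) F)"
proof (rule sum.reindex_bij_witness[where i = "\<lambda>F. skeleton_cells K (int k - 1) \<union> F" and j = "\<lambda>Y. top_cells Y (int k)"])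
  let ?s = "skeleton_cells K (int k - 1)"
  fix Y assume "Y \<in> spanning_trees K k"
  hence Y: "?s \<subseteq> Y" "Y \<subseteq> skeleton_cells K (int k)" "basis_of (C (int k)) (Some ` top_cells Y (int k))"
    using spanning_tree_iff[OF betti] by auto
  show eq: "?s \<union> top_cells Y (int k) = Y"
    using Y(1,2) by (auto simp: top_cells_def skeleton_cells_def)
  show "top_cells Y (int k) \<in> {F. F \<subseteq> k_cells K (int k) \<and> basis_of (C (int k)) (Some ` F)}"
    using Y top_cells_subset[OF _ Y(1,2)] by simp
  show "g (?s \<union> top_cells Y (int k)) (top_cells Y (int k)) = g Y (k_cells (on_cells K Y) (int k))"
    unfolding eq by (simp add: k_cells_on_cells)
next
  let ?s = "skeleton_cells K (int k - 1)"
  fix F assume F: "F \<in> {F. F \<subseteq> k_cells K (int k) \<and> basis_of (C (int k)) (Some ` F)}"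
  show top: "top_cells (?s \<union> F) (int k) = F"
    using F by (auto simp: top_cells_def k_cells_def skeleton_cells_def)
  have "?s \<union> F \<subseteq> skeleton_cells K (int k)" using F by (auto simp: k_cells_def skeleton_cells_def)
  thus "?s \<union> F \<in> spanning_trees K k"
    unfolding spanning_tree_iff[OF betti] top using F by simp
qed

lemma hom_order_tree:
  assumes "F \<subseteq> k_cells K (int k)"
  shows "hom_order (on_cells K (skeleton_cells K (int k - 1) \<union> F)) (int k - 1)
    = sub_index (cycles_on (C (int k - 1))) (boundaries_on (Some ` F))"
proof -
  have "top_cells (skeleton_cells K (int k - 1) \<union> F) (int k) = F"
    using assms by (auto simp: top_cells_def k_cells_def skeleton_cells_def)
  moreover have "skeleton_cells K (int k - 1) \<union> F \<subseteq> skeleton_cells K (int k)"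
    using assms by (auto simp: k_cells_def skeleton_cells_def)
  ultimately show ?thesis
    using hom_order_on_cells[of "int k" "skeleton_cells K (int k - 1) \<union> F"] by simp
qed

end

section \<open>Characteristic polynomials and nonzero eigenvalues\<close>

text \<open>Over an algebraically closed field the characteristic polynomial is a power of the variable times the
  product of the factors for the nonzero eigenvalues. The lowest nonvanishing coefficient locates that
  power, and its value is the constant term of the other factor.\<close>

lemma prod_nonzero_eigenvalues_eq_coeff:
  fixes A :: "'k::alg_closed_field mat"
  assumes A: "A \<in> carrier_mat n n"
    and low: "\<And>i. i < m \<Longrightarrow> Polynomial.coeff (char_poly A) i = 0" and c: "Polynomial.coeff (char_poly A) m \<noteq> 0"
  shows "prod_nonzero_eigenvalues A = (-1) ^ (n - m) * Polynomial.coeff (char_poly A) m"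
proof -
  define q where "q = char_poly A"
  have q: "Polynomial.degree q = n" "Polynomial.lead_coeff q = 1"
    using degree_monic_char_poly[OF A] by (simp_all add: q_def)
  hence "q \<noteq> 0" by auto
  then obtain M where M: "size M = Polynomial.degree q"
    "q = Polynomial.smult (Polynomial.lead_coeff q) (\<Prod>x\<in>#M. [:- x, 1:])"
    using alg_closed_imp_factorization by blast
  have qM: "q = (\<Prod>x\<in>#M. [:- x, 1:])" using M(2) q(2) by simp
  define N where "N = filter_mset (\<lambda>x. x \<noteq> 0) M"
  define k where "k = count M 0"
  define P where "P = (\<Prod>x\<in>#N. [:- x, 1:])"
  have MN: "M = N + replicate_mset k 0"
    by (rule multiset_eqI) (simp add: N_def k_def)
  have "(\<Prod>x\<in>#replicate_mset k (0::'k). [:- x, 1:]) = [:0, 1:] ^ k" by simp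
  hence qP: "q = Polynomial.monom 1 k * P"
    unfolding qM P_def by (subst MN) (simp add: monom_altdef mult.commute)
  have P0: "Polynomial.coeff P 0 = (-1) ^ size N * prod_mset N"
    unfolding P_def poly_0_coeff_0[symmetric] by (induction N) (simp_all add: algebra_simps)
  have "0 \<notin># N" by (simp add: N_def)
  hence P0_nz: "Polynomial.coeff P 0 \<noteq> 0" unfolding P0 by simp
  have coeff_q: "Polynomial.coeff q i = (if i < k then 0 else Polynomial.coeff P (i - k))" for i
    unfolding qP by (simp add: coeff_monom_mult)
  have "k = m"
  proof (rule antisym)
    show "k \<le> m" using c coeff_q[of m] unfolding q_def by (auto split: if_splits simp: not_less)
    show "m \<le> k"
    proof (rule ccontr)
      assume "\<not> m \<le> k"
      hence "Polynomial.coeff q k = 0" using low[of k] by (simp add: q_def)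
      thus False using coeff_q[of k] P0_nz by simp
    qed
  qed
  have size: "size N = n - m"
    using M(1) q(1) \<open>k = m\<close> by (subst (asm) MN) simp
  have "proots q = M"
  proof -
    have "proots q = \<Sum>\<^sub># (image_mset proots (image_mset (\<lambda>x. [:- x, 1:]) M))"
    proof -
      have "(0 :: 'k poly) \<notin># image_mset (\<lambda>x. [:- x, 1:]) M" by auto
      from proots_prod_mset[OF this] show ?thesis unfolding qM by simp
    qed
    also have "\<dots> = M" by (induction M) (simp_all add: proots_linear_factor)
    finally show ?thesis .
  qed
  hence ord: "Polynomial.order a q = count M a" for a using count_proots[OF \<open>q \<noteq> 0\<close>, of a] by simp
  have "{a. eigenvalue A a \<and> a \<noteq> 0} = set_mset N"
  proof -
    have "{a. eigenvalue A a} = {a. poly q a = 0}" using eigenvalue_root_char_poly[OF A] by (simp add: q_def)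
    also have "\<dots> = set_mset M" using set_count_proots[OF \<open>q \<noteq> 0\<close>] \<open>proots q = M\<close> by simp
    finally show ?thesis by (auto simp: N_def)
  qed
  hence "prod_nonzero_eigenvalues A = (\<Prod>a\<in>set_mset N. a ^ count M a)"
    by (simp add: prod_nonzero_eigenvalues_def ord flip: q_def)
  also have "\<dots> = (\<Prod>a\<in>set_mset N. a ^ count N a)"
    by (rule prod.cong) (auto simp: N_def)
  also have "\<dots> = prod_mset N" by (simp add: prod_mset_multiplicity)
  finally have "prod_nonzero_eigenvalues A = prod_mset N" .
  moreover have "Polynomial.coeff q m = (-1) ^ (n - m) * prod_mset N"
    using coeff_q[of m] \<open>k = m\<close> P0 size by simp
  moreover have "(-1) ^ (n - m) * ((-1) ^ (n - m) * x) = x" for x :: 'k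
    by (simp add: mult.assoc[symmetric] flip: power_mult_distrib)
  ultimately show ?thesis unfolding q_def by simp
qed

lemma det_on_hom:
  fixes S :: "'i set"
  assumes "comm_ring_hom h"
  shows "det_on S (\<lambda>s t. h (M s t)) = h (det_on S M)"
proof -
  interpret comm_ring_hom h by fact
  have "h (of_int (sign p)) = of_int (sign p)" for p :: "'i \<Rightarrow> 'i"
    by (simp add: sign_def hom_uminus)
  thus ?thesis by (simp add: det_on_def hom_sum hom_mult hom_prod)
qed

lemma det_on_uminus:
  "det_on S (\<lambda>s t. - M s t) = (-1) ^ card S * det_on S M"
  by (simp add: det_on_def prod_uminus sum_distrib_left mult_ac)

lemma det_on_scale_columns:
  assumes "finite S"
  shows "det_on S (\<lambda>s t. M s t * c t) = det_on S M * (\<Prod>t\<in>S. c t)"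
proof -
  have "(\<Prod>i\<in>S. M i (p i) * c (p i)) = (\<Prod>i\<in>S. M i (p i)) * (\<Prod>t\<in>S. c t)" if "p permutes S" for p
    using prod.permute[OF that, of c] by (simp add: prod.distrib o_def)
  hence "of_int (sign p) * (\<Prod>i\<in>S. M i (p i) * c (p i))
      = of_int (sign p) * (\<Prod>i\<in>S. M i (p i)) * (\<Prod>t\<in>S. c t)" if "p \<in> {p. p permutes S}" for p
    using that by (simp add: mult.assoc)
  thus ?thesis unfolding det_on_def sum_distrib_right by (intro sum.cong refl)
qed

lemma det_on_reindex:
  assumes "finite S" "bij_betw h S S'"
  shows "det_on S' M = det_on S (\<lambda>i j. M (h i) (h j))"
proof -
  obtain e where e: "bij_betw e {0..<card S} S" using obtain_enumeration[OF assms(1)] .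
  have "bij_betw (h \<circ> e) {0..<card S} S'" using e assms(2) by (rule bij_betw_trans)
  from det_on_enumerate[OF this, of M] det_on_enumerate[OF e, of "\<lambda>i j. M (h i) (h j)"]
  show ?thesis by simp
qed

text \<open>Expand \<open>det (x I - M)\<close> along the diagonal: \<open>U\<close> is the set of rows in which \<open>x\<close> is chosen.\<close>

lemma coeff_char_poly_square_matrix:
  fixes M :: "'c::linorder \<Rightarrow> 'c \<Rightarrow> 'k::field"
  assumes "finite I"
  shows "Polynomial.coeff (char_poly (square_matrix I M)) m =
    (\<Sum>U | U \<subseteq> I \<and> card U = m. (-1) ^ (card I - m) * det_on (I - U) M)"
proof -
  let ?n = "card I" and ?e = "\<lambda>i. sorted_list_of_set I ! i"
  have e: "bij_betw ?e {0..<?n} I" using assms by (intro bij_betw_nth) auto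
  let ?N = "\<lambda>s t. (if s = t then [:0, 1:] else 0) + (- [:M s t:])"
  have "char_poly_matrix (square_matrix I M) = mat ?n ?n (\<lambda>(i, j). ?N (?e i) (?e j))"
  proof (rule eq_matI)
    fix i j assume "i < dim_row (mat ?n ?n (\<lambda>(i, j). ?N (?e i) (?e j)))" "j < dim_col (mat ?n ?n (\<lambda>(i, j). ?N (?e i) (?e j)))"
    hence ij: "i < ?n" "j < ?n" by auto
    have "?e i = ?e j \<longleftrightarrow> i = j" using e ij by (auto simp: bij_betw_def inj_on_def)
    thus "char_poly_matrix (square_matrix I M) $$ (i, j) = mat ?n ?n (\<lambda>(i, j). ?N (?e i) (?e j)) $$ (i, j)"
      using ij by (simp add: char_poly_matrix_def square_matrix_def)
  qed (simp_all add: char_poly_matrix_def square_matrix_def)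
  hence "char_poly (square_matrix I M) = det_on I ?N"
    unfolding char_poly_def det_on_enumerate[OF e] by simp
  also have "\<dots> = (\<Sum>U\<in>Pow I. [:0, 1:] ^ card U * det_on (I - U) (\<lambda>s t. - [:M s t:]))"
    by (rule det_on_add_diagonal[OF assms])
  also have "\<dots> = (\<Sum>U\<in>Pow I. Polynomial.monom ((-1) ^ (?n - card U) * det_on (I - U) M) (card U))"
  proof (rule sum.cong[OF refl])
    fix U assume "U \<in> Pow I"
    hence U: "U \<subseteq> I" by simp
    have "comm_ring_hom (\<lambda>x::'k. [:x:])" by standard (simp_all)
    from det_on_hom[OF this] have "det_on (I - U) (\<lambda>s t. [:M s t:]) = [:det_on (I - U) M:]" .
    moreover have "card (I - U) = ?n - card U" using U assms by (meson card_Diff_subset finite_subset)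
    moreover have "(-1) ^ k = [:(-1) ^ k :: 'k:]" for k
      by (induction k) (simp_all add: one_pCons)
    ultimately have "det_on (I - U) (\<lambda>s t. - [:M s t:]) = [:(-1) ^ (?n - card U) * det_on (I - U) M:]"
      unfolding det_on_uminus by simp
    thus "[:0, 1:] ^ card U * det_on (I - U) (\<lambda>s t. - [:M s t:])
        = Polynomial.monom ((-1) ^ (?n - card U) * det_on (I - U) M) (card U)"
      by (simp add: monom_altdef)
  qed
  finally have "Polynomial.coeff (char_poly (square_matrix I M)) m
     = (\<Sum>U\<in>Pow I. if card U = m then (-1) ^ (?n - m) * det_on (I - U) M else 0)"
    by (simp add: coeff_sum) (rule sum.cong, auto)
  also have "\<dots> = (\<Sum>U | U \<subseteq> I \<and> card U = m. (-1) ^ (?n - m) * det_on (I - U) M)"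
    using assms by (subst sum.inter_filter[symmetric]) (auto intro!: sum.cong)
  finally show ?thesis .
qed

section \<open>Nonvanishing in the field of rational functions\<close>

lemma of_nat_ratfun_eq_0_iff: "(of_nat n :: ('c::linorder) ratfun) = 0 \<longleftrightarrow> n = 0"
proof -
  have "to_fract (of_nat k :: ('c \<Rightarrow>\<^sub>0 nat) \<Rightarrow>\<^sub>0 int) = of_nat k" for k
    by (induction k) (simp_all add: to_fract_add)
  hence "(of_nat n :: 'c ratfun) = 0 \<longleftrightarrow> (of_nat n :: ('c \<Rightarrow>\<^sub>0 nat) \<Rightarrow>\<^sub>0 int) = 0"
    by (metis to_fract_eq_0_iff)
  also have "\<dots> \<longleftrightarrow> n = 0"
    by (metis (mono_tags, lifting) lookup_of_nat lookup_zero of_nat_0 of_nat_eq_0_iff when_simps(1))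
  finally show ?thesis .
qed

text \<open>Distinct sets give distinct monomials, so that the coefficient of the monomial of \<open>F0\<close> is \<open>a F0\<close>.\<close>

lemma sum_square_monomials_nonzero:
  fixes a :: "'c::linorder set \<Rightarrow> nat"
  assumes "finite \<F>" "\<And>F. F \<in> \<F> \<Longrightarrow> finite F" "F0 \<in> \<F>" "a F0 \<noteq> 0"
  shows "(\<Sum>F\<in>\<F>. of_nat (a F) * (\<Prod>f\<in>F. (indet f)\<^sup>2) :: 'c ratfun) \<noteq> 0"
proof
  let ?e = "\<lambda>F. \<Sum>f\<in>F. Poly_Mapping.single f (2::nat)"
  have e: "Poly_Mapping.lookup (?e F) f = (if f \<in> F then 2 else 0)" if "finite F" for F :: "'c set" and f
    using that by (simp add: lookup_sum lookup_single when_def sum.delta)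
  have nat: "to_fract (of_nat k :: ('c \<Rightarrow>\<^sub>0 nat) \<Rightarrow>\<^sub>0 int) = of_nat k" for k
    by (induction k) (simp_all add: to_fract_add)
  have mono: "(\<Prod>f\<in>F. (indet f)\<^sup>2) = to_fract (Poly_Mapping.single (?e F) 1)" if "finite F" for F :: "'c set"
    using that
  proof (induction F rule: finite_induct)
    case (insert f F)
    have "(indet f)\<^sup>2 = to_fract (Poly_Mapping.single (Poly_Mapping.single f 2) 1)"
      by (simp add: indet_def power2_eq_square to_fract_def mult_single flip: single_add)
        (simp add: numeral_2_eq_2)
    thus ?case using insert by (simp add: mult_single flip: to_fract_mult)
  qed simp
  define P where "P = (\<Sum>F\<in>\<F>. of_nat (a F) * Poly_Mapping.single (?e F) (1::int))"
  assume "(\<Sum>F\<in>\<F>. of_nat (a F) * (\<Prod>f\<in>F. (indet f)\<^sup>2) :: 'c ratfun) = 0"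
  also have "(\<Sum>F\<in>\<F>. of_nat (a F) * (\<Prod>f\<in>F. (indet f)\<^sup>2) :: 'c ratfun) = to_fract P"
    unfolding P_def to_fract_sum
    by (rule sum.cong) (simp_all add: to_fract_mult nat mono assms(2))
  finally have "P = 0" by simp
  moreover have "Poly_Mapping.lookup P (?e F0) = (\<Sum>F\<in>\<F>. if F = F0 then int (a F0) else 0)"
    unfolding P_def lookup_sum
  proof (rule sum.cong[OF refl])
    fix F assume F: "F \<in> \<F>"
    have "?e F = ?e F0 \<longleftrightarrow> F = F0"
    proof
      assume "?e F = ?e F0"
      hence "f \<in> F \<longleftrightarrow> f \<in> F0" for f
        using e[OF assms(2)[OF F], of f] e[OF assms(2)[OF assms(3)], of f] by (metis zero_neq_numeral)
      thus "F = F0" by blast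
    qed simp
    moreover have "of_nat k * Poly_Mapping.single x (1::int) = Poly_Mapping.single x (int k)" for k and x :: "'c \<Rightarrow>\<^sub>0 nat"
      by (induction k) (simp_all add: algebra_simps single_add)
    ultimately show "Poly_Mapping.lookup (of_nat (a F) * Poly_Mapping.single (?e F) 1) (?e F0)
        = (if F = F0 then int (a F0) else 0)"
      by (simp add: lookup_single when_def)
  qed
  ultimately show False using assms by (simp add: sum.delta)
qed

section \<open>The weighted Laplacian\<close>

lemma card_image_Some: "card (Some ` S) = card S"
  by (simp add: card_image)

lemma (in finite_CW_complex) incidence_det_cells:
  assumes "d \<ge> 1" "S \<subseteq> k_cells K (int d - 1)" "F \<subseteq> k_cells K (int d)" "bij_betw \<gamma> S F"
  shows "incidence_det (Some ` S) (\<lambda>x. Some (\<gamma> (the x))) = det_on S (\<lambda>s t. incidence K s (\<gamma> t))"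
proof -
  have fin: "finite S" using assms finite_k_cells finite_subset by blast
  have b: "bij_betw Some S (Some ` S)" by (simp add: bij_betw_def)
  have "Poly_Mapping.lookup (cell_boundary K (frag_of (Some (\<gamma> t)))) (Some s) = incidence K s (\<gamma> t)"
    if "s \<in> S" "t \<in> S" for s t
  proof -
    have "\<gamma> t \<in> k_cells K (int d)" using assms that by (auto simp: bij_betw_def)
    hence dim: "int (dm (\<gamma> t)) = int d" by (simp add: k_cells_def)
    hence "cell_boundary K (frag_of (Some (\<gamma> t)))
        = (\<Sum>s\<in>k_cells K (int d - 1). frag_cmul (incidence K s (\<gamma> t)) (frag_of (Some s)))"
      using assms(1) by (simp add: cell_boundary_def)
    hence "Poly_Mapping.lookup (cell_boundary K (frag_of (Some (\<gamma> t)))) (Some s)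
        = (\<Sum>u\<in>k_cells K (int d - 1). if u = s then incidence K s (\<gamma> t) else 0)"
      by (simp only: lookup_sum) (rule sum.cong, auto)
    thus ?thesis using assms(2) that finite_k_cells by (auto simp: sum.delta)
  qed
  thus ?thesis
    unfolding incidence_det_def det_on_reindex[OF fin b] by (intro det_on_cong) simp
qed

lemma det_weighted_boundary:
  fixes K :: "('a, 'c::linorder) cell_structure"
  assumes "finite S" "bij_betw \<gamma> S F"
  shows "det_on S (\<lambda>s t. weighted_boundary K s (\<gamma> t))
     = of_int (det_on S (\<lambda>s t. incidence K s (\<gamma> t))) * (\<Prod>f\<in>F. indet f)"
proof -
  have "det_on S (\<lambda>s t. weighted_boundary K s (\<gamma> t))
      = det_on S (\<lambda>s t. of_int (incidence K s (\<gamma> t))) * (\<Prod>t\<in>S. indet (\<gamma> t))"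
    unfolding weighted_boundary_def by (rule det_on_scale_columns[OF assms(1)])
  moreover have "(\<Prod>t\<in>S. indet (\<gamma> t)) = (\<Prod>f\<in>F. indet f)"
    by (rule prod.reindex_bij_betw[OF assms(2)])
  moreover have "comm_ring_hom (of_int :: int \<Rightarrow> 'c ratfun)"
    by standard
  note det_on_hom[OF this, of S "\<lambda>s t. incidence K s (\<gamma> t)"]
  ultimately show ?thesis by (simp only:)
qed

text \<open>Cauchy--Binet, with the weights extracted from the columns.\<close>

lemma det_weighted_laplacian:
  assumes "finite S" "finite (k_cells K (int d))"
    and \<gamma>: "\<And>F. F \<subseteq> k_cells K (int d) \<Longrightarrow> card F = card S \<Longrightarrow> bij_betw (\<gamma> F) S F"
  shows "det_on S (weighted_laplacian K d) = (\<Sum>F | F \<subseteq> k_cells K (int d) \<and> card F = card S.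
     of_int ((det_on S (\<lambda>s t. incidence K s (\<gamma> F t)))\<^sup>2) * (\<Prod>f\<in>F. (indet f)\<^sup>2))"
proof -
  have "det_on S (weighted_laplacian K d)
      = det_on S (\<lambda>s t. \<Sum>f\<in>k_cells K (int d). weighted_boundary K s f * weighted_boundary K t f)"
    by (rule det_on_cong) (simp add: weighted_laplacian_def)
  also have "\<dots> = (\<Sum>F | F \<subseteq> k_cells K (int d) \<and> card F = card S.
      det_on S (\<lambda>s t. weighted_boundary K s (\<gamma> F t)) * det_on S (\<lambda>s t. weighted_boundary K s (\<gamma> F t)))"
    by (rule Cauchy_Binet[OF assms])
  also have "\<dots> = (\<Sum>F | F \<subseteq> k_cells K (int d) \<and> card F = card S.
     of_int ((det_on S (\<lambda>s t. incidence K s (\<gamma> F t)))\<^sup>2) * (\<Prod>f\<in>F. (indet f)\<^sup>2))"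
  proof (rule sum.cong[OF refl])
    fix F assume "F \<in> {F. F \<subseteq> k_cells K (int d) \<and> card F = card S}"
    hence b: "bij_betw (\<gamma> F) S F" using \<gamma> by blast
    show "det_on S (\<lambda>s t. weighted_boundary K s (\<gamma> F t)) * det_on S (\<lambda>s t. weighted_boundary K s (\<gamma> F t))
       = of_int ((det_on S (\<lambda>s t. incidence K s (\<gamma> F t)))\<^sup>2) * (\<Prod>f\<in>F. (indet f)\<^sup>2)"
      unfolding det_weighted_boundary[OF assms(1) b]
      by (simp add: power2_eq_square prod.distrib mult_ac)
  qed
  finally show ?thesis .
qed

theorem theorem2p12:
  fixes K :: "('a, 'c::linorder) cell_structure" and d :: nat
  assumes "finite_CW K" and "cells K \<noteq> {}" and "d \<ge> 1" and "CW_dim K = d" and "APC K"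
  shows "pi_hat K d =
           to_ac (tau_hat K d * of_nat (tau K (d - 1)) / of_nat ((hom_order K (int d - 2))\<^sup>2)) \<and>
         (\<forall>T \<in> spanning_trees K (d - 1). \<forall>U. U = k_cells (on_cells K T) (int d - 1) \<longrightarrow>
           tau_hat K d =
             of_nat ((hom_order K (int d - 2))\<^sup>2)
               / of_nat ((hom_order (on_cells K (U \<union> skeleton_cells K (int d - 2))) (int d - 2))\<^sup>2)
               * Determinant.det
                   (square_matrix (k_cells K (int d - 1) - U) (weighted_laplacian K d)))"
proof -
  interpret finite_CW_complex K by standard (rule assms(1))
  have betti: "red_betti K j = 0" if "j < int d" for j
    using assms(4,5) that by (simp add: APC_def)
  have d1: "int (d - 1) = int d - 1" using assms(3) by simp
  let ?I = "k_cells K (int d - 1)" and ?J = "k_cells K (int d)"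
  let ?L = "weighted_laplacian K d"
  have CJ: "C (int d) = Some ` ?J" and CI: "C (int d - 1) = Some ` ?I"
    using assms(3) by (simp_all add: C_nonneg)
  have finI: "finite ?I" and finJ: "finite ?J" by (rule finite_k_cells)+
  interpret L: torsion_step "cell_boundary K" "C (int d)" "C (int d - 1)"
    by (rule torsion_step_level) (simp add: betti)
  have "torsion_step (cell_boundary K) (C (int d - 1)) (C (int d - 1 - 1))"
    by (rule torsion_step_level) (simp add: betti)
  then interpret L': torsion_step "cell_boundary K" "C (int d - 1)" "C (int d - 2)" by simp
  define a where "a F = sub_index (cycles_on (C (int d - 1))) (boundaries_on (Some ` F))" for F
  define h where "h U = sub_index (cycles_on (C (int d - 2))) (boundaries_on (Some ` U))" for U
  define h0 where "h0 = hom_order K (int d - 2)"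
  define trees where "trees = {F. F \<subseteq> ?J \<and> basis_of (C (int d)) (Some ` F)}"
  define roots where "roots = {U. U \<subseteq> ?I \<and> basis_of (C (int d - 1)) (Some ` U)}"

  have tau_hat: "tau_hat K d = (\<Sum>F\<in>trees. of_nat ((a F)\<^sup>2) * (\<Prod>f\<in>F. (indet f)\<^sup>2))"
  proof -
    have "tau_hat K d = (\<Sum>F | F \<subseteq> ?J \<and> basis_of (C (int d)) (Some ` F).
        of_nat ((hom_order (on_cells K (skeleton_cells K (int d - 1) \<union> F)) (int d - 1))\<^sup>2) * (\<Prod>f\<in>F. (indet f)\<^sup>2))"
      unfolding tau_hat_def
      by (rule sum_spanning_trees[where g = "\<lambda>Y F. of_nat ((hom_order (on_cells K Y) (int d - 1))\<^sup>2) * (\<Prod>f\<in>F. (indet f)\<^sup>2)"])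
        (simp add: betti)
    also have "\<dots> = (\<Sum>F\<in>trees. of_nat ((a F)\<^sup>2) * (\<Prod>f\<in>F. (indet f)\<^sup>2))"
      unfolding trees_def by (intro sum.cong refl) (simp add: hom_order_tree a_def)
    finally show ?thesis .
  qed
  have h_tree: "hom_order (on_cells K (skeleton_cells K (int d - 2) \<union> U)) (int d - 2) = h U" if "U \<subseteq> ?I" for U
    using hom_order_tree[of U "d - 1"] that unfolding h_def d1 by simp
  have tau: "tau K (d - 1) = (\<Sum>U\<in>roots. (h U)\<^sup>2)"
  proof -
    have "tau K (d - 1) = (\<Sum>U | U \<subseteq> k_cells K (int (d - 1)) \<and> basis_of (C (int (d - 1))) (Some ` U).
        (hom_order (on_cells K (skeleton_cells K (int (d - 1) - 1) \<union> U)) (int (d - 1) - 1))\<^sup>2)"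
      unfolding tau_def
      by (rule sum_spanning_trees[where g = "\<lambda>Y F. (hom_order (on_cells K Y) (int (d - 1) - 1))\<^sup>2"])
        (simp add: betti d1)
    also have "\<dots> = (\<Sum>U\<in>roots. (h U)\<^sup>2)"
      unfolding roots_def d1 by (intro sum.cong refl) (simp add: h_tree)
    finally show ?thesis .
  qed
  have h_nz: "h U \<noteq> 0" if "U \<in> roots" for U
    using L'.sub_index_cycles_boundaries_nonzero[of "Some ` U"] that by (simp add: h_def roots_def)
  have a_nz: "a F \<noteq> 0" if "F \<in> trees" for F
    using L.sub_index_cycles_boundaries_nonzero[of "Some ` F"] that by (simp add: a_def trees_def)
  have h_tower: "h U = h0 * sub_index (boundaries_on (C (int d - 1))) (boundaries_on (Some ` U))" if "U \<subseteq> ?I" for U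
  proof -
    have UC: "Some ` U \<subseteq> C (int d - 1)" using that CI by auto
    hence "boundaries_on (Some ` U) \<subseteq> boundaries_on (C (int d - 1))"
      unfolding boundaries_on_def by (intro image_mono chains_on_mono)
    note sub_index_tower[OF add_subgroup_cycles add_subgroup_boundaries add_subgroup_boundaries this L'.bd_cycles]
    moreover have "h0 = sub_index (cycles_on (C (int d - 2))) (boundaries_on (C (int d - 1)))"
      by (simp add: h0_def hom_order_eq)
    ultimately show ?thesis by (simp only: h_def)
  qed

  \<comment> \<open>the minors of interest have size \<open>r\<close>, because the sizes of bases in consecutive dimensions are complementary\<close>
  obtain F0 where F0: "F0 \<in> trees"
  proof -
    obtain V where V: "basis_of (C (int d)) V" "{} \<subseteq> V"
      by (rule basis_exists[OF finite_C _ acyclic_on_empty]) auto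
    hence "V \<subseteq> Some ` ?J" using CJ by (simp add: basis_of_def)
    then obtain F where "F \<subseteq> ?J" "V = Some ` F" by (rule subset_imageE)
    thus thesis using V(1) by (intro that[of F]) (simp add: trees_def)
  qed
  obtain U0 where U0: "U0 \<in> roots"
  proof -
    obtain V where V: "basis_of (C (int d - 1)) V" "{} \<subseteq> V"
      by (rule basis_exists[OF finite_C _ acyclic_on_empty]) auto
    hence "V \<subseteq> Some ` ?I" using CI by (simp add: basis_of_def)
    then obtain U where "U \<subseteq> ?I" "V = Some ` U" by (rule subset_imageE)
    thus thesis using V(1) by (intro that[of U]) (simp add: roots_def)
  qed
  define r where "r = card F0"
  have compl: "C (int d - 1) - Some ` U = Some ` (?I - U)" for U using CI by auto
  have card_trees: "card F = r" if "F \<in> trees" for F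
    using that F0 card_basis_eq[OF finite_C, of "int d" "Some ` F" "Some ` F0"]
    by (simp add: trees_def r_def card_image_Some)
  have card_roots: "card (?I - U) = r" if "U \<in> roots" for U
    using that F0 L.card_basis_complement[of "Some ` F0" "Some ` U"]
    by (simp add: trees_def roots_def r_def compl card_image_Some)
  have h0_nz: "h0 \<noteq> 0" using h_nz[OF U0] h_tower[of U0] U0 by (auto simp: roots_def)

  \<comment> \<open>the square of a minor splits into a factor for its rows and a factor for its columns\<close>
  have minor_bases: "of_nat (h0\<^sup>2) * (of_int ((det_on (?I - U) (\<lambda>s t. incidence K s (\<gamma> t)))\<^sup>2) :: 'c ratfun)
      = of_nat ((h U)\<^sup>2) * of_nat ((a F)\<^sup>2)"
    if UF: "U \<in> roots" "F \<in> trees" and \<gamma>: "bij_betw \<gamma> (?I - U) F" for U F \<gamma>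
  proof -
    let ?D = "det_on (?I - U) (\<lambda>s t. incidence K s (\<gamma> t))"
    let ?\<gamma> = "\<lambda>x. Some (\<gamma> (the x))"
    have U: "U \<subseteq> ?I" "basis_of (C (int d - 1)) (Some ` U)" and F: "F \<subseteq> ?J" "basis_of (C (int d)) (Some ` F)"
      using UF by (auto simp: roots_def trees_def)
    have "bij_betw ?\<gamma> (C (int d - 1) - Some ` U) (Some ` F)"
      unfolding compl using \<gamma> by (auto simp: bij_betw_def inj_on_def image_iff)
    note L.incidence_det_bases(2)[OF F(2) U(2) this]
    hence "\<bar>?D\<bar> = int (sub_index (boundaries_on (C (int d - 1))) (boundaries_on (Some ` U)) * a F)"
      unfolding compl using incidence_det_cells[OF assms(3) _ F(1) \<gamma>] by (simp add: a_def)
    hence "int h0 * \<bar>?D\<bar> = int (h U * a F)" by (simp add: h_tower[OF U(1)])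
    hence "(int h0)\<^sup>2 * ?D\<^sup>2 = int ((h U)\<^sup>2 * (a F)\<^sup>2)"
      by (metis of_nat_mult of_nat_power power2_abs power_mult_distrib)
    hence "of_int ((int h0)\<^sup>2 * ?D\<^sup>2) = (of_int (int ((h U)\<^sup>2 * (a F)\<^sup>2)) :: 'c ratfun)" by (rule arg_cong)
    thus ?thesis by simp
  qed
  have minor_zero: "det_on S (\<lambda>s t. incidence K s (\<gamma> t)) = 0"
    if S: "S \<subseteq> ?I" and F: "F \<subseteq> ?J" and \<gamma>: "bij_betw \<gamma> S F" and not: "card S > r \<or> card S = r \<and> (?I - S \<notin> roots \<or> F \<notin> trees)"
    for S F \<gamma>
  proof (rule ccontr)
    assume nz: "det_on S (\<lambda>s t. incidence K s (\<gamma> t)) \<noteq> 0"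
    let ?\<gamma> = "\<lambda>x. Some (\<gamma> (the x))"
    have b: "bij_betw ?\<gamma> (Some ` S) (Some ` F)"
      using \<gamma> by (auto simp: bij_betw_def inj_on_def image_iff)
    have nz': "incidence_det (Some ` S) ?\<gamma> \<noteq> 0"
      using incidence_det_cells[OF assms(3) S F \<gamma>] nz by simp
    have SC: "Some ` S \<subseteq> C (int d - 1)" and FC: "Some ` F \<subseteq> C (int d)" using S F CI CJ by auto
    have bF0: "basis_of (C (int d)) (Some ` F0)" using F0 by (simp add: trees_def)
    have "card F = card S" using \<gamma> bij_betw_same_card by metis
    show False
    proof (cases "card S = r")
      case True
      hence "card (Some ` S) = card (Some ` F0)" by (simp add: card_image_Some r_def)
      from L.incidence_det_nonzero_imp_bases[OF bF0 SC this FC b nz']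
      have "basis_of (C (int d)) (Some ` F)" "basis_of (C (int d - 1)) (Some ` (?I - S))"
        using CI by (auto simp: image_set_diff)
      hence "F \<in> trees" "?I - S \<in> roots" using F by (auto simp: trees_def roots_def)
      thus False using not True by simp
    next
      case False
      have "finite (Some ` S)" using S finI finite_subset by blast
      hence "\<forall>w\<in>chains_on (Some ` F). restrict_chain (Some ` S) (cell_boundary K w) = 0 \<longrightarrow> w = 0"
        using incidence_det_nonzero_iff[OF _ b] nz' by blast
      hence "acyclic_on (Some ` F)" by (intro acyclic_onI) (simp add: restrict_chain_0)
      then obtain V where V: "basis_of (C (int d)) V" "Some ` F \<subseteq> V"
        by (rule basis_exists[OF finite_C FC])
      have "card V = r" using card_basis_eq[OF finite_C V(1) bF0] by (simp add: card_image_Some r_def)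
      moreover have "finite V" using V(1) finite_C finite_subset by (auto simp: basis_of_def)
      ultimately have "card F \<le> r" using card_mono[OF _ V(2)] by (simp add: card_image_Some)
      thus False using \<open>card F = card S\<close> False not by simp
    qed
  qed

  \<comment> \<open>the squares in the Cauchy--Binet formula make the choice of the bijections \<open>\<gamma>\<close> immaterial\<close>
  have bij: "\<exists>g. bij_betw g S F" if "S \<subseteq> ?I" "F \<subseteq> ?J" "card F = card S" for S F
    using that finI finJ finite_subset by (metis finite_same_card_bij)
  define \<gamma> where "\<gamma> S F = (SOME g. bij_betw g S F)" for S F :: "'c set"
  have \<gamma>: "bij_betw (\<gamma> S F) S F" if "S \<subseteq> ?I" "F \<subseteq> ?J" "card F = card S" for S F
    unfolding \<gamma>_def using someI_ex[OF bij[OF that]] .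
  have expand: "det_on S ?L = (\<Sum>F | F \<subseteq> ?J \<and> card F = card S.
       of_int ((det_on S (\<lambda>s t. incidence K s (\<gamma> S F t)))\<^sup>2) * (\<Prod>f\<in>F. (indet f)\<^sup>2))" if "S \<subseteq> ?I" for S
    using that finI finJ finite_subset by (intro det_weighted_laplacian \<gamma>) auto
  have zero: "det_on (?I - U) ?L = 0" if U: "U \<subseteq> ?I" "card (?I - U) > r \<or> card (?I - U) = r \<and> U \<notin> roots" for U
  proof -
    have S: "?I - U \<subseteq> ?I" by auto
    have eq: "?I - (?I - U) = U" using U by auto
    have "det_on (?I - U) (\<lambda>s t. incidence K s (\<gamma> (?I - U) F t)) = 0"
      if "F \<subseteq> ?J" "card F = card (?I - U)" for F
      by (rule minor_zero[OF S that(1) \<gamma>[OF S that]]) (use U(2) in \<open>auto simp: eq\<close>)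
    thus ?thesis unfolding expand[OF S] by (intro sum.neutral) auto
  qed
  have principal: "of_nat (h0\<^sup>2) * det_on (?I - U) ?L = of_nat ((h U)\<^sup>2) * tau_hat K d" if U: "U \<in> roots" for U
  proof -
    let ?S = "?I - U"
    have S: "?S \<subseteq> ?I" by auto
    have cardS: "card ?S = r" by (rule card_roots[OF U])
    let ?t = "\<lambda>F. of_int ((det_on ?S (\<lambda>s t. incidence K s (\<gamma> ?S F t)))\<^sup>2) * (\<Prod>f\<in>F. (indet f)\<^sup>2) :: 'c ratfun"
    have "det_on ?S ?L = (\<Sum>F\<in>trees. ?t F)"
      unfolding expand[OF S]
    proof (rule sum.mono_neutral_right)
      show "finite {F. F \<subseteq> ?J \<and> card F = card ?S}" using finJ by simp
      show "trees \<subseteq> {F. F \<subseteq> ?J \<and> card F = card ?S}" using card_trees cardS by (auto simp: trees_def)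
      show "\<forall>F\<in>{F. F \<subseteq> ?J \<and> card F = card ?S} - trees. ?t F = 0"
      proof
        fix F assume "F \<in> {F. F \<subseteq> ?J \<and> card F = card ?S} - trees"
        hence F: "F \<subseteq> ?J" "card F = card ?S" "F \<notin> trees" by auto
        show "?t F = 0" using minor_zero[OF S F(1) \<gamma>[OF S F(1,2)]] F(3) cardS by simp
      qed
    qed
    hence "of_nat (h0\<^sup>2) * det_on ?S ?L = (\<Sum>F\<in>trees. of_nat (h0\<^sup>2) * ?t F)"
      by (simp only: sum_distrib_left)
    also have "\<dots> = (\<Sum>F\<in>trees. of_nat ((h U)\<^sup>2) * (of_nat ((a F)\<^sup>2) * (\<Prod>f\<in>F. (indet f)\<^sup>2)))"
    proof (rule sum.cong[OF refl])
      fix F assume F: "F \<in> trees"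
      have "bij_betw (\<gamma> ?S F) ?S F"
        using F card_trees[OF F] cardS by (intro \<gamma>) (auto simp: trees_def)
      from minor_bases[OF U F this]
      show "of_nat (h0\<^sup>2) * ?t F = of_nat ((h U)\<^sup>2) * (of_nat ((a F)\<^sup>2) * (\<Prod>f\<in>F. (indet f)\<^sup>2))"
        by (simp only: mult.assoc[symmetric])
    qed
    also have "\<dots> = of_nat ((h U)\<^sup>2) * tau_hat K d" by (simp only: tau_hat sum_distrib_left)
    finally show ?thesis .
  qed
  have h0_nz': "(of_nat (h0\<^sup>2) :: 'c ratfun) \<noteq> 0"
    using h0_nz by (subst of_nat_ratfun_eq_0_iff) simp

  have part2: "tau_hat K d =
      of_nat ((hom_order K (int d - 2))\<^sup>2)
        / of_nat ((hom_order (on_cells K (U \<union> skeleton_cells K (int d - 2))) (int d - 2))\<^sup>2)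
        * Determinant.det (square_matrix (?I - U) ?L)"
    if T: "T \<in> spanning_trees K (d - 1)" and UT: "U = k_cells (on_cells K T) (int d - 1)" for T U
  proof -
    have "red_betti K (int (d - 1) - 1) = 0" by (simp add: betti d1)
    from spanning_tree_iff[OF this, of T] T
    have "T \<subseteq> skeleton_cells K (int d - 1)" "basis_of (C (int d - 1)) (Some ` U)"
      unfolding d1 UT k_cells_on_cells by auto
    hence U: "U \<in> roots" using UT by (auto simp: roots_def k_cells_def skeleton_cells_def)
    hence "U \<subseteq> ?I" by (simp add: roots_def)
    hence hU: "hom_order (on_cells K (U \<union> skeleton_cells K (int d - 2))) (int d - 2) = h U"
      using h_tree[of U] by (simp add: Un_commute)
    have hU_nz: "(of_nat ((h U)\<^sup>2) :: 'c ratfun) \<noteq> 0"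
      using h_nz[OF U] by (subst of_nat_ratfun_eq_0_iff) simp
    have "Determinant.det (square_matrix (?I - U) ?L) = det_on (?I - U) ?L"
      using finI by (intro det_square_matrix) simp
    moreover have "tau_hat K d = of_nat (h0\<^sup>2) * det_on (?I - U) ?L / of_nat ((h U)\<^sup>2)"
      by (simp only: principal[OF U] nonzero_mult_div_cancel_left[OF hU_nz])
    ultimately show ?thesis
      by (simp only: hU h0_def[symmetric] times_divide_eq_left)
  qed

  \<comment> \<open>the coefficient of degree \<open>?n - r\<close> is the lowest nonzero one, and is itself a sum of principal minors\<close>
  have part1: "pi_hat K d =
      to_ac (tau_hat K d * of_nat (tau K (d - 1)) / of_nat ((hom_order K (int d - 2))\<^sup>2))"
  proof -
    let ?n = "card ?I" and ?m = "card U0"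
    let ?A = "square_matrix ?I ?L"
    let ?p = "tau_hat K d * of_nat (tau K (d - 1)) / of_nat (h0\<^sup>2)"
    have U0I: "U0 \<subseteq> ?I" using U0 by (simp add: roots_def)
    have card_diff: "card (?I - U) = ?n - card U" "card U \<le> ?n" if "U \<subseteq> ?I" for U
      using that finI by (auto intro: card_Diff_subset finite_subset card_mono)
    have r: "r = ?n - ?m" "?m \<le> ?n" using card_roots[OF U0] card_diff[OF U0I] by auto
    have A: "?A \<in> carrier_mat ?n ?n" by (simp add: square_matrix_def)
    have hom: "comm_ring_hom (to_ac :: 'c ratfun \<Rightarrow> _)" by standard (simp_all add: to_ac_add to_ac_mult)
    interpret ac: comm_ring_hom "to_ac :: 'c ratfun \<Rightarrow> _" by (rule hom)
    have coeff: "Polynomial.coeff (char_poly (map_mat to_ac ?A)) m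
        = to_ac (\<Sum>U | U \<subseteq> ?I \<and> card U = m. (-1) ^ (?n - m) * det_on (?I - U) ?L)" for m
      unfolding comm_ring_hom.char_poly_hom[OF hom A] ac.coeff_map_poly_hom
        coeff_char_poly_square_matrix[OF finI] ..
    have low: "Polynomial.coeff (char_poly (map_mat to_ac ?A)) i = 0" if "i < ?m" for i
    proof -
      have "(\<Sum>U | U \<subseteq> ?I \<and> card U = i. (-1) ^ (?n - i) * det_on (?I - U) ?L) = 0"
      proof (rule sum.neutral, rule ballI)
        fix U assume "U \<in> {U. U \<subseteq> ?I \<and> card U = i}"
        hence U: "U \<subseteq> ?I" "card U = i" by auto
        hence "card (?I - U) > r" using card_diff[OF U(1)] r that by linarith
        thus "(-1) ^ (?n - i) * det_on (?I - U) ?L = 0" using zero[OF U(1)] by simp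
      qed
      thus ?thesis unfolding coeff by simp
    qed
    have "(\<Sum>U | U \<subseteq> ?I \<and> card U = ?m. (-1) ^ (?n - ?m) * det_on (?I - U) ?L)
        = (\<Sum>U\<in>roots. (-1) ^ r * det_on (?I - U) ?L)"
      unfolding r(1)
    proof (rule sum.mono_neutral_right)
      show "finite {U. U \<subseteq> ?I \<and> card U = ?m}" using finI by simp
      show "roots \<subseteq> {U. U \<subseteq> ?I \<and> card U = ?m}"
      proof
        fix U assume U: "U \<in> roots"
        hence "U \<subseteq> ?I" by (simp add: roots_def)
        thus "U \<in> {U. U \<subseteq> ?I \<and> card U = ?m}" using card_roots[OF U] card_diff[of U] r by auto
      qed
      show "\<forall>U\<in>{U. U \<subseteq> ?I \<and> card U = ?m} - roots. (-1) ^ (?n - ?m) * det_on (?I - U) ?L = 0"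
      proof
        fix U assume "U \<in> {U. U \<subseteq> ?I \<and> card U = ?m} - roots"
        hence U: "U \<subseteq> ?I" "card U = ?m" "U \<notin> roots" by auto
        have "card (?I - U) = r" using card_diff[OF U(1)] U(2) r by simp
        thus "(-1) ^ (?n - ?m) * det_on (?I - U) ?L = 0" using zero[OF U(1)] U(3) by simp
      qed
    qed
    also have "\<dots> = (\<Sum>U\<in>roots. (-1) ^ r * (of_nat ((h U)\<^sup>2) * tau_hat K d / of_nat (h0\<^sup>2)))"
    proof (rule sum.cong[OF refl])
      fix U assume "U \<in> roots"
      hence "det_on (?I - U) ?L = of_nat ((h U)\<^sup>2) * tau_hat K d / of_nat (h0\<^sup>2)"
        by (simp only: principal[symmetric] nonzero_mult_div_cancel_left[OF h0_nz'])
      thus "(-1) ^ r * det_on (?I - U) ?L = (-1) ^ r * (of_nat ((h U)\<^sup>2) * tau_hat K d / of_nat (h0\<^sup>2))"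
        by (simp only:)
    qed
    also have "\<dots> = (-1) ^ r * ?p"
      unfolding tau of_nat_sum sum_distrib_left sum_distrib_right sum_divide_distrib
      by (simp only: mult.commute)
    finally have coeff_m: "Polynomial.coeff (char_poly (map_mat to_ac ?A)) ?m = to_ac ((-1) ^ r * ?p)"
      unfolding coeff by (simp only:)
    have "tau_hat K d \<noteq> 0"
      unfolding tau_hat
    proof (rule sum_square_monomials_nonzero[OF _ _ F0])
      show "finite trees" unfolding trees_def using finJ by simp
      show "finite F" if "F \<in> trees" for F using that finJ finite_subset by (auto simp: trees_def)
      show "(a F0)\<^sup>2 \<noteq> 0" using a_nz[OF F0] by simp
    qed
    moreover have "tau K (d - 1) \<noteq> 0"
    proof -
      have "finite roots" unfolding roots_def using finI by simp
      hence "(h U0)\<^sup>2 \<le> tau K (d - 1)" unfolding tau using U0 by (intro member_le_sum) auto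
      thus ?thesis using h_nz[OF U0] by (metis le_zero_eq power_not_zero)
    qed
    hence "(of_nat (tau K (d - 1)) :: 'c ratfun) \<noteq> 0" by (simp only: of_nat_ratfun_eq_0_iff not_False_eq_True)
    ultimately have p_nz: "?p \<noteq> 0"
      using h0_nz' by (simp only: divide_eq_0_iff mult_eq_0_iff de_Morgan_disj not_False_eq_True simp_thms)
    have sign: "(-1) ^ r * ((-1) ^ r * x) = x" for x :: "'c ratfun"
      by (simp add: mult.assoc[symmetric] flip: power_mult_distrib)
    have "(-1) ^ r * ?p \<noteq> 0"
    proof
      assume "(-1) ^ r * ?p = 0"
      with sign[of ?p] have "?p = 0" by (simp only: mult_zero_right)
      with p_nz show False by (rule notE)
    qed
    hence nz: "Polynomial.coeff (char_poly (map_mat to_ac ?A)) ?m \<noteq> 0"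
      unfolding coeff_m to_ac_eq_0_iff .
    have A': "map_mat to_ac ?A \<in> carrier_mat ?n ?n" using A by simp
    have e1: "pi_hat K d = prod_nonzero_eigenvalues (map_mat to_ac ?A)"
      by (simp only: pi_hat_def)
    have e2: "prod_nonzero_eigenvalues (map_mat to_ac ?A)
        = (-1) ^ (?n - ?m) * Polynomial.coeff (char_poly (map_mat to_ac ?A)) ?m"
      by (rule prod_nonzero_eigenvalues_eq_coeff[OF A' low nz])
    have e3: "(-1) ^ (?n - ?m) * to_ac x = to_ac ((-1) ^ r * x)" for x :: "'c ratfun"
      by (simp only: r(1) to_ac_mult to_ac_power to_ac_minus to_ac_1)
    show ?thesis
      by (simp only: e1 e2 coeff_m e3 sign h0_def[symmetric])
  qed
  show ?thesis using part1 part2 by blast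
qed

end
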